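(* Let $a<b$ be coprime positive integers, let $1\le k\le a$, and let $X$ be the set of $\pi\in\mathsf{NC}(a,b)$ having exactly $k$ blocks. Let $C=\mathbb{Z}_{b-1}$ act on $X$ by rotation. Then $(X,C,X(q))$ exhibits the cyclic sieving phenomenon, where $$X(q)=\mathsf{Nar}_q(a,b,k)=\frac{1}{[a]_q}\begin{bmatrix}a\\k\end{bmatrix}_q\begin{bmatrix}b-1\\k-1\end{bmatrix}_q.$$
   Context: Let $a<b$ be coprime positive integers and $[b-1]=\{1,\dots,b-1\}$. An $a,b$-Dyck path is a lattice path from $(0,0)$ to $(b,a)$ using unit north and east steps that stays weakly above the line $y=\frac{a}{b}x$. A valley of such a path $D$ is a lattice point of $D$ immediately preceded by an east step and immediately followed by a north step. From each valley $P$ fire the laser $\ell(P)$: the segment of slope $\frac ab$ from $P$ going northeast until it first meets $D$ again. Label the east endpoints of the first $b-1$ east steps of $D$ from left to right by $1,\dots,b-1$, each label regarded as sitting slightly below its lattice point. The set partition $\pi(D)$ of $[b-1]$ declares $i\sim j$ iff labels $i,j$ are not separated by any valley laser. $\mathsf{NC}(a,b)=\{\pi(D): D\text{ an }a,b\text{-Dyck path}\}$. Rotation: a generator of $\mathbb Z_{b-1}$ acts by $\mathtt{rot}$, the permutation $i\mapsto i+1$ ($i<b-1$), $b-1\mapsto1$, applied blockwise. Notation: $[n]_q=1+q+\cdots+q^{n-1}$, $[n]_q!=[1]_q\cdots[n]_q$, $\begin{bmatrix}n\\k\end{bmatrix}_q=\frac{[n]_q!}{[k]_q![n-k]_q!}$.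 Cyclic sieving: for a finite set $X$ acted on by a cyclic group $C=\langle c\rangle$ of order $n$ and a polynomial $X(q)$ with nonnegative integer coefficients, $(X,C,X(q))$ exhibits the cyclic sieving phenomenon if $X(\zeta^d)=|\{x\in X: c^d.x=x\}|$ for all $d\ge0$, where $\zeta$ is a primitive $n$-th root of unity. *)

theory Defs
  imports
    "HOL-Algebra.Group_Action"
    "HOL-Algebra.Elementary_Groups"
    "HOL-Analysis.Analysis"
    "HOL-Computational_Algebra.Polynomial_Factorial"
begin

section \<open>Rational Dyck paths\<close>

datatype step = North | East

definition vertex :: "step list \<Rightarrow> nat \<Rightarrow> real \<times> real" where
  "vertex D n = (real (count_list (take n D) East), real (count_list (take n D) North))"

definition path_points :: "step list \<Rightarrow> (real \<times> real) set" where
  "path_points D = (\<Union>n<length D. closed_segment (vertex D n) (vertex D (Suc n)))"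

definition dyck_paths :: "nat \<Rightarrow> nat \<Rightarrow> step list set" where
  "dyck_paths a b = {D. vertex D (length D) = (real b, real a) \<and>
                        (\<forall>(x, y) \<in> path_points D. y \<ge> real a / real b * x)}"

definition valleys :: "step list \<Rightarrow> (real \<times> real) set" where
  "valleys D = {vertex D (Suc n) |n. Suc n < length D \<and> D ! n = East \<and> D ! Suc n = North}"

text \<open>The half-line from \<open>P\<close> in direction \<open>(b, a)\<close>, cut off at the first later point of
  \<open>D\<close>; that point is included, since only the parameters strictly before \<open>t\<close> have to avoid \<open>D\<close>.\<close>

definition laser :: "nat \<Rightarrow> nat \<Rightarrow> step list \<Rightarrow> real \<times> real \<Rightarrow> (real \<times> real) set" where
  "laser a b D P = {P + t *\<^sub>R (real b, real a) |t.
     0 \<le> t \<and> (\<forall>s. 0 < s \<and> s < t \<longrightarrow> P + s *\<^sub>R (real b, real a) \<notin> path_points D)}"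

section \<open>Rational noncrossing partitions\<close>

definition east_steps :: "step list \<Rightarrow> nat list" where
  "east_steps D = filter (\<lambda>n. D ! n = East) [0..<length D]"

text \<open>Label \<open>i\<close>, lowered by \<open>\<epsilon>\<close> from the east endpoint of the \<open>i\<close>-th east step
  (counted from 1).\<close>

definition label :: "step list \<Rightarrow> real \<Rightarrow> nat \<Rightarrow> real \<times> real" where
  "label D \<epsilon> i = vertex D (Suc (east_steps D ! (i - 1))) - (0, \<epsilon>)"

text \<open>The path alone is an arc and does not disconnect the plane; a laser \<open>L\<close> together with the
  stretch of the path between its two endpoints encloses a bounded region.  Hence two labels are
  separated by \<open>L\<close> iff they lie in different components of the complement of path and laser.
  \<open>Slightly below\<close> means for all sufficiently small \<open>\<epsilon> > 0\<close>.\<close>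

definition separated :: "step list \<Rightarrow> (real \<times> real) set \<Rightarrow> nat \<Rightarrow> nat \<Rightarrow> bool" where
  "separated D L i j \<longleftrightarrow>
     (\<forall>\<^sub>F \<epsilon> in at_right 0. \<not> connected_component (- (path_points D \<union> L)) (label D \<epsilon> i) (label D \<epsilon> j))"

definition laser_partition :: "nat \<Rightarrow> nat \<Rightarrow> step list \<Rightarrow> nat set set" where
  "laser_partition a b D =
     {1..b - 1} // {(i, j). i \<in> {1..b - 1} \<and> j \<in> {1..b - 1} \<and>
                            (\<forall>P \<in> valleys D. \<not> separated D (laser a b D P) i j)}"

definition NC :: "nat \<Rightarrow> nat \<Rightarrow> nat set set set" where
  "NC a b = laser_partition a b ` dyck_paths a b"

definition NC_blocks :: "nat \<Rightarrow> nat \<Rightarrow> nat \<Rightarrow> nat set set set" where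
  "NC_blocks a b k = {\<pi> \<in> NC a b. card \<pi> = k}"

section \<open>Rotation\<close>

definition rot :: "nat \<Rightarrow> nat \<Rightarrow> nat" where
  "rot n i = (if i < n then i + 1 else 1)"

definition rot_partition :: "nat \<Rightarrow> nat set set \<Rightarrow> nat set set" where
  "rot_partition n \<pi> = (\<lambda>B. rot n ` B) ` \<pi>"

text \<open>Elements of \<open>integer_mod_group n\<close> are the representatives \<open>0, \<dots>, n - 1\<close>.  The
  restriction to \<open>X\<close> is needed because permutations in \<open>BijGroup X\<close> are extensional.\<close>

definition rotation_action ::
    "nat \<Rightarrow> nat set set set \<Rightarrow> int \<Rightarrow> nat set set \<Rightarrow> nat set set" where
  "rotation_action n X d = restrict (rot_partition n ^^ nat d) X"

section \<open>Cyclic sieving\<close>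

definition primitive_unity_root :: "nat \<Rightarrow> complex \<Rightarrow> bool" where
  "primitive_unity_root n \<zeta> \<longleftrightarrow> \<zeta> ^ n = 1 \<and> (\<forall>m. 0 < m \<and> m < n \<longrightarrow> \<zeta> ^ m \<noteq> 1)"

definition cyclic_sieving ::
    "('g, 'm) monoid_scheme \<Rightarrow> 'g \<Rightarrow> ('g \<Rightarrow> 'x \<Rightarrow> 'x) \<Rightarrow> 'x set \<Rightarrow> int poly \<Rightarrow> bool" where
  "cyclic_sieving G c \<phi> X p \<longleftrightarrow>
     finite X \<and> finite (carrier G) \<and> group_action G X \<phi> \<and>
     c \<in> carrier G \<and> generate G {c} = carrier G \<and>
     (\<forall>i. coeff p i \<ge> 0) \<and>
     (\<forall>\<zeta>. primitive_unity_root (Coset.order G) \<zeta> \<longrightarrow>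
        (\<forall>d::nat. poly (map_poly of_int p) (\<zeta> ^ d) =
                  of_nat (card {x \<in> X. \<phi> (c [^]\<^bsub>G\<^esub> d) x = x})))"

section \<open>Rational q-Narayana numbers\<close>

text \<open>All quotients are formed in the fraction field of the integer polynomials in \<open>q\<close>.\<close>

definition q_int :: "nat \<Rightarrow> int poly fract" where
  "q_int n = (\<Sum>i<n. to_fract [:0, 1:] ^ i)"

definition q_fact :: "nat \<Rightarrow> int poly fract" where
  "q_fact n = (\<Prod>i=1..n. q_int i)"

definition q_binomial :: "nat \<Rightarrow> nat \<Rightarrow> int poly fract" where
  "q_binomial n k = q_fact n / (q_fact k * q_fact (n - k))"

definition q_narayana :: "nat \<Rightarrow> nat \<Rightarrow> nat \<Rightarrow> int poly fract" where
  "q_narayana a b k = 1 / q_int a * q_binomial a k * q_binomial (b - 1) (k - 1)"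

end

theory Submission
  imports Defs "HOL-Library.Periodic_Fun"
begin

text \<open>
  A Dyck path is recorded by the numbers of north steps on the vertical lines \<open>x = 0, \<dots>, b - 2\<close>,
  repeated periodically with period \<open>N = b - 1\<close>. For such a word \<open>u\<close> let \<open>ht u\<close> be the walk with
  steps \<open>b u\<^sub>j - a\<close>, and make the last earlier time at which the walk was lower the parent of a time.
  The laser from a valley covers the labels up to the next time the walk falls to the height of the
  valley, that is, the descendants of the valley, so two labels are in the same block iff they are
  siblings. In this form the partition makes sense for every periodic word of sum at most \<open>a\<close>, and
  rotating the partition is shifting the word; if the sum is less than \<open>a\<close>, the record lows of the
  walk form one further block, whose rank is the missing mass. A block may carry its rank in front of
  any of its elements, and a word is determined by its partition once the place where the Dyck path
  starts is fixed; hence the set of these partitions is closed under rotation.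

  For \<open>N = e g\<close> with \<open>e \<ge> 2\<close> the partitions fixed by the rotation by \<open>g\<close> correspond to the words of
  period \<open>g\<close>: of full sum if no block is fixed, and of smaller sum if there is a fixed (central)
  block. These are counted by products of binomial coefficients, and so are all partitions, by the
  cycle lemma. The q-Narayana polynomial \<open>p\<close> takes the same values by the q-Lucas theorem, since
  \<open>[b] p = [b, k] [a - 1, k - 1]\<close>.

  Integrality of \<open>p\<close> follows from a Bezout identity for \<open>[a]\<close> and \<open>[b]\<close>. Nonnegativity follows because
  Gaussian polynomials are symmetric and unimodal, which is seen from the action of \<open>sl\<^sub>2\<close> on subsets,
  and products of symmetric unimodal polynomials are again symmetric and unimodal.
\<close>

section \<open>Words and their prefix sums\<close>

abbreviation periodic :: "(int \<Rightarrow> 'a) \<Rightarrow> int \<Rightarrow> bool" where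
  "periodic u n \<equiv> periodic_fun_simple u n"

lemma periodic_add_mult:
  assumes "periodic u n" shows "u (j + k * n) = u j"
proof -
  interpret periodic_fun_simple u n by (rule assms)
  show ?thesis using plus_of_int[of j k] by simp
qed

lemma periodic_shift_mult: "periodic u n \<Longrightarrow> (\<lambda>j. u (j + k * n)) = u"
  by (simp add: periodic_add_mult)

lemma periodic_mod: "periodic u n \<Longrightarrow> u (j mod n) = u j"
  using periodic_add_mult[of u n "j mod n" "j div n"] by (simp add: algebra_simps)

lemma periodic_dvd_diff:
  assumes "periodic u n" "n dvd i - j" shows "u i = u j"
proof -
  obtain k where "i - j = n * k" using assms(2) by (auto simp: dvd_def)
  then show ?thesis using periodic_add_mult[OF assms(1), of j k] by (simp add: algebra_simps)
qed

lemma periodic_shift: "periodic u n \<Longrightarrow> periodic (\<lambda>j. u (j + c)) n"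
  unfolding periodic_fun_simple_def by (metis add.assoc add.commute)

lemma periodic_multiple: "periodic u n \<Longrightarrow> periodic u (k * n)"
  using periodic_add_mult[of u n] by (simp add: periodic_fun_simple_def)

definition psum :: "(int \<Rightarrow> nat) \<Rightarrow> int \<Rightarrow> int" where
  "psum u j = (if 0 \<le> j then \<Sum>i\<in>{0..<j}. int (u i) else - (\<Sum>i\<in>{j..<0}. int (u i)))"

lemma psum_0 [simp]: "psum u 0 = 0"
  by (simp add: psum_def)

lemma psum_add_1: "psum u (j + 1) = psum u j + int (u j)"
proof (cases "0 \<le> j")
  case True
  then have "{0..<j + 1} = insert j {0..<j}" by auto
  then show ?thesis using True by (simp add: psum_def)
next
  case False
  then have "{j..<0} = insert j {j + 1..<0}" by auto
  then show ?thesis using False by (auto simp: psum_def)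
qed

lemma psum_unique:
  assumes "\<And>j. f (j + 1) = f j + int (u j)"
  shows "f j = f 0 + psum u j"
proof -
  interpret periodic_fun_simple' "\<lambda>j. f j - psum u j"
    by unfold_locales (simp add: assms psum_add_1)
  show ?thesis using of_int[of j] by simp
qed

lemma psum_shift: "psum (\<lambda>j. u (j + c)) j = psum u (j + c) - psum u c"
  using psum_unique[of "\<lambda>j. psum u (j + c)" "\<lambda>j. u (j + c)" j] psum_add_1[of u "_ + c"]
  by (simp add: add.commute add.left_commute)

lemma psum_add_period: "periodic u n \<Longrightarrow> psum u (j + n) = psum u j + psum u n"
  using psum_shift[of u n j] periodic_shift_mult[of u n 1] by simp

lemma psum_add_mult_period:
  assumes "periodic u n" shows "psum u (j + k * n) = psum u j + k * psum u n"
proof -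
  interpret periodic_fun_simple' "\<lambda>k. psum u (j + k * n) - k * psum u n"
    using psum_add_period[OF assms, of "j + _ * n"] by unfold_locales (simp add: algebra_simps)
  show ?thesis using of_int[of k] by simp
qed

lemma psum_mult_period: "periodic u n \<Longrightarrow> psum u (k * n) = k * psum u n"
  using psum_add_mult_period[of u n 0] by simp

lemma psum_shift_period: "periodic u n \<Longrightarrow> psum (\<lambda>j. u (j + c)) n = psum u n"
  using psum_add_period[of u n c] by (simp add: psum_shift add.commute)

lemma psum_diff:
  assumes "i \<le> j" shows "psum u j - psum u i = (\<Sum>k\<in>{i..<j}. int (u k))"
  using assms
proof (induction j rule: int_ge_induct)
  case (step j)
  then have "{i..<j + 1} = insert j {i..<j}" by auto
  then show ?case using step by (simp add: psum_add_1)
qed simp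

lemma psum_eq_sum: "0 \<le> n \<Longrightarrow> psum u n = (\<Sum>k\<in>{0..<n}. int (u k))"
  by (simp add: psum_def)

lemma psum_nonneg: "0 \<le> n \<Longrightarrow> 0 \<le> psum u n"
  by (simp add: psum_eq_sum sum_nonneg)

lemma psum_cong: "0 \<le> n \<Longrightarrow> (\<And>i. 0 \<le> i \<Longrightarrow> i < n \<Longrightarrow> u i = v i) \<Longrightarrow> psum u n = psum v n"
  by (simp add: psum_eq_sum)

definition support :: "(int \<Rightarrow> nat) \<Rightarrow> int \<Rightarrow> int" where
  "support u = psum (\<lambda>j. of_bool (0 < u j))"

lemma support_eq_card: "0 \<le> n \<Longrightarrow> support u n = int (card {p \<in> {0..<n}. 0 < u p})"
  by (simp add: support_def psum_eq_sum sum.If_cases of_bool_def if_distrib Int_def cong: if_cong)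

lemma support_cong:
  "0 \<le> n \<Longrightarrow> (\<And>i. 0 \<le> i \<Longrightarrow> i < n \<Longrightarrow> u i = v i) \<Longrightarrow> support u n = support v n"
  unfolding support_def by (rule psum_cong) simp_all

lemma periodic_indicator: "periodic u n \<Longrightarrow> periodic (\<lambda>j. of_bool (0 < u j)) n"
  by (simp add: periodic_fun_simple_def)

lemma support_mult_period: "periodic u n \<Longrightarrow> support u (k * n) = k * support u n"
  unfolding support_def by (intro psum_mult_period periodic_indicator)

lemma support_shift_period: "periodic u n \<Longrightarrow> support (\<lambda>j. u (j + c)) n = support u n"
  unfolding support_def by (rule psum_shift_period[OF periodic_indicator])

definition periodic_upd :: "int \<Rightarrow> (int \<Rightarrow> 'a) \<Rightarrow> int \<Rightarrow> 'a \<Rightarrow> int \<Rightarrow> 'a" where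
  "periodic_upd n u c x = (\<lambda>j. if n dvd j - c then x else u j)"

lemma periodic_periodic_upd: "periodic u n \<Longrightarrow> periodic (periodic_upd n u c x) n"
proof -
  have "n dvd j + n - c \<longleftrightarrow> n dvd j - c" for j
    using dvd_add_left_iff[of n n "j - c"] by (simp add: algebra_simps)
  then show "periodic u n \<Longrightarrow> periodic (periodic_upd n u c x) n"
    by (simp add: periodic_fun_simple_def periodic_upd_def)
qed

lemma periodic_upd_upd: "periodic_upd n (periodic_upd n u c x) c y = periodic_upd n u c y"
  by (auto simp: periodic_upd_def)

lemma periodic_upd_triv: "periodic u n \<Longrightarrow> periodic_upd n u c (u c) = u"
  using periodic_dvd_diff by (fastforce simp: periodic_upd_def)

lemma psum_periodic_upd:
  assumes "c < j" "j \<le> c + n"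
  shows "psum (periodic_upd n u c x) j - psum (periodic_upd n u c x) c =
    psum u j - psum u c + int x - int (u c)"
proof -
  have "{c..<j} = insert c {c + 1..<j}" using assms by auto
  then have split: "psum v j - psum v c = int (v c) + (\<Sum>k\<in>{c + 1..<j}. int (v k))" for v
    using psum_diff[of c j v] assms(1) by simp
  have "periodic_upd n u c x k = u k" if "k \<in> {c + 1..<j}" for k
    using that assms zdvd_not_zless[of "k - c" n] by (auto simp: periodic_upd_def)
  then show ?thesis by (simp add: split periodic_upd_def)
qed

lemma psum_periodic_upd_period:
  assumes "periodic u n" "0 < n"
  shows "psum (periodic_upd n u c x) n = psum u n + int x - int (u c)"
  using psum_periodic_upd[of c "c + n" n u x] assms
  by (simp add: psum_add_period periodic_periodic_upd)

lemma support_periodic_upd: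
  assumes "periodic u n" "0 < n"
  shows "support (periodic_upd n u c x) n = support u n + of_bool (0 < x) - of_bool (0 < u c)"
proof -
  have "(\<lambda>j. of_bool (0 < periodic_upd n u c x j) :: nat) =
      periodic_upd n (\<lambda>j. of_bool (0 < u j)) c (of_bool (0 < x))"
    by (auto simp: periodic_upd_def)
  then show ?thesis
    using psum_periodic_upd_period[OF periodic_indicator[OF assms(1)] assms(2), of c "of_bool (0 < x)"]
    unfolding support_def by simp
qed

lemma int_interval_argmin:
  fixes f :: "int \<Rightarrow> 'a :: linorder"
  assumes "0 < n"
  obtains i where "0 \<le> i" "i < n" "\<And>j. 0 \<le> j \<Longrightarrow> j < n \<Longrightarrow> f i \<le> f j"
proof -
  have "finite {0..<n}" "{0..<n} \<noteq> {}" using assms by auto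
  from arg_min_if_finite(1)[OF this, of f] arg_min_least[OF this, of _ f]
  show ?thesis by (intro that[of "arg_min_on f {0..<n}"]) auto
qed

lemma int_first_above:
  fixes c j :: int
  assumes "c < j" "P j"
  obtains i where "c < i" "i \<le> j" "P i" "\<And>k. c < k \<Longrightarrow> k < i \<Longrightarrow> \<not> P k"
proof -
  have fin: "finite {i \<in> {c<..j}. P i}" and mem: "j \<in> {i \<in> {c<..j}. P i}"
    using assms by (auto intro: finite_subset[of _ "{c<..j}"])
  define i where "i = Min {i \<in> {c<..j}. P i}"
  have "i \<in> {i \<in> {c<..j}. P i}" unfolding i_def using Min_in[OF fin] mem by blast
  moreover have "\<not> P k" if "c < k" "k < i" for k
    using that Min_le[OF fin, of k] calculation unfolding i_def[symmetric] by auto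
  ultimately show ?thesis using that by auto
qed

lemma int_last_below:
  fixes c j :: int
  assumes "j < c" "P j"
  obtains i where "i < c" "j \<le> i" "P i" "\<And>k. i < k \<Longrightarrow> k < c \<Longrightarrow> \<not> P k"
proof -
  obtain i where "- c < i" "i \<le> - j" "P (- i)" and max: "\<And>k. - c < k \<Longrightarrow> k < i \<Longrightarrow> \<not> P (- k)"
    using int_first_above[of "- c" "- j" "\<lambda>i. P (- i)"] assms by auto
  moreover have "\<not> P k" if "- i < k" "k < c" for k using max[of "- k"] that by simp
  ultimately show ?thesis by (intro that[of "- i"]) auto
qed

section \<open>The forest of a walk\<close>

locale slope =
  fixes a b N :: int
  assumes a_pos: "0 < a" and a_less: "a < b" and coprime_ab: "coprime a b" and b_eq: "b = N + 1"
begin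

lemma N_pos: "0 < N" and b_pos: "0 < b"
  using a_pos a_less b_eq by simp_all

lemma b_mult: "b * x = N * x + x"
  by (simp add: b_eq algebra_simps)

definition ht :: "(int \<Rightarrow> nat) \<Rightarrow> int \<Rightarrow> int" where
  "ht u j = b * psum u j - a * j"

lemma ht_0 [simp]: "ht u 0 = 0"
  by (simp add: ht_def)

lemma ht_add_1: "ht u (j + 1) = ht u j + b * int (u j) - a"
  unfolding ht_def psum_add_1 by (simp add: algebra_simps)

lemma ht_add_1_ge: "ht u j - a \<le> ht u (j + 1)"
  using b_pos by (simp add: ht_add_1)

lemma ht_less_add_1_iff: "ht u j < ht u (j + 1) \<longleftrightarrow> 0 < u j"
proof (cases "u j")
  case (Suc n)
  have "b * 1 \<le> b * int (u j)" using Suc b_pos by (intro mult_left_mono) auto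
  then show ?thesis using Suc ht_add_1[of u j] a_less by simp
qed (use ht_add_1[of u j] a_pos in simp)

lemma ht_shift: "ht (\<lambda>j. u (j + c)) j = ht u (j + c) - ht u c"
  by (simp add: ht_def psum_shift algebra_simps)

lemma ht_add_period: "periodic u n \<Longrightarrow> ht u (j + n) = ht u j + ht u n"
  by (simp add: ht_def psum_add_period algebra_simps)

lemma ht_inj:
  assumes "ht u i = ht u j" "\<bar>i - j\<bar> < b" shows "i = j"
proof -
  have "a * (i - j) = b * (psum u i - psum u j)" using assms(1) by (simp add: ht_def algebra_simps)
  then have "b dvd a * (i - j)" by simp
  then have "b dvd i - j" using coprime_ab by (simp add: coprime_dvd_mult_right_iff coprime_commute)
  then show ?thesis using assms(2) dvd_imp_le_int[of "i - j" b] b_pos by auto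
qed

definition parent :: "(int \<Rightarrow> nat) \<Rightarrow> int \<Rightarrow> int \<Rightarrow> bool" where
  "parent u p q \<longleftrightarrow> p < q \<and> ht u p < ht u q \<and> (\<forall>j. p < j \<and> j < q \<longrightarrow> ht u q \<le> ht u j)"

definition ancestor :: "(int \<Rightarrow> nat) \<Rightarrow> int \<Rightarrow> int \<Rightarrow> bool" where
  "ancestor u p q \<longleftrightarrow> p < q \<and> (\<forall>j. p < j \<and> j \<le> q \<longrightarrow> ht u p < ht u j)"

definition is_root :: "(int \<Rightarrow> nat) \<Rightarrow> int \<Rightarrow> bool" where
  "is_root u c \<longleftrightarrow> (\<forall>j>c. ht u c < ht u j)"

definition record_low :: "(int \<Rightarrow> nat) \<Rightarrow> int \<Rightarrow> bool" where
  "record_low u q \<longleftrightarrow> (\<forall>p<q. ht u q \<le> ht u p)"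

definition siblings :: "(int \<Rightarrow> nat) \<Rightarrow> int \<Rightarrow> int \<Rightarrow> bool" where
  "siblings u i j \<longleftrightarrow> (\<forall>p. parent u p i \<longleftrightarrow> parent u p j)"

definition linked :: "(int \<Rightarrow> nat) \<Rightarrow> int \<Rightarrow> int \<Rightarrow> bool" where
  "linked u i j \<longleftrightarrow> (\<exists>k. siblings u i (j + k * N))"

lemma parent_unique: "parent u p q \<Longrightarrow> parent u p' q \<Longrightarrow> p = p'"
  unfolding parent_def by (metis linorder_neqE_linordered_idom linorder_not_le)

lemma parent_ge: "parent u p q \<Longrightarrow> j < q \<Longrightarrow> ht u j < ht u q \<Longrightarrow> j \<le> p"
  unfolding parent_def by (meson linorder_not_le)

lemma parent_ex:
  assumes "j < q" "ht u j < ht u q"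
  obtains p where "j \<le> p" "parent u p q"
proof -
  obtain p where "p < q" "j \<le> p" "ht u p < ht u q" "\<And>k. p < k \<Longrightarrow> k < q \<Longrightarrow> \<not> ht u k < ht u q"
    using int_last_below[where P = "\<lambda>k. ht u k < ht u q", OF assms] by blast
  then show ?thesis by (intro that[of p]) (auto simp: parent_def not_less)
qed

lemma parent_add_1: "parent u p q \<Longrightarrow> parent u p (p + 1)"
  unfolding parent_def by (cases "q = p + 1") (auto dest!: spec[of _ "p + 1"])

lemma parent_add_1_iff: "parent u p (p + 1) \<longleftrightarrow> 0 < u p"
  by (auto simp: parent_def ht_less_add_1_iff)

lemma parent_imp_ancestor:
  assumes "parent u p q" shows "ancestor u p q"
proof -
  have "ht u p < ht u j" if "p < j" "j \<le> q" for j
    using assms that by (cases "j = q") (auto simp: parent_def intro: order.strict_trans2)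
  then show ?thesis using assms by (simp add: ancestor_def parent_def)
qed

lemma ancestor_trans:
  assumes "ancestor u p q" "ancestor u q r" shows "ancestor u p r"
proof -
  have "ht u p < ht u j" if "p < j" "j \<le> r" for j
  proof (cases "j \<le> q")
    case False
    then have "ht u p < ht u q" "ht u q < ht u j" using assms that by (auto simp: ancestor_def)
    then show ?thesis by simp
  qed (use assms that in \<open>simp add: ancestor_def\<close>)
  then show ?thesis using assms by (simp add: ancestor_def)
qed

lemma ancestor_iff_parent:
  "ancestor u p q \<longleftrightarrow> (\<exists>t. parent u t q \<and> (p = t \<or> ancestor u p t))"
proof
  assume pq: "ancestor u p q"
  then obtain t where t: "p \<le> t" "parent u t q"
    using parent_ex[of p q u] by (auto simp: ancestor_def)
  then have "p = t \<or> ancestor u p t" using pq by (auto simp: ancestor_def parent_def)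
  then show "\<exists>t. parent u t q \<and> (p = t \<or> ancestor u p t)" using t(2) by blast
next
  assume "\<exists>t. parent u t q \<and> (p = t \<or> ancestor u p t)"
  then show "ancestor u p q" using parent_imp_ancestor ancestor_trans by blast
qed

lemma parent_iff_ancestor:
  "parent u p q \<longleftrightarrow> ancestor u p q \<and> (\<forall>t. ancestor u t q \<longrightarrow> t \<le> p)"
proof
  assume "parent u p q"
  then show "ancestor u p q \<and> (\<forall>t. ancestor u t q \<longrightarrow> t \<le> p)"
    using parent_imp_ancestor parent_ge by (auto simp: ancestor_def)
next
  assume p: "ancestor u p q \<and> (\<forall>t. ancestor u t q \<longrightarrow> t \<le> p)"
  then obtain t where t: "parent u t q" "p = t \<or> ancestor u p t" using ancestor_iff_parent by blast
  moreover have "t \<le> p" using p parent_imp_ancestor[OF t(1)] by blast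
  ultimately show "parent u p q" by (auto simp: ancestor_def)
qed

lemma siblings_iff_ancestor: "siblings u i j \<longleftrightarrow> (\<forall>p. ancestor u p i \<longleftrightarrow> ancestor u p j)"
proof
  assume "siblings u i j"
  then show "\<forall>p. ancestor u p i \<longleftrightarrow> ancestor u p j"
    using ancestor_iff_parent[of u _ i] ancestor_iff_parent[of u _ j] by (simp add: siblings_def)
next
  assume "\<forall>p. ancestor u p i \<longleftrightarrow> ancestor u p j"
  then show "siblings u i j" by (simp add: siblings_def parent_iff_ancestor)
qed

lemma is_root_if_ancestor: "is_root u c \<Longrightarrow> ancestor u p c \<Longrightarrow> is_root u p"
  unfolding is_root_def ancestor_def by (metis linorder_not_le order_le_less order_less_trans)

lemma record_low_iff: "record_low u q \<longleftrightarrow> (\<forall>p. \<not> parent u p q)"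
  unfolding record_low_def by (metis linorder_not_le parent_def parent_ex)

lemma record_low_zero: "record_low u (c + 1) \<Longrightarrow> u c = 0"
  using parent_add_1_iff[of u c] by (auto simp: record_low_iff)

lemma siblings_if_parent: "parent u p i \<Longrightarrow> parent u p j \<Longrightarrow> siblings u i j"
  unfolding siblings_def using parent_unique by metis

lemma siblings_if_record_low: "record_low u i \<Longrightarrow> record_low u j \<Longrightarrow> siblings u i j"
  by (simp add: siblings_def record_low_iff)

lemma parent_shift: "parent (\<lambda>j. u (j + c)) p q \<longleftrightarrow> parent u (p + c) (q + c)"
proof -
  have "(\<forall>j. p + c < j \<and> j < q + c \<longrightarrow> P j) \<longleftrightarrow> (\<forall>j. p < j \<and> j < q \<longrightarrow> P (j + c))" for P
    by (metis add_less_cancel_right diff_add_cancel)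
  then show ?thesis by (simp add: parent_def ht_shift)
qed

lemma siblings_shift: "siblings (\<lambda>j. u (j + c)) i j \<longleftrightarrow> siblings u (i + c) (j + c)"
  unfolding siblings_def parent_shift by (metis diff_add_cancel)

lemma linked_shift: "linked (\<lambda>j. u (j + c)) i j \<longleftrightarrow> linked u (i + c) (j + c)"
  by (simp add: linked_def siblings_shift algebra_simps)

lemma record_low_shift: "record_low (\<lambda>j. u (j + c)) q \<longleftrightarrow> record_low u (q + c)"
  unfolding record_low_iff parent_shift by (metis diff_add_cancel)

lemma is_root_shift: "is_root (\<lambda>j. u (j + c)) q \<longleftrightarrow> is_root u (q + c)"
  unfolding is_root_def ht_shift by (simp, metis add_less_cancel_right diff_add_cancel)

context
  fixes u :: "int \<Rightarrow> nat" and n :: int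
  assumes per: "periodic u n"
begin

lemma parent_add_mult: "parent u (p + k * n) (q + k * n) \<longleftrightarrow> parent u p q"
  using parent_shift[of u "k * n"] by (simp add: periodic_shift_mult[OF per])

lemma siblings_add_mult: "siblings u (i + k * n) (j + k * n) \<longleftrightarrow> siblings u i j"
  using siblings_shift[of u "k * n"] by (simp add: periodic_shift_mult[OF per])

lemma record_low_add_mult: "record_low u (q + k * n) \<longleftrightarrow> record_low u q"
  using record_low_shift[of u "k * n"] by (simp add: periodic_shift_mult[OF per])

lemma is_root_add_mult: "is_root u (q + k * n) \<longleftrightarrow> is_root u q"
  using is_root_shift[of u "k * n"] by (simp add: periodic_shift_mult[OF per])

lemma is_root_add_period: "is_root u (q + n) \<longleftrightarrow> is_root u q"
  using is_root_add_mult[of q 1] by simp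

lemma parent_less_period:
  assumes "0 < n" "parent u p q" shows "q \<le> p + n"
proof (rule ccontr)
  assume "\<not> q \<le> p + n"
  then have "ht u q \<le> ht u (p + n)" "ht u q \<le> ht u (q - n)" "ht u p < ht u q"
    using assms by (auto simp: parent_def)
  then show False using ht_add_period[OF per, of p] ht_add_period[OF per, of "q - n"] by simp
qed

end

lemma linked_add_mult_right: "linked u i (j + k * N) \<longleftrightarrow> linked u i j"
  unfolding linked_def
  by (metis (no_types, lifting) add.assoc add.commute diff_add_cancel distrib_right)

lemma linked_if_siblings: "siblings u i j \<Longrightarrow> linked u i j"
  unfolding linked_def by (rule exI[of _ 0]) simp

lemma linked_if_parent: "parent u p i \<Longrightarrow> parent u p j \<Longrightarrow> linked u i j"
  by (simp add: linked_if_siblings siblings_if_parent)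

lemma linked_refl: "linked u i i"
  by (simp add: linked_if_siblings siblings_def)

lemma linked_first_child: "parent u p q \<Longrightarrow> linked u (p + 1) q"
  by (rule linked_if_parent[OF parent_add_1])

lemma window_representative:
  obtains k where "j - k * N \<in> {c<..c + N}"
proof
  have "(j - c - 1) = (j - c - 1) div N * N + (j - c - 1) mod N" by simp
  moreover have "0 \<le> (j - c - 1) mod N" "(j - c - 1) mod N < N" using N_pos by auto
  ultimately show "j - (j - c - 1) div N * N \<in> {c<..c + N}"
    unfolding greaterThanAtMost_iff by linarith
qed

definition cut :: "(int \<Rightarrow> nat) \<Rightarrow> int \<Rightarrow> bool" where
  "cut u c \<longleftrightarrow> (\<forall>q\<in>{c<..c + N}. \<forall>p. parent u p q \<longrightarrow> c \<le> p)"

lemma cut_if_is_root: "is_root u c \<Longrightarrow> cut u c"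
  using parent_ge by (auto simp: cut_def is_root_def)

context
  fixes u :: "int \<Rightarrow> nat"
  assumes per: "periodic u N"
begin

lemma linked_sym:
  assumes "linked u i j" shows "linked u j i"
proof -
  obtain k where "siblings u i (j + k * N)" using assms unfolding linked_def by blast
  then have "siblings u (i + - k * N) j"
    using siblings_add_mult[OF per, of "i + - k * N" k j] by simp
  then show ?thesis unfolding linked_def siblings_def by metis
qed

lemma linked_trans:
  assumes "linked u i j" "linked u j l" shows "linked u i l"
proof -
  obtain k k' where k: "siblings u i (j + k * N)" "siblings u j (l + k' * N)"
    using assms unfolding linked_def by blast
  have "siblings u (j + k * N) (l + k' * N + k * N)" using k(2) siblings_add_mult[OF per] by blast
  then have "siblings u i (l + (k' + k) * N)"
    using k(1) by (simp add: siblings_def algebra_simps)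
  then show ?thesis unfolding linked_def by blast
qed

lemma equivp_linked: "equivp (linked u)"
  by (intro equivpI reflpI sympI transpI) (blast intro: linked_refl linked_sym linked_trans)+

lemma linked_add_mult: "linked u (i + k * N) (j + k' * N) \<longleftrightarrow> linked u i j"
  using linked_add_mult_right linked_sym by metis

lemma record_low_if_linked:
  assumes "linked u i j" "record_low u i" shows "record_low u j"
proof -
  obtain k where "siblings u i (j + k * N)" using assms(1) unfolding linked_def by blast
  then have "record_low u (j + k * N)" using assms(2) by (simp add: record_low_iff siblings_def)
  then show ?thesis by (simp add: record_low_add_mult[OF per])
qed

lemma linked_iff_siblings:
  assumes "cut u c" and in_window: "i \<in> {c<..c + N}" "j \<in> {c<..c + N}"
  shows "linked u i j \<longleftrightarrow> siblings u i j"
proof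
  assume linked: "linked u i j"
  then obtain k where k: "siblings u i (j + k * N)" unfolding linked_def by blast
  show "siblings u i j"
  proof (cases "record_low u i")
    case True
    then show ?thesis using record_low_if_linked[OF linked] siblings_if_record_low by blast
  next
    case False
    then obtain p where p: "parent u p i" by (auto simp: record_low_iff)
    then have "parent u p (j + k * N)" using k by (simp add: siblings_def)
    then have p': "parent u (p - k * N) j"
      using parent_add_mult[OF per, of "p - k * N" k j] by simp
    have "c \<le> p" "c \<le> p - k * N" using assms p p' by (auto simp: cut_def)
    moreover have "p < c + N" "p - k * N < c + N" using p p' in_window by (auto simp: parent_def)
    ultimately have "k * N < 1 * N" "(- 1) * N < k * N" by linarith+
    then have "k = 0" using N_pos by (simp only: mult_less_cancel_right_pos)
    then show ?thesis using k by simp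
  qed
qed (rule linked_if_siblings)

end

lemma linked_eqI:
  assumes "periodic u N" "periodic v N"
    and linked_iff: "\<And>i j. i \<in> {c<..c + N} \<Longrightarrow> j \<in> {c<..c + N} \<Longrightarrow> linked u i j \<longleftrightarrow> linked v i j"
  shows "linked u = linked v"
proof (intro ext)
  fix i j
  obtain k l where k: "i - k * N \<in> {c<..c + N}" and l: "j - l * N \<in> {c<..c + N}"
    using window_representative by metis
  have "linked w i j \<longleftrightarrow> linked w (i - k * N) (j - l * N)" if "periodic w N" for w
    using linked_add_mult[OF that, of "i - k * N" k "j - l * N" l] by simp
  then show "linked u i j = linked v i j" using linked_iff[OF k l] assms(1,2) by simp
qed

section \<open>Full and deficient words\<close>

definition full :: "(int \<Rightarrow> nat) \<Rightarrow> bool" where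
  "full u \<longleftrightarrow> periodic u N \<and> psum u N = a"

definition deficient :: "(int \<Rightarrow> nat) \<Rightarrow> bool" where
  "deficient u \<longleftrightarrow> periodic u N \<and> psum u N < a"

lemma full_periodic: "full u \<Longrightarrow> periodic u N" and deficient_periodic: "deficient u \<Longrightarrow> periodic u N"
  by (simp_all add: full_def deficient_def)

lemma full_shift: "full u \<Longrightarrow> full (\<lambda>j. u (j + c))"
  by (simp add: full_def periodic_shift psum_shift_period)

lemma deficient_shift: "deficient u \<Longrightarrow> deficient (\<lambda>j. u (j + c))"
  by (simp add: deficient_def periodic_shift psum_shift_period)

lemma ht_add_N_full: "full u \<Longrightarrow> ht u (j + N) = ht u j + a"
  using ht_add_period[of u N j] b_mult[of a] by (simp add: full_def ht_def[of u N] mult.commute)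

lemma ht_add_N_deficient:
  assumes "deficient u" shows "ht u (j + N) + (b * (a - psum u N) - a) = ht u j"
  using ht_add_period[of u N j] assms b_mult[of a]
  by (simp add: deficient_def ht_def[of u N] right_diff_distrib mult.commute)

lemma ht_add_N_deficient_less:
  assumes "deficient u" shows "ht u (j + N) < ht u j"
proof -
  have "b * 1 \<le> b * (a - psum u N)"
    using assms b_pos by (intro mult_left_mono) (auto simp: deficient_def)
  then show ?thesis using ht_add_N_deficient[OF assms, of j] a_less by linarith
qed

lemma full_parent_ex:
  assumes "full u" obtains p where "parent u p q"
  using parent_ex[of "q - N" q u] ht_add_N_full[OF assms, of "q - N"] a_pos N_pos that by auto

lemma full_not_record_low: "full u \<Longrightarrow> \<not> record_low u q"
  using full_parent_ex[of u q] by (auto simp: record_low_iff)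

lemma is_rootI:
  assumes "full u" "\<And>j. j \<in> {c<..c + N} \<Longrightarrow> ht u c < ht u j"
  shows "is_root u c"
proof -
  have step: "ht u c < ht u j" if "c < j" for j
    using that
  proof (induction "nat (j - c)" arbitrary: j rule: less_induct)
    case less
    show ?case
    proof (cases "j \<le> c + N")
      case False
      then have "ht u c < ht u (j - N)" using less.hyps[of "j - N"] N_pos by simp
      then show ?thesis using ht_add_N_full[OF assms(1), of "j - N"] a_pos by simp
    qed (use less.prems assms(2) in simp)
  qed
  then show ?thesis by (simp add: is_root_def)
qed

lemma record_lowI:
  assumes "deficient u" "\<And>j. j \<in> {c - N..<c} \<Longrightarrow> ht u c \<le> ht u j"
  shows "record_low u c"
proof -
  have step: "ht u c \<le> ht u j" if "j < c" for j
    using that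
  proof (induction "nat (c - j)" arbitrary: j rule: less_induct)
    case less
    show ?case
    proof (cases "c - N \<le> j")
      case False
      then have "ht u c \<le> ht u (j + N)" using less.hyps[of "j + N"] N_pos by simp
      then show ?thesis using ht_add_N_deficient_less[OF assms(1), of j] by simp
    qed (use less.prems assms(2) in simp)
  qed
  then show ?thesis by (simp add: record_low_def)
qed

lemma full_is_root_ex:
  assumes "full u" obtains c where "is_root u c"
proof -
  obtain c where c: "0 \<le> c" "c < N" and min: "\<And>j. 0 \<le> j \<Longrightarrow> j < N \<Longrightarrow> ht u c \<le> ht u j"
    using int_interval_argmin[OF N_pos] by blast
  have "is_root u c"
  proof (rule is_rootI[OF assms])
    fix j assume j: "j \<in> {c<..c + N}"
    show "ht u c < ht u j"
    proof (cases "j < N")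
      case True
      then show ?thesis using min[of j] ht_inj[of u c j] c j b_eq by fastforce
    next
      case False
      then show ?thesis using min[of "j - N"] ht_add_N_full[OF assms, of "j - N"] a_pos c j by auto
    qed
  qed
  then show ?thesis by (rule that)
qed

lemma deficient_record_low_ex:
  assumes "deficient u" obtains c where "record_low u (c + 1)"
proof -
  obtain q where q: "0 \<le> q" "q < N" and min: "\<And>j. 0 \<le> j \<Longrightarrow> j < N \<Longrightarrow> ht u q \<le> ht u j"
    using int_interval_argmin[OF N_pos] by blast
  have "record_low u q"
  proof (rule record_lowI[OF assms])
    fix j assume j: "j \<in> {q - N..<q}"
    show "ht u q \<le> ht u j"
    proof (cases "0 \<le> j")
      case False
      then show ?thesis
        using min[of "j + N"] ht_add_N_deficient_less[OF assms, of j] q j by fastforce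
    qed (use min[of j] q j in auto)
  qed
  then show ?thesis using that[of "q - 1"] by simp
qed

lemma ht_periodic_upd:
  assumes "j \<in> {c<..c + N}"
  shows "ht (periodic_upd N u c x) j - ht (periodic_upd N u c x) c =
    ht u j - ht u c + b * (int x - int (u c))"
  using arg_cong[OF psum_periodic_upd[of c j N u x], of "\<lambda>t. b * t"] assms
  by (simp add: ht_def algebra_simps)

text \<open>The record lows of a deficient word form one block; the missing mass is the rank of this block
  and may be put in front of any of its elements.\<close>

definition fill :: "(int \<Rightarrow> nat) \<Rightarrow> int \<Rightarrow> int \<Rightarrow> nat" where
  "fill u c = periodic_upd N u c (nat (a - psum u N))"

definition drain :: "(int \<Rightarrow> nat) \<Rightarrow> int \<Rightarrow> int \<Rightarrow> nat" where
  "drain u c = periodic_upd N u c 0"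

context
  fixes u :: "int \<Rightarrow> nat" and c :: int
  assumes deficient: "deficient u" and low: "record_low u (c + 1)"
begin

lemma parent_after_record_low:
  assumes "c < q" "parent u p q" shows "c < p"
proof (rule ccontr)
  assume "\<not> c < p"
  then have "q \<noteq> c + 1" using assms low by (auto simp: record_low_iff)
  then have "ht u q \<le> ht u (c + 1)" "ht u (c + 1) \<le> ht u p"
    using assms low \<open>\<not> c < p\<close> by (auto simp: parent_def record_low_def)
  then show False using assms(2) by (simp add: parent_def)
qed

lemma cut_if_record_low: "cut u c"
  unfolding cut_def
proof (intro ballI allI impI)
  fix q p assume "q \<in> {c<..c + N}" "parent u p q"
  then show "c \<le> p" using parent_after_record_low[of q p] by simp
qed

lemma full_fill: "full (fill u c)"
  using psum_periodic_upd_period[of u N c] periodic_periodic_upd[of u N c] deficient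
    record_low_zero[OF low] N_pos by (simp add: full_def deficient_def fill_def)

lemma ht_fill:
  assumes "j \<in> {c<..c + N}"
  shows "ht (fill u c) j - ht (fill u c) c = ht u j - ht u c + b * (a - psum u N)"
  using ht_periodic_upd[OF assms] deficient record_low_zero[OF low]
  by (simp add: fill_def deficient_def)

lemma ht_fill_diff:
  assumes "i \<in> {c<..c + N}" "j \<in> {c<..c + N}"
  shows "ht (fill u c) j - ht (fill u c) i = ht u j - ht u i"
  using ht_fill[OF assms(1)] ht_fill[OF assms(2)] by simp

lemma is_root_fill: "is_root (fill u c) c"
proof (rule is_rootI[OF full_fill])
  fix j assume j: "j \<in> {c<..c + N}"
  have rec': "record_low u (c + 1 + N)"
    using record_low_add_mult[OF deficient_periodic[OF deficient], of "c + 1" 1] low by simp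
  have "ht u (c + 1 + N) = ht u c - b * (a - psum u N)"
    using ht_add_N_deficient[OF deficient, of "c + 1"] ht_add_1[of u c] record_low_zero[OF low]
    by simp
  moreover have "ht u (c + 1 + N) \<le> ht u j" using rec' j by (simp add: record_low_def)
  moreover have "ht u (c + 1 + N) \<noteq> ht u j" using ht_inj[of u "c + 1 + N" j] j b_eq by auto
  ultimately show "ht (fill u c) c < ht (fill u c) j" using ht_fill[OF j] by simp
qed

lemma parent_fill:
  assumes "q \<in> {c<..c + N}" "c < p"
  shows "parent (fill u c) p q \<longleftrightarrow> parent u p q"
proof (cases "p < q")
  case True
  have "ht (fill u c) i < ht (fill u c) j \<longleftrightarrow> ht u i < ht u j"
    if "i \<in> {c<..c + N}" "j \<in> {c<..c + N}" for i j using ht_fill_diff[OF that] by linarith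
  then show ?thesis using assms True unfolding parent_def not_less[symmetric] by auto
qed (simp add: parent_def)

lemma parent_fill_root:
  assumes "q \<in> {c<..c + N}"
  shows "parent (fill u c) c q \<longleftrightarrow> record_low u q"
proof
  assume root: "parent (fill u c) c q"
  have "\<not> parent u p q" for p
  proof
    assume p: "parent u p q"
    then have "c < p" using parent_after_record_low[OF _ p] assms by simp
    then show False using parent_unique[OF root] parent_fill[OF assms] p by blast
  qed
  then show "record_low u q" by (simp add: record_low_iff)
next
  assume "record_low u q"
  moreover obtain p where p: "parent (fill u c) p q" using full_parent_ex[OF full_fill] .
  moreover have "c \<le> p" using p cut_if_is_root[OF is_root_fill] assms by (auto simp: cut_def)
  ultimately show "parent (fill u c) c q"
    using parent_fill[OF assms, of p] by (cases "p = c") (auto simp: record_low_iff)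
qed

lemma siblings_fill:
  assumes "i \<in> {c<..c + N}" "j \<in> {c<..c + N}"
  shows "siblings (fill u c) i j \<longleftrightarrow> siblings u i j"
proof -
  have above: "c \<le> p" if "parent (fill u c) p q" "q \<in> {c<..c + N}" for p q
    using that cut_if_is_root[OF is_root_fill] by (auto simp: cut_def)
  have "siblings u i j \<longleftrightarrow> (record_low u i \<longleftrightarrow> record_low u j) \<and> (\<forall>p>c. parent u p i \<longleftrightarrow> parent u p j)"
    using parent_after_record_low assms unfolding siblings_def record_low_iff greaterThanAtMost_iff
    by blast
  moreover have "siblings (fill u c) i j \<longleftrightarrow>
      (parent (fill u c) c i \<longleftrightarrow> parent (fill u c) c j) \<and>
      (\<forall>p>c. parent (fill u c) p i \<longleftrightarrow> parent (fill u c) p j)"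
    using above assms unfolding siblings_def by (metis order_le_less)
  ultimately show ?thesis using parent_fill parent_fill_root assms by simp
qed

lemma linked_fill: "linked (fill u c) = linked u"
proof (rule linked_eqI)
  show per: "periodic (fill u c) N" "periodic u N"
    using full_periodic[OF full_fill] deficient_periodic[OF deficient] .
  fix i j assume ij: "i \<in> {c<..c + N}" "j \<in> {c<..c + N}"
  show "linked (fill u c) i j \<longleftrightarrow> linked u i j"
    using linked_iff_siblings[OF per(1) cut_if_is_root[OF is_root_fill] ij]
      linked_iff_siblings[OF per(2) cut_if_record_low ij] siblings_fill[OF ij] by simp
qed

lemma support_fill: "support (fill u c) N = support u N + 1"
  using support_periodic_upd[of u N c] deficient record_low_zero[OF low] N_pos
  by (simp add: fill_def deficient_def)

end

context
  fixes u :: "int \<Rightarrow> nat" and c :: int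
  assumes full: "full u" and root: "is_root u c"
begin

lemma psum_drain: "psum (drain u c) N = a - int (u c)"
  using psum_periodic_upd_period[of u N c 0] full N_pos by (simp add: full_def drain_def)

lemma deficient_drain: "deficient (drain u c)"
proof -
  have "0 < u c" using root by (simp add: is_root_def flip: ht_less_add_1_iff)
  then show ?thesis
    using periodic_periodic_upd[OF full_periodic[OF full]] psum_drain
    by (simp add: deficient_def drain_def)
qed

lemma fill_drain: "fill (drain u c) c = u"
  using periodic_upd_triv[OF full_periodic[OF full]]
  by (simp add: fill_def psum_drain) (simp add: drain_def periodic_upd_upd)

lemma record_low_drain: "record_low (drain u c) (c + 1)"
proof (rule record_lowI[OF deficient_drain])
  fix j assume "j \<in> {c + 1 - N..<c + 1}"
  then have j: "j + N \<in> {c<..c + N}" by auto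
  have "ht u c < ht u (j + N)" using root j by (simp add: is_root_def)
  then have "ht (drain u c) c - b * int (u c) < ht (drain u c) (j + N)"
    using ht_periodic_upd[OF j, of u 0] by (simp add: drain_def)
  moreover have "ht (drain u c) (j + N) + (b * int (u c) - a) = ht (drain u c) j"
    using ht_add_N_deficient[OF deficient_drain, of j] by (simp add: psum_drain)
  moreover have "ht (drain u c) (c + 1) = ht (drain u c) c - a"
    using ht_add_1[of "drain u c" c] by (simp add: drain_def periodic_upd_def)
  ultimately show "ht (drain u c) (c + 1) \<le> ht (drain u c) j" by linarith
qed

lemma linked_drain: "linked (drain u c) = linked u"
  using linked_fill[OF deficient_drain record_low_drain] by (simp add: fill_drain)

end

section \<open>The root determines the word\<close>

text \<open>Rerooting: the rank of the block that starts right after a root is drained and filled in again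
  in front of another element of the block.\<close>

lemma full_reroot_pred:
  assumes "full u" "is_root u c"
  obtains v where "full v" "is_root v (c - 1)" "linked v = linked u"
proof -
  have per: "periodic u N" using assms(1) by (rule full_periodic)
  obtain p where p: "parent u p (c + N)" using full_parent_ex[OF assms(1)] .
  have root: "is_root u p"
    using is_root_if_ancestor[OF _ parent_imp_ancestor[OF p]] is_root_add_period[OF per] assms(2)
    by simp
  note drained = deficient_drain[OF assms(1) root]
  have "linked (drain u p) (p + 1) (c + N)"
    using linked_first_child[OF p] linked_drain[OF assms(1) root] by simp
  then have "record_low (drain u p) (c - 1 + N + 1)"
    using record_low_if_linked[OF deficient_periodic[OF drained]] record_low_drain[OF assms(1) root]
    by simp
  note filled = full_fill[OF drained this] is_root_fill[OF drained this] linked_fill[OF drained this]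
  show ?thesis
    using that[OF filled(1)] filled(2,3) is_root_add_period[OF full_periodic[OF filled(1)]]
      linked_drain[OF assms(1) root] by simp
qed

lemma full_reroot:
  assumes "full u"
  obtains v where "full v" "is_root v c" "linked v = linked u"
proof -
  obtain c0 where c0: "is_root u c0" using full_is_root_ex[OF assms] .
  have "c - c0 \<le> \<bar>c - c0\<bar> * 1" by simp
  also have "\<dots> \<le> \<bar>c - c0\<bar> * N" using N_pos by (intro mult_left_mono) auto
  finally have "c \<le> c0 + \<bar>c - c0\<bar> * N" by (simp add: algebra_simps)
  then have "\<exists>v. full v \<and> is_root v c \<and> linked v = linked u"
  proof (induction c rule: int_le_induct)
    case base
    then show ?case
      using assms c0 is_root_add_mult[OF full_periodic[OF assms]] by blast
  next
    case (step i)
    then show ?case using full_reroot_pred by metis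
  qed
  then show ?thesis using that by blast
qed

lemma parent_le_if_linked_eq:
  assumes "full u" "is_root u c" "full v" "is_root v c" "linked u = linked v"
    and parents: "q \<in> {c<..c + N}" "parent u p q" "parent v p' q"
  shows "p' \<le> p"
proof -
  have "c \<le> p" using cut_if_is_root[OF assms(2)] parents by (auto simp: cut_def)
  moreover have "p < q" using parents(2) by (simp add: parent_def)
  ultimately have "p + 1 \<in> {c<..c + N}" using parents by auto
  moreover have "linked v (p + 1) q"
    using linked_first_child[OF parents(2)] assms(5) by simp
  ultimately have "siblings v (p + 1) q"
    using linked_iff_siblings[OF full_periodic[OF assms(3)] cut_if_is_root[OF assms(4)]] parents(1)
    by blast
  then have "parent v p' (p + 1)" using parents(3) by (simp add: siblings_def)
  then show ?thesis by (simp add: parent_def)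
qed

lemma parent_eq_if_linked_eq:
  assumes "full u" "is_root u c" "full v" "is_root v c" "linked u = linked v" "q \<in> {c<..c + N}"
  shows "parent u p q \<longleftrightarrow> parent v p q"
proof -
  obtain s t where s: "parent u s q" and t: "parent v t q"
    using full_parent_ex[OF assms(1)] full_parent_ex[OF assms(3)] by metis
  have "s = t"
    using parent_le_if_linked_eq[OF assms s t]
      parent_le_if_linked_eq[OF assms(3,4,1,2) assms(5)[symmetric] assms(6) t s] by simp
  then show ?thesis using s t parent_unique by blast
qed

lemma ancestor_eq_if_parent_eq:
  assumes "\<And>p q. q \<in> {c<..d} \<Longrightarrow> parent u p q \<longleftrightarrow> parent v p q" "c \<le> p" "q \<le> d"
  shows "ancestor u p q \<longleftrightarrow> ancestor v p q"
  using assms(3)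
proof (induction "nat (q - p)" arbitrary: q rule: less_induct)
  case less
  show ?case
  proof (cases "p < q")
    case True
    have "parent u t q \<and> (p = t \<or> ancestor u p t) \<longleftrightarrow> parent v t q \<and> (p = t \<or> ancestor v p t)" for t
    proof (cases "p < t \<and> t < q")
      case True
      then show ?thesis using less.hyps[of t] less.prems assms(1)[of q t] assms(2) by auto
    next
      case False
      then show ?thesis using assms(1)[of q t] assms(2) less.prems \<open>p < q\<close>
        by (auto simp: ancestor_def parent_def)
    qed
    then show ?thesis unfolding ancestor_iff_parent[of _ p q] by simp
  qed (simp add: ancestor_def)
qed

lemma ht_diff_eqI:
  assumes "ht u i - ht u j \<in> {0..a}" "ht v i - ht v j \<in> {0..a}"
  shows "ht u i - ht v i = ht u j - ht v j"
proof -
  have "(ht u i - ht u j) - (ht v i - ht v j) = b * ((psum u i - psum u j) - (psum v i - psum v j))"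
    by (simp add: ht_def algebra_simps)
  then have "b dvd (ht u i - ht u j) - (ht v i - ht v j)" by simp
  moreover have "\<bar>(ht u i - ht u j) - (ht v i - ht v j)\<bar> < b" using assms a_less by auto
  ultimately have "(ht u i - ht u j) - (ht v i - ht v j) = 0"
    using dvd_imp_le_int[of "(ht u i - ht u j) - (ht v i - ht v j)" b] b_pos by fastforce
  then show ?thesis by simp
qed

text \<open>When the walk first comes back from above to the height of \<open>q\<close> or lower, it does so by a down
  step, so it ends at most \<open>a\<close> lower; modulo \<open>b\<close> this drop is known.\<close>

lemma ht_first_return:
  assumes "q < j" "\<not> ancestor u q j" "\<And>k. q < k \<Longrightarrow> k < j \<Longrightarrow> ancestor u q k"
  shows "ht u q - ht u j \<in> {0..a}"
proof -
  have "\<not> ht u q < ht u j"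
  proof
    assume less: "ht u q < ht u j"
    have "ht u q < ht u k" if "q < k" "k \<le> j" for k
      using less assms(3)[of k] that by (cases "k = j") (auto simp: ancestor_def)
    then show False using assms(1,2) by (simp add: ancestor_def)
  qed
  moreover have "ht u q \<le> ht u (j - 1)"
    using assms(3)[of "j - 1"] assms(1)
    by (cases "q = j - 1") (auto simp: ancestor_def intro!: less_imp_le)
  ultimately show ?thesis using ht_add_1_ge[of u "j - 1"] by auto
qed

lemma ht_diff_const:
  assumes "full u" "is_root u c" "full v" "is_root v c" "linked u = linked v"
    and in_window: "c \<le> q" "q \<le> c + N"
  shows "ht u q - ht v q = ht u c - ht v c"
  using in_window
proof (induction "nat (c + N - q)" arbitrary: q rule: less_induct)
  case less
  have anc: "ancestor u q j \<longleftrightarrow> ancestor v q j" if "j \<le> c + N" for j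
    by (rule ancestor_eq_if_parent_eq[OF parent_eq_if_linked_eq[OF assms(1-5)] less.prems(1) that])
  show ?case
  proof (cases "q = c + N \<or> ancestor u q (c + N)")
    case True
    have "ht w q - ht w c \<in> {0..a}" if w: "full w" "is_root w c" "q = c + N \<or> ancestor w q (c + N)" for w
    proof -
      have "ht w q \<le> ht w (c + N)" using w(3) by (auto simp: ancestor_def)
      moreover have "ht w c \<le> ht w q"
        using w(2) less.prems(1) by (cases "q = c") (auto simp: is_root_def intro!: less_imp_le)
      ultimately show ?thesis using ht_add_N_full[OF w(1), of c] by simp
    qed
    then show ?thesis using True anc assms(1-4) by (intro ht_diff_eqI) auto
  next
    case False
    then have "q < c + N" "\<not> ancestor u q (c + N)" using less.prems by auto
    then obtain j where j: "q < j" "j \<le> c + N" "\<not> ancestor u q j"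
      and above: "\<And>k. q < k \<Longrightarrow> k < j \<Longrightarrow> ancestor u q k"
      using int_first_above[where P = "\<lambda>j. \<not> ancestor u q j"] by metis
    have "ht u q - ht u j \<in> {0..a}" by (rule ht_first_return[OF j(1,3) above])
    moreover have "ht v q - ht v j \<in> {0..a}"
      by (rule ht_first_return[OF j(1)]) (use j above anc in auto)
    ultimately have "ht u q - ht v q = ht u j - ht v j" by (rule ht_diff_eqI)
    then show ?thesis using less.hyps[of j] j less.prems by simp
  qed
qed

lemma full_eq_if_linked_eq:
  assumes "full u" "is_root u c" "full v" "is_root v c" "linked u = linked v"
  shows "u = v"
proof
  fix j
  obtain k where k: "j - k * N \<in> {c - 1<..c - 1 + N}" using window_representative .
  let ?j = "j - k * N"
  have "ht u ?j - ht v ?j = ht u c - ht v c" "ht u (?j + 1) - ht v (?j + 1) = ht u c - ht v c"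
    using ht_diff_const[OF assms, of ?j] ht_diff_const[OF assms, of "?j + 1"] k by auto
  then have "b * int (u ?j) = b * int (v ?j)" unfolding ht_add_1 by linarith
  then have "u ?j = v ?j" using b_pos by simp
  then show "u j = v j"
    using periodic_add_mult[OF full_periodic[OF assms(1)], of ?j k]
      periodic_add_mult[OF full_periodic[OF assms(3)], of ?j k] by simp
qed

lemma deficient_eq_if_linked_eq:
  assumes "deficient u" "record_low u (c + 1)" "deficient v" "record_low v (c + 1)" "linked u = linked v"
  shows "u = v"
proof -
  have "fill u c = fill v c"
    by (rule full_eq_if_linked_eq[of _ c]) (use assms full_fill is_root_fill linked_fill in auto)
  then have "periodic_upd N (fill u c) c 0 = periodic_upd N (fill v c) c 0" by simp
  then have "periodic_upd N u c (u c) = periodic_upd N v c (v c)"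
    using record_low_zero[OF assms(2)] record_low_zero[OF assms(4)]
    by (simp add: fill_def periodic_upd_upd)
  then show ?thesis
    using periodic_upd_triv[OF deficient_periodic[OF assms(1)]]
      periodic_upd_triv[OF deficient_periodic[OF assms(3)]] by simp
qed

end

section \<open>The partition of a word\<close>

lemma equiv_eq_Union_quotient:
  assumes "equiv A r" shows "r = (\<Union>B\<in>A // r. B \<times> B)"
proof
  show "r \<subseteq> (\<Union>B\<in>A // r. B \<times> B)"
  proof clarify
    fix x y assume xy: "(x, y) \<in> r"
    then have "x \<in> A" using equiv_type[OF assms] by auto
    then have "r `` {x} \<in> A // r" "(x, y) \<in> r `` {x} \<times> r `` {x}"
      using xy equiv_class_self[OF assms] by (auto intro: quotientI)
    then show "(x, y) \<in> (\<Union>B\<in>A // r. B \<times> B)" by blast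
  qed
qed (use in_quotient_imp_in_rel[OF assms] in auto)

lemma quotient_inject: "equiv A r \<Longrightarrow> equiv A s \<Longrightarrow> A // r = A // s \<longleftrightarrow> r = s"
  using equiv_eq_Union_quotient[of A r] equiv_eq_Union_quotient[of A s] by metis

lemma image_quotient:
  assumes f_bij: "bij_betw f A A" and "r \<subseteq> A \<times> A" "s \<subseteq> A \<times> A"
    and iff: "\<And>x y. x \<in> A \<Longrightarrow> y \<in> A \<Longrightarrow> (f x, f y) \<in> s \<longleftrightarrow> (x, y) \<in> r"
  shows "(\<lambda>B. f ` B) ` (A // r) = A // s"
proof -
  have fA: "f ` A = A" using f_bij by (simp add: bij_betw_def)
  have "f ` (r `` {x}) = s `` {f x}" if "x \<in> A" for x
  proof -
    have "s `` {f x} \<subseteq> f ` A" using assms(3) fA by auto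
    then show ?thesis using assms(2) iff[OF that] by blast
  qed
  then have "(\<lambda>B. f ` B) ` (A // r) = (\<lambda>x. s `` {x}) ` f ` A"
    by (simp add: quotient_def UNION_singleton_eq_range image_image)
  then show ?thesis by (simp add: fA quotient_def UNION_singleton_eq_range)
qed

lemma card_quotient_representatives:
  assumes "equiv A r" "f ` S \<subseteq> A"
    and represented: "\<And>x. x \<in> A \<Longrightarrow> \<exists>s\<in>S. (x, f s) \<in> r"
    and unique: "\<And>s t. s \<in> S \<Longrightarrow> t \<in> S \<Longrightarrow> (f s, f t) \<in> r \<Longrightarrow> s = t"
  shows "card (A // r) = card S"
proof -
  have "inj_on (\<lambda>s. r `` {f s}) S"
    using assms(2) unique by (intro inj_onI) (auto dest!: eq_equiv_class[OF _ assms(1)])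
  moreover have "(\<lambda>s. r `` {f s}) ` S = A // r"
    using assms(2) represented equiv_class_eq[OF assms(1)] by (fastforce simp: quotient_def)
  ultimately show ?thesis using card_image by metis
qed

context slope begin

definition label_rel :: "(int \<Rightarrow> nat) \<Rightarrow> (nat \<times> nat) set" where
  "label_rel u = {(i, j). i \<in> {1..nat N} \<and> j \<in> {1..nat N} \<and> linked u (int i) (int j)}"

definition partition_of :: "(int \<Rightarrow> nat) \<Rightarrow> nat set set" where
  "partition_of u = {1..nat N} // label_rel u"

lemma equiv_label_rel: "periodic u N \<Longrightarrow> equiv {1..nat N} (label_rel u)"
  by (intro equivI refl_onI symI transI)
     (auto simp: label_rel_def linked_refl intro: linked_sym linked_trans)

lemma partition_of_cong: "linked u = linked v \<Longrightarrow> partition_of u = partition_of v"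
  by (simp add: partition_of_def label_rel_def)

lemma partition_of_eq_iff:
  assumes "periodic u N" "periodic v N"
  shows "partition_of u = partition_of v \<longleftrightarrow> linked u = linked v"
proof
  assume "partition_of u = partition_of v"
  then have label_rel_eq: "label_rel u = label_rel v"
    unfolding partition_of_def using quotient_inject equiv_label_rel assms by blast
  show "linked u = linked v"
  proof (rule linked_eqI[OF assms])
    fix i j assume "i \<in> {0<..0 + N}" "j \<in> {0<..0 + N}"
    then have "nat i \<in> {1..nat N}" "nat j \<in> {1..nat N}" "int (nat i) = i" "int (nat j) = j" by auto
    moreover have "(nat i, nat j) \<in> label_rel u \<longleftrightarrow> (nat i, nat j) \<in> label_rel v"
      using label_rel_eq by simp
    ultimately show "linked u i j \<longleftrightarrow> linked v i j" by (simp add: label_rel_def)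
  qed
qed (rule partition_of_cong)

lemma positive_representative:
  assumes "full u"
  obtains p where "p \<in> {0..<N}" "0 < u p" "linked u q (p + 1)"
proof -
  obtain p where p: "parent u p q" using full_parent_ex[OF assms] .
  have "linked u q (p + 1)" using linked_if_parent[OF p parent_add_1[OF p]] .
  then have "linked u q (p mod N + 1)"
    using linked_add_mult_right[of u q "p mod N + 1" "p div N"] by (simp add: algebra_simps)
  moreover have "0 < u (p mod N)"
    using parent_add_1[OF p]
    by (simp add: parent_add_1_iff periodic_mod[OF full_periodic[OF assms]])
  ultimately show ?thesis using that[of "p mod N"] N_pos by simp
qed

lemma positive_representative_unique:
  assumes "periodic u N" "0 < u p" "0 < u q" "p \<in> {0..<N}" "q \<in> {0..<N}"
    and "linked u (p + 1) (q + 1)"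
  shows "p = q"
proof -
  obtain k where k: "siblings u (p + 1) (q + 1 + k * N)" using assms(6) by (auto simp: linked_def)
  have "parent u p (q + 1 + k * N)"
    using k assms(2) parent_add_1_iff unfolding siblings_def by blast
  moreover have "parent u (q + k * N) (q + 1 + k * N)"
    using parent_add_mult[OF assms(1)] assms(3) parent_add_1_iff by blast
  ultimately have "p = q + k * N" by (rule parent_unique)
  then have "p mod N = q mod N" by simp
  then show ?thesis using assms(4,5) by simp
qed

lemma card_partition_of_full:
  assumes "full u" shows "int (card (partition_of u)) = support u N"
proof -
  have per: "periodic u N" using assms by (rule full_periodic)
  have "card (partition_of u) = card {p \<in> {0..<N}. 0 < u p}"
    unfolding partition_of_def
  proof (rule card_quotient_representatives[OF equiv_label_rel[OF per], of "\<lambda>p. nat (p + 1)"])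
    fix q assume "q \<in> {1..nat N}"
    moreover obtain p where "p \<in> {0..<N}" "0 < u p" "linked u (int q) (p + 1)"
      using positive_representative[OF assms] .
    ultimately show "\<exists>p\<in>{p \<in> {0..<N}. 0 < u p}. (q, nat (p + 1)) \<in> label_rel u"
      by (intro bexI[of _ p]) (auto simp: label_rel_def)
  next
    fix p q assume "p \<in> {p \<in> {0..<N}. 0 < u p}" "q \<in> {p \<in> {0..<N}. 0 < u p}"
      "(nat (p + 1), nat (q + 1)) \<in> label_rel u"
    then show "p = q"
      using positive_representative_unique[OF per, of p q] by (auto simp: label_rel_def)
  qed auto
  then show ?thesis using N_pos by (simp add: support_eq_card)
qed

lemma deficient_as_full:
  assumes "deficient u"
  obtains v where "full v" "partition_of v = partition_of u" "support v N = support u N + 1"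
proof -
  obtain c where c: "record_low u (c + 1)" using deficient_record_low_ex[OF assms] .
  show ?thesis
    using that[of "fill u c"] full_fill[OF assms c] support_fill[OF assms c]
      partition_of_cong[OF linked_fill[OF assms c]] by blast
qed

lemma card_partition_of_deficient:
  assumes "deficient u" shows "int (card (partition_of u)) = support u N + 1"
  using deficient_as_full[OF assms] card_partition_of_full by metis

lemma finite_partitions: "finite (partition_of ` A)"
proof (rule finite_subset)
  show "partition_of ` A \<subseteq> Pow (Pow {1..nat N})"
    by (auto simp: partition_of_def quotient_def label_rel_def)
qed simp

end

section \<open>Rotation\<close>

lemma bij_betw_rot: "bij_betw (rot n) {1..n} {1..n}"
proof -
  have "inj_on (rot n) {1..n}" by (auto simp: inj_on_def rot_def split: if_splits)
  moreover have "rot n ` {1..n} \<subseteq> {1..n}" by (auto simp: rot_def)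
  ultimately show ?thesis by (simp add: bij_betw_def endo_inj_surj)
qed

lemma rot_eq_add_1:
  assumes "i \<in> {1..n}" obtains k where "int (rot n i) - 1 = int i + k * int n"
  using assms that[of 0] that[of "- 1"] by (cases "i = n") (auto simp: rot_def)

context slope begin

lemma rot_partition_of:
  assumes "periodic u N" shows "rot_partition (nat N) (partition_of u) = partition_of (\<lambda>j. u (j - 1))"
  unfolding rot_partition_def partition_of_def
proof (rule image_quotient[OF bij_betw_rot])
  fix x y assume xy: "x \<in> {1..nat N}" "y \<in> {1..nat N}"
  obtain k l where "int (rot (nat N) x) - 1 = int x + k * N" "int (rot (nat N) y) - 1 = int y + l * N"
    using rot_eq_add_1[OF xy(1)] rot_eq_add_1[OF xy(2)] N_pos by (metis int_nat_eq less_imp_le)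
  then have "linked (\<lambda>j. u (j - 1)) (int (rot (nat N) x)) (int (rot (nat N) y)) \<longleftrightarrow>
      linked u (int x) (int y)"
    using linked_shift[of u "- 1"] linked_add_mult[OF assms] by simp
  moreover have "rot (nat N) x \<in> {1..nat N}" "rot (nat N) y \<in> {1..nat N}"
    using bij_betw_rot[of "nat N"] xy bij_betwE by blast+
  ultimately show "(rot (nat N) x, rot (nat N) y) \<in> label_rel (\<lambda>j. u (j - 1)) \<longleftrightarrow> (x, y) \<in> label_rel u"
    using xy by (simp add: label_rel_def)
qed (auto simp: label_rel_def)

lemma rot_partition_of_power:
  assumes "periodic u N"
  shows "(rot_partition (nat N) ^^ d) (partition_of u) = partition_of (\<lambda>j. u (j - int d))"
proof (induction d)
  case (Suc d)
  have "periodic (\<lambda>j. u (j - int d)) N" using periodic_shift[OF assms, of "- int d"] by simp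
  from rot_partition_of[OF this] show ?case using Suc by (simp add: algebra_simps)
qed simp

lemma rot_partition_of_fixed_iff:
  assumes "periodic u N"
  shows "(rot_partition (nat N) ^^ d) (partition_of u) = partition_of u \<longleftrightarrow>
    (\<forall>i j. linked u (i + int d) (j + int d) \<longleftrightarrow> linked u i j)"
proof -
  have "(rot_partition (nat N) ^^ d) (partition_of u) = partition_of u \<longleftrightarrow>
      linked (\<lambda>j. u (j - int d)) = linked u"
    unfolding rot_partition_of_power[OF assms]
    using partition_of_eq_iff[OF _ assms] periodic_shift[OF assms, of "- int d"] by simp
  also have "\<dots> \<longleftrightarrow> (\<forall>i j. linked u (i - int d) (j - int d) \<longleftrightarrow> linked u i j)"
    using linked_shift[of u "- int d"] by (auto simp: fun_eq_iff)
  also have "\<dots> \<longleftrightarrow> (\<forall>i j. linked u (i + int d) (j + int d) \<longleftrightarrow> linked u i j)"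
    by (metis add_diff_cancel_right' diff_add_cancel)
  finally show ?thesis .
qed

lemma rot_partition_closed:
  assumes "\<pi> \<in> partition_of ` Collect full" shows "rot_partition (nat N) \<pi> \<in> partition_of ` Collect full"
  using assms rot_partition_of[OF full_periodic] full_shift[of _ "- 1"] by auto

lemma card_rot_partition:
  assumes "\<pi> \<in> partition_of ` Collect full" shows "card (rot_partition (nat N) \<pi>) = card \<pi>"
proof -
  obtain u where u: "full u" "\<pi> = partition_of u" using assms by blast
  have "full (\<lambda>j. u (j - 1))" "support (\<lambda>j. u (j - 1)) N = support u N"
    using full_shift[OF u(1), of "- 1"] support_shift_period[OF full_periodic[OF u(1)], of "- 1"]
    by simp_all
  then have "int (card (partition_of (\<lambda>j. u (j - 1)))) = int (card (partition_of u))"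
    using card_partition_of_full u(1) by simp
  then show ?thesis using u rot_partition_of[OF full_periodic[OF u(1)]] by simp
qed

lemma rot_partition_period:
  assumes "\<pi> \<in> partition_of ` Collect full" shows "(rot_partition (nat N) ^^ nat N) \<pi> = \<pi>"
proof -
  obtain u where "periodic u N" "\<pi> = partition_of u" using assms full_periodic by blast
  then show ?thesis
    using periodic_shift_mult[of u N "- 1"] N_pos by (simp add: rot_partition_of_power)
qed

lemma not_root_straddled:
  assumes "full u" "\<not> is_root u c"
  obtains p q where "parent u p q" "p < c" "c < q"
proof -
  obtain j where "c < j" "\<not> ht u c < ht u j" using assms(2) by (auto simp: is_root_def)
  then obtain q where q: "c < q" "\<not> ht u c < ht u q"
    and above: "\<And>k. c < k \<Longrightarrow> k < q \<Longrightarrow> ht u c < ht u k"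
    using int_first_above[where P = "\<lambda>j. \<not> ht u c < ht u j"] by metis
  obtain p where p: "parent u p q" using full_parent_ex[OF assms(1)] .
  then have "ht u p < ht u c" "p < q" using q by (auto simp: parent_def)
  then have "p < c" using above[of p] by (cases p c rule: linorder_cases) auto
  then show ?thesis using that p q(1) by blast
qed

lemma linked_noncrossing:
  assumes "full u" "i < j" "j < k" "k < l" "l < i + N" "linked u i k" "linked u j l"
  shows "linked u i j"
proof -
  obtain v where rerooted: "full v" "is_root v (i - 1)" "linked v = linked u"
    using full_reroot[OF assms(1)] .
  note siblings = linked_iff_siblings[OF full_periodic[OF rerooted(1)] cut_if_is_root[OF rerooted(2)]]
  have "siblings v i k" "siblings v j l"
    using siblings[of i k] siblings[of j l] assms rerooted(3) by auto
  moreover obtain p q where pq: "parent v p i" "parent v q j"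
    using full_parent_ex[OF rerooted(1)] by metis
  ultimately have pk: "parent v p k" and ql: "parent v q l" by (auto simp: siblings_def)
  have "\<not> p < q"
  proof
    assume "p < q"
    then have "ht v k \<le> ht v q" "ht v l \<le> ht v k"
      using pq(2) pk ql assms(3,4) by (auto simp: parent_def)
    then show False using ql by (simp add: parent_def)
  qed
  moreover have "\<not> q < p"
  proof
    assume "q < p"
    then have "ht v j \<le> ht v p" "ht v k \<le> ht v j"
      using pq pk assms(2,3) by (auto simp: parent_def)
    then show False using pk by (simp add: parent_def)
  qed
  ultimately have "parent v p j" using pq(2) by simp
  then show ?thesis using linked_if_parent[OF pq(1)] rerooted(3) by simp
qed

end

section \<open>Partitions fixed by a rotation\<close>

text \<open>If no class is fixed by the rotation by \<open>g\<close>, then every class lies on an arc shorter than \<open>g\<close>,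
  and the left end of a longest such arc is not straddled by any other.\<close>

locale free_rotation =
  fixes R :: "int \<Rightarrow> int \<Rightarrow> bool" and N g :: int
  assumes equivp: "equivp R"
    and period: "R i (j + N) \<longleftrightarrow> R i j"
    and invariant: "R (i + g) (j + g) \<longleftrightarrow> R i j"
    and noncrossing: "i < j \<Longrightarrow> j < k \<Longrightarrow> k < l \<Longrightarrow> l < i + N \<Longrightarrow> R i k \<Longrightarrow> R j l \<Longrightarrow> R i j"
    and free: "\<not> R i (i + g)"
    and g_pos: "0 < g" and g_le: "2 * g \<le> N"
begin

lemma refl: "R i i" and sym: "R i j \<Longrightarrow> R j i" and trans: "R i j \<Longrightarrow> R j k \<Longrightarrow> R i k"
  using equivp by (blast intro: equivp_reflp equivp_symp equivp_transp)+

lemma short_or_long: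
  assumes "R i j" "i < j" "j < i + N"
  shows "j - i < g \<or> N - g < j - i"
proof (rule ccontr)
  assume "\<not> ?thesis"
  moreover have "j - i \<noteq> g" using free[of i] assms(1) by auto
  moreover have "j - i \<noteq> N - g"
  proof
    assume "j - i = N - g"
    then have "R j (j + g)" using period[of j i] sym[OF assms(1)] by (simp add: algebra_simps)
    then show False using free by simp
  qed
  ultimately have "R i (i + g)"
    using noncrossing[of i "i + g" j "j + g"] invariant[of i j] assms g_pos by auto
  then show False using free by simp
qed

lemma short_trans:
  assumes "R i j" "R j k" "i < j" "j < k" "j - i < g" "k - j < g"
  shows "k - i < g"
proof (rule ccontr)
  assume "\<not> ?thesis"
  moreover have ik: "R i k" using assms trans by blast
  moreover have "k \<noteq> i + g" using free[of i] ik by auto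
  ultimately have "i + g < k" by simp
  then have "R j (i + g)"
    using noncrossing[of j "i + g" k "j + g"] invariant[of i j] assms g_le sym by auto
  then have "R i (i + g)" using assms(1) trans by blast
  then show False using free by simp
qed

lemma not_straddled_ex: "\<exists>x. \<forall>i j. i < x \<longrightarrow> x \<le> j \<longrightarrow> j - i < g \<longrightarrow> \<not> R i j"
proof -
  define S where "S = {d \<in> {0..<g}. \<exists>x. R x (x + d)}"
  have fin: "finite S" unfolding S_def by (rule finite_subset[of _ "{0..<g}"]) auto
  moreover have "0 \<in> S" using g_pos refl by (auto simp: S_def)
  ultimately have "Max S \<in> S" using Max_in by blast
  then obtain x where "R x (x + Max S)" "0 \<le> Max S" "Max S < g" by (auto simp: S_def)
  then obtain y where xy: "R x y" "x \<le> y" "y - x < g" and y: "y = x + Max S" by auto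
  have longest: "j - i \<le> y - x" if "R i j" "i \<le> j" "j - i < g" for i j
  proof -
    have "j - i \<in> S" using that by (auto simp: S_def intro!: exI[of _ i])
    then show ?thesis using Max_ge[OF fin] by (simp add: y)
  qed
  have "\<not> R i j" if ij: "i < x" "x \<le> j" "j - i < g" for i j
  proof
    assume R: "R i j"
    show False
    proof (cases "R i x")
      case True
      then have "R i y" using xy(1) trans by blast
      moreover have "y - i < g" using short_trans[OF True xy(1)] ij xy by (cases "x = y") auto
      ultimately show False using longest[of i y] ij xy by simp
    next
      case False
      then have "x \<noteq> j" "y \<noteq> j" using R xy(1) sym trans by blast+
      moreover have "\<not> j < y" using noncrossing[of i x j y] R xy False ij g_le \<open>x \<noteq> j\<close> by auto
      ultimately show False using longest[OF R] ij xy by simp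
    qed
  qed
  then show ?thesis by blast
qed

end

context slope begin

definition symmetric_words :: "int \<Rightarrow> (int \<Rightarrow> nat) set" where
  "symmetric_words g = {u. periodic u g \<and> psum u N \<le> a}"

context
  fixes g e :: int
  assumes g_pos: "0 < g" and e_ge: "2 \<le> e" and N_eq: "N = e * g"
begin

lemma two_g_le: "2 * g \<le> N"
  using mult_right_mono[OF e_ge] g_pos N_eq by simp

lemma periodic_N: "periodic u g \<Longrightarrow> periodic u N"
  using periodic_multiple N_eq by simp

lemma symmetric_words_cases:
  assumes "u \<in> symmetric_words g" obtains "full u" | "deficient u"
  using assms periodic_N[of u] unfolding symmetric_words_def full_def deficient_def
  by (cases "psum u N = a") auto

lemma siblings_if_linked_near:
  assumes "periodic u g" "parent u p i" "linked u i j" "p - g < j" "j \<le> p + N"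
  shows "siblings u i j"
proof -
  obtain k where k: "siblings u i (j + k * N)" using assms(3) unfolding linked_def by blast
  then have "parent u p (j + k * N)" using assms(2) by (simp add: siblings_def)
  then have "p < j + k * N" "j + k * N \<le> p + g"
    using parent_less_period[OF assms(1) g_pos] by (auto simp: parent_def)
  then have "(- 1) * N < k * N" "k * N < 1 * N" using assms(4,5) two_g_le g_pos by linarith+
  then have "k = 0" using N_pos by (simp only: mult_less_cancel_right_pos)
  then show ?thesis using k by simp
qed

lemma linked_add_g_iff_record_low:
  assumes "periodic u g" shows "linked u x (x + g) \<longleftrightarrow> record_low u x"
proof
  assume low: "record_low u x"
  then have "record_low u (x + g)" using record_low_add_mult[OF assms, of x 1] by simp
  then show "linked u x (x + g)" using siblings_if_record_low[OF low] linked_if_siblings by blast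
next
  assume linked: "linked u x (x + g)"
  show "record_low u x" unfolding record_low_iff
  proof (intro allI notI)
    fix p assume p: "parent u p x"
    then have "p < x" "x \<le> p + g"
      using parent_less_period[OF assms g_pos p] by (auto simp: parent_def)
    then have "siblings u x (x + g)"
      using siblings_if_linked_near[OF assms p linked] two_g_le g_pos by simp
    then have "parent u p (x + g)" using p by (simp add: siblings_def)
    then show False using parent_less_period[OF assms g_pos] \<open>p < x\<close> by fastforce
  qed
qed

lemma is_root_if_linked_eq:
  assumes "periodic u g" "periodic v g" "full u" "full v" "linked u = linked v" "is_root u c"
  shows "is_root v c"
proof (rule ccontr)
  assume "\<not> is_root v c"
  then obtain p q where pq: "parent v p q" "p < c" "c < q"
    using not_root_straddled[OF assms(4)] by blast
  have linked: "linked u (p + 1) q"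
    using linked_first_child[OF pq(1)] assms(5) by simp
  obtain t where t: "parent u t (p + 1)" using full_parent_ex[OF assms(3)] .
  have "t < p + 1" "p + 1 \<le> t + g" "q \<le> p + g"
    using t parent_less_period[OF assms(1) g_pos t] parent_less_period[OF assms(2) g_pos pq(1)]
    by (auto simp: parent_def)
  then have "siblings u (p + 1) q"
    using siblings_if_linked_near[OF assms(1) t linked] pq two_g_le g_pos by simp
  then have "parent u t q" using t by (simp add: siblings_def)
  then have "c \<le> t" using parent_ge[of u t q c] assms(6) pq by (simp add: is_root_def)
  then show False using \<open>t < p + 1\<close> pq by simp
qed

lemma inj_on_symmetric_words: "inj_on partition_of (symmetric_words g)"
proof
  fix u v assume uv: "u \<in> symmetric_words g" "v \<in> symmetric_words g" "partition_of u = partition_of v"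
  have per: "periodic u g" "periodic v g" using uv by (auto simp: symmetric_words_def)
  have linked: "linked u = linked v"
    using partition_of_eq_iff[OF per[THEN periodic_N]] uv(3) by simp
  then have low: "record_low u x \<longleftrightarrow> record_low v x" for x
    using linked_add_g_iff_record_low per by metis
  have full_iff: "full w \<longleftrightarrow> (\<forall>x. \<not> record_low w x)" if "w \<in> symmetric_words g" for w
    using symmetric_words_cases[OF that] full_not_record_low deficient_record_low_ex by metis
  show "u = v"
  proof (cases rule: symmetric_words_cases[OF uv(1), case_names full deficient])
    case full
    then have "full v" using full_iff[OF uv(1)] full_iff[OF uv(2)] low by simp
    moreover obtain c where "is_root u c" using full_is_root_ex[OF full] .
    ultimately show ?thesis
      using full_eq_if_linked_eq[OF full] is_root_if_linked_eq[OF per full _ linked] linked by blast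
  next
    case deficient
    then obtain c where c: "record_low u (c + 1)" using deficient_record_low_ex by blast
    then have "record_low v (c + 1)" "\<not> full v" using low full_not_record_low by blast+
    then show ?thesis
      using symmetric_words_cases[OF uv(2)] deficient_eq_if_linked_eq[OF deficient c] linked
      by blast
  qed
qed

context
  fixes u :: "int \<Rightarrow> nat"
  assumes full: "full u" and invariant: "\<And>i j. linked u (i + g) (j + g) \<longleftrightarrow> linked u i j"
begin

lemma linked_shift_eq_if_linked_eq: "linked v = linked u \<Longrightarrow> linked (\<lambda>j. v (j + g)) = linked v"
  by (simp add: fun_eq_iff linked_shift invariant)

lemma symmetric_word_if_center:
  assumes center: "linked u x (x + g)"
  obtains v where "v \<in> symmetric_words g" "linked v = linked u"
proof -
  obtain w where rerooted: "full w" "is_root w (x - 1)" "linked w = linked u"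
    using full_reroot[OF full] .
  define v where "v = drain w (x - 1)"
  have drained: "deficient v" "record_low v (x - 1 + 1)" "linked v = linked u"
    using deficient_drain[OF rerooted(1,2)] record_low_drain[OF rerooted(1,2)]
      linked_drain[OF rerooted(1,2)] rerooted(3)
    by (auto simp: v_def)
  have "record_low v (x + g)"
    using record_low_if_linked[OF deficient_periodic[OF drained(1)], of x "x + g"] drained(2,3)
      center
    by simp
  then have "record_low (\<lambda>j. v (j + g)) (x - 1 + 1)" by (simp add: record_low_shift)
  then have "(\<lambda>j. v (j + g)) = v"
    using deficient_eq_if_linked_eq[OF deficient_shift[OF drained(1)] _ drained(1,2)]
      linked_shift_eq_if_linked_eq[OF drained(3)] by blast
  then have "periodic v g" by (simp add: periodic_fun_simple_def fun_eq_iff)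
  then show ?thesis using that[of v] drained by (simp add: symmetric_words_def deficient_def)
qed

lemma is_root_add_g:
  assumes free: "\<And>x. \<not> linked u x (x + g)"
    and not_straddled: "\<And>i j. i < x \<Longrightarrow> x \<le> j \<Longrightarrow> j - i < g \<Longrightarrow> \<not> linked u i j"
    and rerooted: "full w" "is_root w (x - 1)" "linked w = linked u"
  shows "is_root w (x - 1 + g)"
proof (rule ccontr)
  interpret free_rotation "linked u" N g
    using equivp_linked[OF full_periodic[OF full]] linked_add_mult_right[of u _ _ 1]
      linked_noncrossing[OF full] invariant free g_pos two_g_le by unfold_locales auto
  assume "\<not> ?thesis"
  then obtain p q where pq: "parent w p q" "p < x - 1 + g" "x - 1 + g < q"
    using not_root_straddled[OF rerooted(1)] by blast
  have linked: "linked u (p + 1) q" using linked_first_child[OF pq(1)] rerooted(3) by simp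
  have "is_root w (x - 1 + N)"
    using is_root_add_period[OF full_periodic[OF rerooted(1)]] rerooted(2) by simp
  then have q_le: "q \<le> x - 1 + N"
    using parent_ge[OF pq(1), of "x - 1 + N"] pq g_pos two_g_le by (force simp: is_root_def)
  have p_ge: "x - 1 \<le> p" using parent_ge[OF pq(1)] rerooted(2) pq g_pos by (simp add: is_root_def)
  then consider (short) "q - (p + 1) < g" | (long) "N - g < q - (p + 1)"
    using short_or_long[OF linked] pq q_le by force
  then show False
  proof cases
    case short
    moreover have "linked u (p + 1 - g) (q - g)"
      using invariant[of "p + 1 - g" "q - g"] linked by simp
    ultimately show False using not_straddled[of "p + 1 - g" "q - g"] pq by simp
  next
    case long
    moreover have "linked u (q - N) (p + 1)" using period[of "p + 1" "q - N"] sym linked by simp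
    ultimately show False using not_straddled[of "q - N" "p + 1"] p_ge q_le by simp
  qed
qed

lemma symmetric_word_if_free:
  assumes free: "\<And>x. \<not> linked u x (x + g)"
  obtains v where "v \<in> symmetric_words g" "linked v = linked u"
proof -
  interpret free_rotation "linked u" N g
    using equivp_linked[OF full_periodic[OF full]] linked_add_mult_right[of u _ _ 1]
      linked_noncrossing[OF full] invariant free g_pos two_g_le by unfold_locales auto
  obtain x where not_straddled: "\<And>i j. i < x \<Longrightarrow> x \<le> j \<Longrightarrow> j - i < g \<Longrightarrow> \<not> linked u i j"
    using not_straddled_ex by blast
  obtain w where rerooted: "full w" "is_root w (x - 1)" "linked w = linked u"
    using full_reroot[OF full] .
  have "is_root (\<lambda>j. w (j + g)) (x - 1)"
    using is_root_add_g[OF free not_straddled rerooted] by (simp add: is_root_shift)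
  then have "(\<lambda>j. w (j + g)) = w"
    using full_eq_if_linked_eq[OF full_shift[OF rerooted(1)] _ rerooted(1,2)]
      linked_shift_eq_if_linked_eq[OF rerooted(3)]
    by blast
  then have "periodic w g" by (simp add: periodic_fun_simple_def fun_eq_iff)
  then show ?thesis using that[of w] rerooted by (simp add: symmetric_words_def full_def)
qed

end

lemma bij_betw_symmetric_words:
  "bij_betw partition_of (symmetric_words g)
     {\<pi> \<in> partition_of ` Collect full. (rot_partition (nat N) ^^ nat g) \<pi> = \<pi>}"
  unfolding bij_betw_def
proof (intro conjI inj_on_symmetric_words subset_antisym subsetI)
  fix \<pi> assume "\<pi> \<in> partition_of ` symmetric_words g"
  then obtain u where u: "u \<in> symmetric_words g" "\<pi> = partition_of u" by blast
  then have per: "periodic u g" by (simp add: symmetric_words_def)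
  have "\<pi> \<in> partition_of ` Collect full"
    using symmetric_words_cases[OF u(1)] deficient_as_full u(2) by (metis imageI mem_Collect_eq)
  moreover have "(rot_partition (nat N) ^^ nat g) \<pi> = \<pi>"
    using periodic_shift_mult[OF per, of "- 1"] g_pos
    by (simp add: u(2) rot_partition_of_power[OF periodic_N[OF per]])
  ultimately show "\<pi> \<in> {\<pi> \<in> partition_of ` Collect full. (rot_partition (nat N) ^^ nat g) \<pi> = \<pi>}"
    by simp
next
  fix \<pi> assume "\<pi> \<in> {\<pi> \<in> partition_of ` Collect full. (rot_partition (nat N) ^^ nat g) \<pi> = \<pi>}"
  then obtain u where u: "full u" "\<pi> = partition_of u"
    and "(rot_partition (nat N) ^^ nat g) (partition_of u) = partition_of u" by blast
  then have "linked u (i + g) (j + g) \<longleftrightarrow> linked u i j" for i j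
    using rot_partition_of_fixed_iff[OF full_periodic[OF u(1)]] g_pos by simp
  then obtain v where "v \<in> symmetric_words g" "linked v = linked u"
    using symmetric_word_if_center[OF u(1)] symmetric_word_if_free[OF u(1)] by metis
  then show "\<pi> \<in> partition_of ` symmetric_words g" using partition_of_cong u(2) by blast
qed

lemma mem_symmetric_words: "u \<in> symmetric_words g \<longleftrightarrow> periodic u g \<and> e * psum u g \<le> a"
  unfolding symmetric_words_def using psum_mult_period[of u g e] by (auto simp flip: N_eq)

lemma card_partition_of_symmetric:
  assumes "u \<in> symmetric_words g"
  shows "int (card (partition_of u)) = e * support u g + of_bool (e * psum u g < a)"
proof -
  have "periodic u g" using assms by (simp add: symmetric_words_def)
  then have "psum u N = e * psum u g" "support u N = e * support u g"
    using psum_mult_period[of u g e] support_mult_period[of u g e] N_eq by auto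
  then show ?thesis
    using symmetric_words_cases[OF assms] card_partition_of_full[of u]
      card_partition_of_deficient[of u]
    by (auto simp: full_def deficient_def)
qed

lemma symmetric_words_with_card:
  "{u \<in> symmetric_words g. card (partition_of u) = k} =
    {u. periodic u g \<and> e * support u g = int k \<and> e * psum u g = a} \<union>
    {u. periodic u g \<and> e * support u g + 1 = int k \<and> e * psum u g < a}"
proof (rule Set.set_eqI)
  fix u
  have "card (partition_of u) = k \<longleftrightarrow> e * support u g + of_bool (e * psum u g < a) = int k"
    if "u \<in> symmetric_words g"
    using card_partition_of_symmetric[OF that] by presburger
  then show "u \<in> {u \<in> symmetric_words g. card (partition_of u) = k} \<longleftrightarrow>
      u \<in> {u. periodic u g \<and> e * support u g = int k \<and> e * psum u g = a} \<union>
        {u. periodic u g \<and> e * support u g + 1 = int k \<and> e * psum u g < a}"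
    by (cases "e * psum u g" a rule: linorder_cases) (auto simp: mem_symmetric_words)
qed

end

end

section \<open>Counting words\<close>

definition bounded_lists :: "nat \<Rightarrow> nat \<Rightarrow> nat \<Rightarrow> nat list set" where
  "bounded_lists n m S = {xs. length xs = n \<and> length (filter ((<) 0) xs) = m \<and> sum_list xs \<le> S}"

lemma finite_lists_sum_le: "finite {xs :: nat list. length xs = n \<and> sum_list xs \<le> S}"
proof (rule finite_subset)
  show "{xs :: nat list. length xs = n \<and> sum_list xs \<le> S} \<subseteq> {xs. set xs \<subseteq> {..S} \<and> length xs = n}"
    using member_le_sum_list by fastforce
qed (simp add: finite_lists_length_eq)

lemma finite_bounded_lists: "finite (bounded_lists n m S)"
  by (rule finite_subset[OF _ finite_lists_sum_le[of n S]]) (auto simp: bounded_lists_def)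

lemma bounded_lists_Suc_0: "bounded_lists (Suc n) 0 S = Cons 0 ` bounded_lists n 0 S"
  by (auto simp: bounded_lists_def length_Suc_conv image_iff split: if_splits)

lemma bounded_lists_Suc_Suc:
  "bounded_lists (Suc n) (Suc m) S =
    Cons 0 ` bounded_lists n (Suc m) S \<union> (\<Union>x\<in>{1..S}. Cons x ` bounded_lists n m (S - x))"
proof (intro subset_antisym subsetI)
  fix ys assume ys: "ys \<in> bounded_lists (Suc n) (Suc m) S"
  then obtain x xs where x: "ys = x # xs" by (auto simp: bounded_lists_def length_Suc_conv)
  show "ys \<in> Cons 0 ` bounded_lists n (Suc m) S \<union> (\<Union>x\<in>{1..S}. Cons x ` bounded_lists n m (S - x))"
  proof (cases "x = 0")
    case False
    then have "x \<in> {1..S}" "xs \<in> bounded_lists n m (S - x)"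
      using ys x by (auto simp: bounded_lists_def)
    then show ?thesis using x by blast
  qed (use ys x in \<open>auto simp: bounded_lists_def\<close>)
qed (auto simp: bounded_lists_def)

lemma card_bounded_lists: "card (bounded_lists n m S) = (n choose m) * (S choose m)"
proof (induction n arbitrary: m S)
  case 0
  have "bounded_lists 0 m S = (if m = 0 then {[]} else {})" by (auto simp: bounded_lists_def)
  then show ?case by simp
next
  case (Suc n)
  show ?case
  proof (cases m)
    case 0
    then show ?thesis using Suc.IH[of 0 S] by (simp add: bounded_lists_Suc_0 card_image)
  next
    case (Suc m')
    have "card (bounded_lists (Suc n) m S) = card (Cons 0 ` bounded_lists n m S) +
        card (\<Union>x\<in>{1..S}. Cons x ` bounded_lists n m' (S - x))"
      unfolding Suc bounded_lists_Suc_Suc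
      by (rule card_Un_disjoint) (use finite_bounded_lists in auto)
    also have "card (\<Union>x\<in>{1..S}. Cons x ` bounded_lists n m' (S - x)) =
        (\<Sum>x\<in>{1..S}. card (Cons x ` bounded_lists n m' (S - x)))"
      by (rule card_UN_disjoint) (use finite_bounded_lists in auto)
    also have "\<dots> = (n choose m') * (\<Sum>x\<in>{1..S}. S - x choose m')"
      using Suc.IH by (simp add: card_image sum_distrib_left)
    also have "(\<Sum>x\<in>{1..S}. S - x choose m') = (\<Sum>x<S. x choose m')"
      by (rule sum.reindex_bij_witness[of _ "\<lambda>x. S - x" "\<lambda>x. S - x"]) auto
    also have "\<dots> = S choose m" unfolding Suc by (induction S) simp_all
    finally show ?thesis using Suc.IH[of m S] by (simp add: card_image Suc algebra_simps)
  qed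
qed

lemma card_lists_sum_eq:
  "card {xs. length xs = n \<and> length (filter ((<) 0) xs) = Suc m \<and> sum_list xs = Suc s} =
    (n choose Suc m) * (s choose m)"
proof -
  have "{xs. length xs = n \<and> length (filter ((<) 0) xs) = Suc m \<and> sum_list xs = Suc s} =
      bounded_lists n (Suc m) (Suc s) - bounded_lists n (Suc m) s"
    by (auto simp: bounded_lists_def)
  also have "card \<dots> = card (bounded_lists n (Suc m) (Suc s)) - card (bounded_lists n (Suc m) s)"
    by (rule card_Diff_subset[OF finite_bounded_lists]) (auto simp: bounded_lists_def)
  finally show ?thesis by (simp add: card_bounded_lists algebra_simps)
qed

definition periodic_word :: "nat list \<Rightarrow> int \<Rightarrow> nat" where
  "periodic_word xs j = xs ! nat (j mod int (length xs))"

lemma periodic_word_nth: "i < length xs \<Longrightarrow> periodic_word xs (int i) = xs ! i"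
  by (simp add: periodic_word_def flip: of_nat_mod)

lemma periodic_periodic_word: "periodic (periodic_word xs) (int (length xs))"
  by (simp add: periodic_fun_simple_def periodic_word_def)

lemma psum_of_nat: "psum u (int n) = (\<Sum>i<n. int (u (int i)))"
  by (induction n) (simp_all add: psum_add_1 add.commute[of 1])

lemma psum_periodic_word: "psum (periodic_word xs) (int (length xs)) = int (sum_list xs)"
  by (simp add: psum_of_nat periodic_word_nth sum_list_sum_nth atLeast0LessThan)

lemma support_periodic_word:
  "support (periodic_word xs) (int (length xs)) = int (length (filter ((<) 0) xs))"
proof -
  have "support (periodic_word xs) (int (length xs)) = (\<Sum>i<length xs. of_bool (0 < xs ! i))"
    by (simp add: support_def psum_of_nat periodic_word_nth)
  also have "\<dots> = int (\<Sum>x\<leftarrow>xs. of_bool (0 < x))"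
    by (simp add: sum_list_sum_nth atLeast0LessThan)
  also have "(\<Sum>x\<leftarrow>xs. of_bool (0 < x)) = length (filter ((<) 0) xs)"
    by (induction xs) auto
  finally show ?thesis .
qed

lemma bij_betw_periodic_word:
  assumes "0 < n"
  shows "bij_betw periodic_word {xs. length xs = n} {u. periodic u (int n)}"
proof (rule bij_betwI[of _ _ _ "\<lambda>u. map (\<lambda>i. u (int i)) [0..<n]"])
  fix xs :: "nat list" assume "xs \<in> {xs. length xs = n}"
  then show "map (\<lambda>i. periodic_word xs (int i)) [0..<n] = xs"
    by (auto intro!: nth_equalityI simp: periodic_word_nth)
next
  fix u :: "int \<Rightarrow> nat" assume "u \<in> {u. periodic u (int n)}"
  then have "u (j mod int n) = u j" for j using periodic_mod by auto
  moreover have "nat (j mod int n) < n" for j using assms by (simp add: nat_less_iff)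
  ultimately show "periodic_word (map (\<lambda>i. u (int i)) [0..<n]) = u"
    using assms by (auto simp: periodic_word_def)
qed (use periodic_periodic_word in auto)

lemma bij_betw_periodic_word_restrict:
  assumes "0 < n"
  shows "bij_betw periodic_word
    {xs \<in> {xs. length xs = n}. Q (int (length (filter ((<) 0) xs))) (int (sum_list xs))}
    {u \<in> {u. periodic u (int n)}. Q (support u (int n)) (psum u (int n))}"
  by (rule bij_betw_Collect[OF bij_betw_periodic_word[OF assms]])
     (use support_periodic_word psum_periodic_word in auto)

lemma finite_words: "0 < n \<Longrightarrow> finite {u. periodic u (int n) \<and> psum u (int n) \<le> int S}"
  using bij_betw_finite[OF bij_betw_periodic_word_restrict[of n "\<lambda>m s. s \<le> int S"]]
    finite_lists_sum_le[of n S] by simp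

lemma card_words_sum_le:
  "0 < n \<Longrightarrow> card {u. periodic u (int n) \<and> support u (int n) = int m \<and> psum u (int n) \<le> int S} =
    (n choose m) * (S choose m)"
  using bij_betw_same_card[OF bij_betw_periodic_word_restrict[of n "\<lambda>m' s. m' = int m \<and> s \<le> int S"]]
    card_bounded_lists[of n m S] by (simp add: bounded_lists_def)

lemma card_words_sum_eq:
  "0 < n \<Longrightarrow>
    card {u. periodic u (int n) \<and> support u (int n) = int (Suc m) \<and> psum u (int n) = int (Suc s)} =
    (n choose Suc m) * (s choose m)"
  using bij_betw_same_card[OF bij_betw_periodic_word_restrict[of n
      "\<lambda>m' s'. m' = int (Suc m) \<and> s' = int (Suc s)"]]
    card_lists_sum_eq[of n m s] by (simp del: of_nat_Suc)

section \<open>The number of partitions fixed by a rotation\<close>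

definition fixed_narayana :: "nat \<Rightarrow> nat \<Rightarrow> nat \<Rightarrow> nat \<Rightarrow> nat" where
  "fixed_narayana e g a k =
    (if e dvd a \<and> e dvd k then (g choose (k div e)) * ((a - 1) div e choose ((k - 1) div e)) else 0) +
    (if e dvd k - 1 then (g choose ((k - 1) div e)) * ((a - 1) div e choose ((k - 1) div e)) else 0)"

lemma Suc_mult_pred_div:
  fixes e m :: nat
  assumes "0 < e" shows "(e * Suc m - 1) div e = m"
  by (rule div_nat_eqI) (use assms in auto)

lemma card_words_dividing:
  assumes "0 < g" "0 < e" "0 < a" "0 < k"
  shows "card {u. periodic u (int g) \<and>
      int e * support u (int g) = int k \<and> int e * psum u (int g) = int a} =
    (if e dvd a \<and> e dvd k then (g choose (k div e)) * ((a - 1) div e choose ((k - 1) div e)) else 0)"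
  (is "card ?W = _")
proof (cases "e dvd a \<and> e dvd k")
  case True
  then obtain s m where "a = e * s" "k = e * m" by (auto elim!: dvdE)
  then obtain s' m' where sm: "a = e * Suc s'" "k = e * Suc m'"
    using assms(3,4) by (metis mult_0_right not0_implies_Suc not_less_iff_gr_or_eq)
  have "?W = {u. periodic u (int g) \<and> support u (int g) = int (Suc m') \<and> psum u (int g) = int (Suc s')}"
    using assms(2) by (simp add: sm del: of_nat_Suc mult_Suc_right)
  then have "card ?W = (g choose Suc m') * (s' choose m')"
    using card_words_sum_eq[OF assms(1), of m' s'] by simp
  moreover have "k div e = Suc m'" "(k - 1) div e = m'" "(a - 1) div e = s'"
    using assms(2) Suc_mult_pred_div[OF assms(2)] unfolding sm by simp_all
  ultimately show ?thesis using True by simp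
next
  case False
  have "e dvd a \<and> e dvd k" if "u \<in> ?W" for u
  proof -
    have "int a = int e * psum u (int g)" "int k = int e * support u (int g)" using that by auto
    then have "int e dvd int a" "int e dvd int k" by simp_all
    then show ?thesis by simp
  qed
  then have "?W = {}" using False by blast
  then show ?thesis unfolding if_not_P[OF False] by (simp only: card.empty)
qed

lemma mult_less_iff_le_div:
  fixes e a :: nat
  assumes "0 < e" "0 < a" shows "int e * x < int a \<longleftrightarrow> x \<le> int ((a - 1) div e)"
proof
  let ?q = "(a - 1) div e"
  have "int a \<le> int (e * Suc ?q)"
    using dividend_less_times_div[OF assms(1), of "a - 1"] unfolding of_nat_le_iff by simp
  moreover assume "int e * x < int a"
  ultimately have "int e * x < int e * int (Suc ?q)" by (simp add: distrib_left)
  then show "x \<le> int ?q" using assms(1) by simp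
next
  assume "x \<le> int ((a - 1) div e)"
  then have "int e * x \<le> int (e * ((a - 1) div e))" by (simp add: mult_left_mono)
  also have "\<dots> < int a"
    unfolding of_nat_less_iff using times_div_less_eq_dividend[of e "a - 1"] assms(2) by linarith
  finally show "int e * x < int a" .
qed

lemma card_words_less:
  assumes "0 < g" "0 < e" "0 < a" "0 < k"
  shows "card {u. periodic u (int g) \<and>
      int e * support u (int g) + 1 = int k \<and> int e * psum u (int g) < int a} =
    (if e dvd k - 1 then (g choose ((k - 1) div e)) * ((a - 1) div e choose ((k - 1) div e)) else 0)"
  (is "card ?W = _")
proof (cases "e dvd k - 1")
  case True
  then obtain m where m: "k = Suc (e * m)" using assms(4) by (metis Suc_pred' dvdE)
  have "int e * x < int a \<longleftrightarrow> x \<le> int ((a - 1) div e)" for x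
    using mult_less_iff_le_div[OF assms(2,3)] .
  then have "?W = {u. periodic u (int g) \<and> support u (int g) = int m \<and> psum u (int g) \<le> int ((a - 1) div e)}"
    using assms(2) by (auto simp: m)
  then show ?thesis using card_words_sum_le[OF assms(1)] True m assms(2) by simp
next
  case False
  have "e dvd k - 1" if "u \<in> ?W" for u
  proof -
    have "int (k - 1) = int e * support u (int g)" using that assms(4) by auto
    then have "int e dvd int (k - 1)" by simp
    then show ?thesis by (simp only: int_dvd_int_iff)
  qed
  then have "?W = {}" using False by blast
  then show ?thesis unfolding if_not_P[OF False] by (simp only: card.empty)
qed

context slope begin

lemma finite_symmetric_words:
  assumes "0 < g" "2 \<le> e" "N = e * int g" shows "finite (symmetric_words (int g))"
proof (rule finite_subset)
  show "symmetric_words (int g) \<subseteq> {u. periodic u (int g) \<and> psum u (int g) \<le> int (nat a)}"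
  proof
    fix u assume "u \<in> symmetric_words (int g)"
    then have u: "periodic u (int g)" "e * psum u (int g) \<le> a"
      using mem_symmetric_words[of "int g" e u] assms by simp_all
    have "1 * psum u (int g) \<le> e * psum u (int g)"
      using assms(2) by (intro mult_right_mono psum_nonneg) auto
    then show "u \<in> {u. periodic u (int g) \<and> psum u (int g) \<le> int (nat a)}" using u a_pos by simp
  qed
qed (use finite_words assms(1) in blast)

lemma card_fixed_partitions:
  assumes "0 < g" "2 \<le> e" "N = int e * int g" "0 < k"
  shows "card {\<pi> \<in> partition_of ` Collect full. card \<pi> = k \<and> (rot_partition (nat N) ^^ g) \<pi> = \<pi>} =
    fixed_narayana e g (nat a) k"
proof -
  let ?W = "{u \<in> symmetric_words (int g). card (partition_of u) = k}"
  let ?full = "{u. periodic u (int g) \<and> int e * support u (int g) = int k \<and> int e * psum u (int g) = a}"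
  let ?deficient =
    "{u. periodic u (int g) \<and> int e * support u (int g) + 1 = int k \<and> int e * psum u (int g) < a}"
  have factors: "0 < int g" "2 \<le> int e" "N = int e * int g" using assms by auto
  have "bij_betw partition_of ?W {\<pi> \<in> {\<pi> \<in> partition_of ` Collect full.
      (rot_partition (nat N) ^^ nat (int g)) \<pi> = \<pi>}. card \<pi> = k}"
    by (rule bij_betw_Collect[OF bij_betw_symmetric_words[OF factors]]) simp
  then have "card {\<pi> \<in> partition_of ` Collect full. card \<pi> = k \<and> (rot_partition (nat N) ^^ g) \<pi> = \<pi>} =
      card (?full \<union> ?deficient)"
    unfolding symmetric_words_with_card[OF factors]
    by (simp add: bij_betw_same_card conj_commute conj_left_commute)
  also have "\<dots> = card ?full + card ?deficient"
  proof (rule card_Un_disjoint)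
    have "finite (?full \<union> ?deficient)"
      using finite_symmetric_words[of g "int e"] assms(1-3)
      by (simp flip: symmetric_words_with_card[OF factors])
    then show "finite ?full" "finite ?deficient" by (simp_all only: finite_Un)
  qed auto
  also have "\<dots> = fixed_narayana e g (nat a) k"
    using card_words_dividing[of g e "nat a" k] card_words_less[of g e "nat a" k] assms a_pos
    by (simp add: fixed_narayana_def)
  finally show ?thesis .
qed

section \<open>The cycle lemma\<close>

text \<open>Among the \<open>b\<close> cyclic shifts of a word of length \<open>b\<close> and sum \<open>a\<close> exactly one starts at the minimum
  of its walk, and that one ends in a \<open>0\<close>, which is dropped.\<close>

definition dyck_words :: "(int \<Rightarrow> nat) set" where
  "dyck_words = {u. full u \<and> is_root u 0}"

definition cyclic_words :: "nat \<Rightarrow> (int \<Rightarrow> nat) set" where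
  "cyclic_words k = {w. periodic w b \<and> support w b = int k \<and> psum w b = a}"

definition lowest_at :: "(int \<Rightarrow> nat) \<Rightarrow> int \<Rightarrow> bool" where
  "lowest_at w c \<longleftrightarrow> (\<forall>j. ht w c \<le> ht w j)"

lemma ht_cong: "0 \<le> j \<Longrightarrow> (\<And>i. 0 \<le> i \<Longrightarrow> i < j \<Longrightarrow> u i = v i) \<Longrightarrow> ht u j = ht v j"
  unfolding ht_def using psum_cong[of j u v] by simp

lemma ht_mod_cyclic:
  assumes "w \<in> cyclic_words k" shows "ht w (j mod b) = ht w j"
proof -
  have "periodic (ht w) b"
    using ht_add_period[of w b] assms
    by (simp add: cyclic_words_def ht_def[of w b] periodic_fun_simple_def)
  then show ?thesis by (rule periodic_mod)
qed

lemma cyclic_words_shift: "w \<in> cyclic_words k \<Longrightarrow> (\<lambda>j. w (j + c)) \<in> cyclic_words k"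
  by (simp add: cyclic_words_def periodic_shift psum_shift_period support_shift_period)

lemma lowest_at_shift: "lowest_at (\<lambda>j. w (j + d)) c \<longleftrightarrow> lowest_at w (c + d)"
  unfolding lowest_at_def ht_shift by (simp, metis diff_add_cancel)

lemma finite_cyclic_words: "finite (cyclic_words k)"
  by (rule finite_subset[OF _ finite_words[of "nat b" "nat a"]])
     (use a_pos b_pos in \<open>auto simp: cyclic_words_def\<close>)

lemma card_cyclic_words: "card (cyclic_words (Suc k)) = (nat b choose Suc k) * (nat a - 1 choose k)"
  using card_words_sum_eq[of "nat b" k "nat a - 1"] a_pos b_pos
  by (simp add: cyclic_words_def of_nat_diff)

lemma card_lowest_at:
  "card {w \<in> cyclic_words k. lowest_at w c} = card {w \<in> cyclic_words k. lowest_at w 0}"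
proof (rule bij_betw_same_card[of "\<lambda>w j. w (j + c)"], rule bij_betwI[of _ _ _ "\<lambda>w j. w (j + - c)"])
  show "(\<lambda>w j. w (j + c)) \<in> {w \<in> cyclic_words k. lowest_at w c} \<rightarrow> {w \<in> cyclic_words k. lowest_at w 0}"
    using cyclic_words_shift by (simp add: lowest_at_shift)
  show "(\<lambda>w j. w (j + - c)) \<in> {w \<in> cyclic_words k. lowest_at w 0} \<rightarrow> {w \<in> cyclic_words k. lowest_at w c}"
    using cyclic_words_shift lowest_at_shift[of _ "- c" c] by (auto simp del: add_uminus_conv_diff)
qed simp_all

lemma cyclic_word_lowest_ex1:
  assumes "w \<in> cyclic_words k" shows "\<exists>!c. c \<in> {0..<b} \<and> lowest_at w c"
proof (rule ex_ex1I)
  obtain c where c: "0 \<le> c" "c < b" and min: "\<And>j. 0 \<le> j \<Longrightarrow> j < b \<Longrightarrow> ht w c \<le> ht w j"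
    using int_interval_argmin[OF b_pos] by blast
  have "ht w c \<le> ht w j" for j using min[of "j mod b"] ht_mod_cyclic[OF assms, of j] b_pos by simp
  then show "\<exists>c. c \<in> {0..<b} \<and> lowest_at w c" using c by (auto simp: lowest_at_def)
next
  fix c c' assume "c \<in> {0..<b} \<and> lowest_at w c" "c' \<in> {0..<b} \<and> lowest_at w c'"
  then show "c = c'" using ht_inj[of w c c'] by (simp add: lowest_at_def order_antisym abs_less_iff)
qed

lemma card_cyclic_words_lowest:
  "card (cyclic_words k) = nat b * card {w \<in> cyclic_words k. lowest_at w 0}"
proof -
  have "cyclic_words k = (\<Union>c\<in>{0..<b}. {w \<in> cyclic_words k. lowest_at w c})"
    using cyclic_word_lowest_ex1 by blast
  then have "card (cyclic_words k) = card (\<Union>c\<in>{0..<b}. {w \<in> cyclic_words k. lowest_at w c})"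
    by (rule arg_cong)
  also have "\<dots> = (\<Sum>c\<in>{0..<b}. card {w \<in> cyclic_words k. lowest_at w c})"
  proof (rule card_UN_disjoint)
    show "\<forall>c\<in>{0..<b}. \<forall>c'\<in>{0..<b}. c \<noteq> c' \<longrightarrow>
        {w \<in> cyclic_words k. lowest_at w c} \<inter> {w \<in> cyclic_words k. lowest_at w c'} = {}"
      using cyclic_word_lowest_ex1 by blast
  qed (use finite_cyclic_words in auto)
  also have "\<dots> = (\<Sum>c\<in>{0..<b}. card {w \<in> cyclic_words k. lowest_at w 0})"
    by (rule sum.cong[OF refl card_lowest_at])
  finally show ?thesis by simp
qed

lemma lowest_word_last:
  assumes "w \<in> cyclic_words k" "lowest_at w 0" shows "w N = 0"
proof (rule ccontr)
  assume "w N \<noteq> 0"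
  then have "b * 1 \<le> b * int (w N)" using b_pos by (intro mult_left_mono) auto
  moreover have "ht w (N + 1) = 0"
    using ht_mod_cyclic[OF assms(1), of b] by (simp flip: b_eq)
  moreover have "0 \<le> ht w N" using assms(2) unfolding lowest_at_def by (metis ht_0)
  ultimately show False using ht_add_1[of w N] a_less by simp
qed

lemma psum_b: "w N = 0 \<Longrightarrow> psum w b = psum w N" and support_b: "w N = 0 \<Longrightarrow> support w b = support w N"
  by (simp_all add: b_eq psum_add_1 support_def)

lemma truncate_lowest_word:
  assumes lowest: "w \<in> cyclic_words k" "lowest_at w 0"
  shows "(\<lambda>j. w (j mod N)) \<in> dyck_words" "support (\<lambda>j. w (j mod N)) N = int k"
proof -
  let ?u = "\<lambda>j. w (j mod N)"
  have agree: "ht ?u j = ht w j" if "0 \<le> j" "j \<le> N" for j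
    by (rule ht_cong) (use that in auto)
  have "psum ?u N = psum w N" "support ?u N = support w N"
    by (rule psum_cong support_cong; use N_pos in simp)+
  then have "psum ?u N = a" and supp: "support ?u N = int k"
    using lowest(1) psum_b support_b lowest_word_last[OF lowest] by (simp_all add: cyclic_words_def)
  then have full: "full ?u" by (simp add: full_def periodic_fun_simple_def)
  have "is_root ?u 0"
  proof (rule is_rootI[OF full])
    fix j assume j: "j \<in> {0<..0 + N}"
    have "ht w 0 \<le> ht w j" using lowest(2) by (simp add: lowest_at_def)
    moreover have "ht w 0 \<noteq> ht w j" using ht_inj[of w 0 j] j b_eq by auto
    ultimately show "ht ?u 0 < ht ?u j" using agree[of j] j by simp
  qed
  then show "?u \<in> dyck_words" using full by (simp add: dyck_words_def)
  show "support ?u N = int k" by (rule supp)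
qed

lemma extend_dyck_word:
  assumes dyck: "u \<in> dyck_words" "support u N = int k"
  defines "w \<equiv> \<lambda>j. if j mod b = N then 0 else u (j mod b)"
  shows "w \<in> cyclic_words k" "lowest_at w 0"
proof -
  have agree: "w i = u i" if "0 \<le> i" "i < N" for i using that b_eq by (simp add: w_def)
  have last: "w N = 0" using N_pos b_eq by (simp add: w_def)
  have "psum w N = psum u N" "support w N = support u N"
    by (rule psum_cong support_cong; use N_pos agree in simp)+
  then show cyclic: "w \<in> cyclic_words k"
    using dyck psum_b[of w, OF last] support_b[of w, OF last]
    by (simp add: cyclic_words_def dyck_words_def full_def)
      (simp add: w_def periodic_fun_simple_def)
  have "0 \<le> ht w (j mod b)" for j
  proof -
    have "0 \<le> j mod b" "j mod b \<le> N" using b_pos b_eq pos_mod_bound[of b j] by auto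
    then have "ht w (j mod b) = ht u (j mod b)" using agree by (intro ht_cong) auto
    moreover have "0 < ht u i" if "0 < i" for i
      using dyck(1) that by (simp add: dyck_words_def is_root_def)
    ultimately show ?thesis using \<open>0 \<le> j mod b\<close> by (cases "j mod b = 0") (auto intro: less_imp_le)
  qed
  then show "lowest_at w 0" using ht_mod_cyclic[OF cyclic] by (simp add: lowest_at_def)
qed

lemma extend_truncate:
  assumes lowest: "w \<in> cyclic_words k" "lowest_at w 0"
  shows "(if j mod b = N then 0 else w (j mod b mod N)) = w j"
proof -
  have "w (j mod b) = w j" using lowest(1) by (intro periodic_mod) (simp add: cyclic_words_def)
  moreover have "j mod b mod N = j mod b" if "j mod b \<noteq> N"
    using that b_pos b_eq pos_mod_bound[of b j] by (intro mod_pos_pos_trivial) auto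
  ultimately show ?thesis using lowest_word_last[OF lowest] by auto
qed

lemma truncate_extend:
  assumes "periodic u N"
  shows "(if j mod N mod b = N then 0 else u (j mod N mod b)) = u j"
proof -
  have j: "0 \<le> j mod N" "j mod N < N" using N_pos by auto
  then have "j mod N mod b = j mod N" using b_eq by (intro mod_pos_pos_trivial) linarith+
  then show ?thesis using periodic_mod[OF assms] j by simp
qed

lemma card_dyck_words:
  "nat b * card {u \<in> dyck_words. support u N = int (Suc k)} = (nat b choose Suc k) * (nat a - 1 choose k)"
proof -
  let ?L = "{w \<in> cyclic_words (Suc k). lowest_at w 0}" and ?D = "{u \<in> dyck_words. support u N = int (Suc k)}"
  have "bij_betw (\<lambda>w j. w (j mod N)) ?L ?D"
  proof (rule bij_betwI[of _ _ _ "\<lambda>u j. if j mod b = N then 0 else u (j mod b)"])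
    show "(\<lambda>w j. w (j mod N)) \<in> ?L \<rightarrow> ?D" using truncate_lowest_word by blast
    show "(\<lambda>u j. if j mod b = N then 0 else u (j mod b)) \<in> ?D \<rightarrow> ?L" using extend_dyck_word by blast
    show "(\<lambda>j. if j mod b = N then 0 else w (j mod b mod N)) = w" if "w \<in> ?L" for w
      using extend_truncate that by blast
    show "(\<lambda>j. if j mod N mod b = N then 0 else u (j mod N mod b)) = u" if "u \<in> ?D" for u
      using truncate_extend[of u] that by (auto simp: dyck_words_def full_def)
  qed
  then show ?thesis
    using card_cyclic_words[of k] card_cyclic_words_lowest[of "Suc k"]
    by (simp add: bij_betw_same_card)
qed

lemma bij_betw_dyck_words: "bij_betw partition_of dyck_words (partition_of ` Collect full)"
  unfolding bij_betw_def
proof (intro conjI inj_onI subset_antisym subsetI)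
  fix u v assume uv: "u \<in> dyck_words" "v \<in> dyck_words" "partition_of u = partition_of v"
  then have "linked u = linked v"
    using partition_of_eq_iff[of u v] by (simp add: dyck_words_def full_def)
  then show "u = v" using full_eq_if_linked_eq[of u 0 v] uv by (simp add: dyck_words_def)
next
  fix \<pi> assume "\<pi> \<in> partition_of ` Collect full"
  then obtain u where u: "full u" "\<pi> = partition_of u" by blast
  obtain v where "full v" "is_root v 0" "linked v = linked u" using full_reroot[OF u(1)] .
  then have "v \<in> dyck_words" "\<pi> = partition_of v"
    using u(2) partition_of_cong[of v u] by (auto simp: dyck_words_def)
  then show "\<pi> \<in> partition_of ` dyck_words" by blast
qed (auto simp: dyck_words_def)

lemma card_partitions:
  "nat b * card {\<pi> \<in> partition_of ` Collect full. card \<pi> = Suc k} =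
    (nat b choose Suc k) * (nat a - 1 choose k)"
proof -
  have "bij_betw partition_of {u \<in> dyck_words. support u N = int (Suc k)}
      {\<pi> \<in> partition_of ` Collect full. card \<pi> = Suc k}"
    by (rule bij_betw_Collect[OF bij_betw_dyck_words])
       (auto simp: dyck_words_def simp flip: card_partition_of_full)
  then show ?thesis using card_dyck_words[of k] by (simp only: bij_betw_same_card)
qed

end

section \<open>Gaussian polynomials\<close>

definition q_int_poly :: "nat \<Rightarrow> int poly" where
  "q_int_poly n = (\<Sum>i<n. monom 1 i)"

definition q_fact_poly :: "nat \<Rightarrow> int poly" where
  "q_fact_poly n = (\<Prod>i=1..n. q_int_poly i)"

fun gauss_poly :: "nat \<Rightarrow> nat \<Rightarrow> int poly" where
  "gauss_poly n 0 = 1"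
| "gauss_poly 0 (Suc m) = 0"
| "gauss_poly (Suc n) (Suc m) = gauss_poly n m + monom 1 (Suc m) * gauss_poly n (Suc m)"

lemmas gauss_poly_induct = gauss_poly.induct[case_names right_0 left_0 Suc_Suc]

lemma gauss_poly_eq_0: "n < m \<Longrightarrow> gauss_poly n m = 0"
  by (induction n m rule: gauss_poly_induct) auto

lemma gauss_poly_self: "gauss_poly n n = 1"
  by (induction n) (simp_all add: gauss_poly_eq_0)

lemma q_int_poly_0 [simp]: "q_int_poly 0 = 0"
  by (simp add: q_int_poly_def)

lemma q_int_poly_Suc: "q_int_poly (Suc n) = q_int_poly n + monom 1 n"
  by (simp add: q_int_poly_def)

lemma q_int_poly_add: "q_int_poly (m + n) = q_int_poly m + monom 1 m * q_int_poly n"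
  by (induction n) (simp_all add: q_int_poly_Suc distrib_left mult_monom)

lemma q_int_poly_dvd_mult: "q_int_poly n dvd q_int_poly (k * n)"
  by (induction k) (simp_all add: q_int_poly_add)

lemma q_int_poly_geometric: "(1 - monom 1 1) * q_int_poly n = 1 - monom 1 n"
  by (induction n) (simp_all add: q_int_poly_Suc distrib_left left_diff_distrib[of _ _ "monom 1 _"] mult_monom)

lemma coeff_q_int_poly: "coeff (q_int_poly n) i = of_bool (i < n)"
  by (simp add: q_int_poly_def coeff_sum if_distrib sum.delta' of_bool_def cong: if_cong)

lemma q_int_poly_nonzero: "0 < n \<Longrightarrow> q_int_poly n \<noteq> 0"
  using coeff_q_int_poly[of n 0] by auto

lemma q_fact_poly_0 [simp]: "q_fact_poly 0 = 1"
  by (simp add: q_fact_poly_def)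

lemma q_fact_poly_Suc: "q_fact_poly (Suc n) = q_fact_poly n * q_int_poly (Suc n)"
  by (simp add: q_fact_poly_def)

lemma q_fact_poly_nonzero: "q_fact_poly n \<noteq> 0"
  by (simp add: q_fact_poly_def q_int_poly_nonzero)

lemma gauss_poly_q_fact:
  "m \<le> n \<Longrightarrow> q_fact_poly m * q_fact_poly (n - m) * gauss_poly n m = q_fact_poly n"
proof (induction n m rule: gauss_poly_induct)
  case (Suc_Suc n m)
  show ?case
  proof (cases "m = n")
    case True
    then show ?thesis using Suc_Suc by (auto simp: gauss_poly_eq_0 q_fact_poly_Suc)
  next
    case False
    then have mn: "Suc m \<le> n" using Suc_Suc by simp
    then have "n - m = Suc (n - Suc m)" by simp
    then have "q_fact_poly (Suc m) * q_fact_poly (n - m) * gauss_poly (Suc n) (Suc m) =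
        q_int_poly (Suc m) * (q_fact_poly m * q_fact_poly (n - m) * gauss_poly n m) +
        monom 1 (Suc m) * q_int_poly (n - m) *
          (q_fact_poly (Suc m) * q_fact_poly (n - Suc m) * gauss_poly n (Suc m))"
      by (simp add: q_fact_poly_Suc algebra_simps)
    also have "\<dots> = q_fact_poly n * (q_int_poly (Suc m) + monom 1 (Suc m) * q_int_poly (n - m))"
      using Suc_Suc mn by (simp add: algebra_simps)
    also have "q_int_poly (Suc m) + monom 1 (Suc m) * q_int_poly (n - m) = q_int_poly (Suc n)"
      using q_int_poly_add[of "Suc m" "n - m"] Suc_Suc by simp
    finally show ?thesis by (simp add: q_fact_poly_Suc)
  qed
qed auto

lemma gauss_poly_absorb:
  assumes "m \<le> n"
  shows "q_int_poly (Suc m) * gauss_poly (Suc n) (Suc m) = q_int_poly (Suc n) * gauss_poly n m"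
proof -
  let ?c = "q_fact_poly m * q_fact_poly (n - m)"
  have "?c * (q_int_poly (Suc m) * gauss_poly (Suc n) (Suc m)) = q_fact_poly (Suc n)"
    using gauss_poly_q_fact[of "Suc m" "Suc n"] assms by (simp add: q_fact_poly_Suc algebra_simps)
  also have "\<dots> = ?c * (q_int_poly (Suc n) * gauss_poly n m)"
    using gauss_poly_q_fact[OF assms] by (simp add: q_fact_poly_Suc algebra_simps)
  finally show ?thesis using q_fact_poly_nonzero by simp
qed

lemma q_int_poly_bezout: "\<exists>u v. u * q_int_poly m + v * q_int_poly n = q_int_poly (gcd m n)"
proof (induction m n rule: gcd_nat_induct)
  case (base m)
  have "1 * q_int_poly m + 0 * q_int_poly 0 = q_int_poly (gcd m 0)" by simp
  then show ?case by blast
next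
  case (step m n)
  then obtain u v where uv: "u * q_int_poly n + v * q_int_poly (m mod n) = q_int_poly (gcd n (m mod n))"
    by blast
  obtain w where w: "q_int_poly (m div n * n) = q_int_poly n * w"
    using q_int_poly_dvd_mult by (rule dvdE)
  have "q_int_poly m = q_int_poly (m mod n) + monom 1 (m mod n) * (q_int_poly n * w)"
    using q_int_poly_add[of "m mod n" "m div n * n"] by (simp add: w)
  then have "v * q_int_poly m + (u - v * monom 1 (m mod n) * w) * q_int_poly n =
      u * q_int_poly n + v * q_int_poly (m mod n)"
    by (simp add: algebra_simps)
  then have "v * q_int_poly m + (u - v * monom 1 (m mod n) * w) * q_int_poly n = q_int_poly (gcd m n)"
    using uv by (simp flip: gcd_red_nat[of m n])
  then show ?case by blast
qed

lemma to_fract_monom: "to_fract (monom 1 n :: int poly) = to_fract [:0, 1:] ^ n"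
proof (induction n)
  case (Suc n)
  have "monom 1 (Suc n) = [:0, 1 :: int:] * monom 1 n" by (simp add: monom_Suc)
  then show ?case using Suc by (simp only: to_fract_mult power_Suc)
qed simp

lemma to_fract_sum: "to_fract (sum f A) = (\<Sum>i\<in>A. to_fract (f i))"
  by (induction A rule: infinite_finite_induct) auto

lemma to_fract_prod: "to_fract (prod f A) = (\<Prod>i\<in>A. to_fract (f i))"
  by (induction A rule: infinite_finite_induct) auto

lemma q_int_eq_to_fract: "q_int n = to_fract (q_int_poly n)"
  by (simp add: q_int_def q_int_poly_def to_fract_sum to_fract_monom)

lemma q_fact_eq_to_fract: "q_fact n = to_fract (q_fact_poly n)"
  by (simp add: q_fact_def q_fact_poly_def to_fract_prod q_int_eq_to_fract)

lemma q_binomial_eq_to_fract: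
  assumes "m \<le> n" shows "q_binomial n m = to_fract (gauss_poly n m)"
proof -
  have "to_fract (q_fact_poly m) * to_fract (q_fact_poly (n - m)) * to_fract (gauss_poly n m) =
      to_fract (q_fact_poly n)"
    using gauss_poly_q_fact[OF assms] by (metis to_fract_mult)
  moreover have "to_fract (q_fact_poly m) \<noteq> 0" "to_fract (q_fact_poly (n - m)) \<noteq> 0"
    using q_fact_poly_nonzero by simp_all
  ultimately show ?thesis unfolding q_binomial_def q_fact_eq_to_fract by (simp add: field_simps)
qed

section \<open>The q-Narayana polynomial\<close>

context
  fixes a b k :: nat
  assumes k_le: "k \<le> a" and a_le: "a \<le> b"
begin

lemma q_narayana_eq_to_fract:
  "q_narayana (Suc a) (Suc b) (Suc k) =
    1 / to_fract (q_int_poly (Suc a)) * to_fract (gauss_poly (Suc a) (Suc k)) * to_fract (gauss_poly b k)"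
  using q_binomial_eq_to_fract[of "Suc k" "Suc a"] q_binomial_eq_to_fract[of k b] k_le a_le
  by (simp add: q_narayana_def q_int_eq_to_fract)

lemma q_int_a_q_narayana:
  "to_fract (q_int_poly (Suc a)) * q_narayana (Suc a) (Suc b) (Suc k) =
    to_fract (gauss_poly (Suc a) (Suc k) * gauss_poly b k)"
  by (simp add: q_narayana_eq_to_fract q_int_poly_nonzero)

lemma q_int_b_q_narayana:
  "to_fract (q_int_poly (Suc b)) * q_narayana (Suc a) (Suc b) (Suc k) =
    to_fract (gauss_poly (Suc b) (Suc k) * gauss_poly a k)"
proof -
  have nonzero: "to_fract (q_int_poly (Suc n)) \<noteq> 0" for n by (simp add: q_int_poly_nonzero)
  have absorb: "to_fract (q_int_poly (Suc k)) * to_fract (gauss_poly (Suc n) (Suc k)) =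
      to_fract (q_int_poly (Suc n)) * to_fract (gauss_poly n k)" if "k \<le> n" for n
    using gauss_poly_absorb[OF that] by (metis to_fract_mult)
  have "to_fract (q_int_poly (Suc k)) * q_narayana (Suc a) (Suc b) (Suc k) =
      to_fract (gauss_poly a k) * to_fract (gauss_poly b k)"
    using absorb[OF k_le] nonzero
    by (simp add: q_narayana_eq_to_fract field_simps del: gauss_poly.simps)
  then have "to_fract (q_int_poly (Suc k)) *
      (to_fract (q_int_poly (Suc b)) * q_narayana (Suc a) (Suc b) (Suc k)) =
      to_fract (q_int_poly (Suc k)) * to_fract (gauss_poly (Suc b) (Suc k) * gauss_poly a k)"
    using absorb[of b] k_le a_le by (simp add: algebra_simps del: gauss_poly.simps)
  then show ?thesis using nonzero by simp
qed

text \<open>The two product formulas clear the denominators \<open>[a]\<close> and \<open>[b]\<close>, which generate the unit ideal.\<close>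

lemma narayana_poly_ex:
  assumes "coprime (Suc a) (Suc b)"
  obtains p where "to_fract p = q_narayana (Suc a) (Suc b) (Suc k)"
    "q_int_poly (Suc b) * p = gauss_poly (Suc b) (Suc k) * gauss_poly a k"
proof -
  let ?P = "q_narayana (Suc a) (Suc b) (Suc k)"
  have "gcd (Suc a) (Suc b) = 1" using assms by simp
  then obtain u v where "u * q_int_poly (Suc a) + v * q_int_poly (Suc b) = 1"
    using q_int_poly_bezout[of "Suc a" "Suc b"] by (auto simp: q_int_poly_def)
  then have one: "to_fract u * to_fract (q_int_poly (Suc a)) + to_fract v * to_fract (q_int_poly (Suc b)) = 1"
    by (metis to_fract_1 to_fract_add to_fract_mult)
  define p where "p = u * (gauss_poly (Suc a) (Suc k) * gauss_poly b k) +
    v * (gauss_poly (Suc b) (Suc k) * gauss_poly a k)"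
  have "to_fract p = to_fract u * (to_fract (q_int_poly (Suc a)) * ?P) +
      to_fract v * (to_fract (q_int_poly (Suc b)) * ?P)"
    unfolding q_int_a_q_narayana q_int_b_q_narayana p_def by simp
  also have "\<dots> =
      (to_fract u * to_fract (q_int_poly (Suc a)) + to_fract v * to_fract (q_int_poly (Suc b))) *
        ?P"
    by (simp add: algebra_simps)
  finally have p_eq: "to_fract p = ?P" using one by simp
  then have "to_fract (q_int_poly (Suc b) * p) = to_fract (gauss_poly (Suc b) (Suc k) * gauss_poly a k)"
    using q_int_b_q_narayana by simp
  then show ?thesis using that p_eq by (simp only: to_fract_eq_iff)
qed

end

section \<open>Gaussian polynomials at roots of unity\<close>

definition eval_at :: "complex \<Rightarrow> int poly \<Rightarrow> complex" where
  "eval_at z p = poly (map_poly of_int p) z"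

lemma eval_at_0 [simp]: "eval_at z 0 = 0" and eval_at_1 [simp]: "eval_at z 1 = 1"
  by (simp_all add: eval_at_def)

lemma eval_at_add [simp]: "eval_at z (p + r) = eval_at z p + eval_at z r"
proof -
  have "map_poly of_int (p + r) = (map_poly of_int p + map_poly of_int r :: complex poly)"
    by (rule poly_eqI) (simp add: coeff_map_poly)
  then show ?thesis by (simp add: eval_at_def)
qed

lemma eval_at_mult [simp]: "eval_at z (p * r) = eval_at z p * eval_at z r"
proof -
  have "map_poly of_int (p * r) = (map_poly of_int p * map_poly of_int r :: complex poly)"
    by (rule poly_eqI) (simp add: coeff_map_poly coeff_mult)
  then show ?thesis by (simp add: eval_at_def)
qed

lemma eval_at_monom [simp]: "eval_at z (monom 1 n) = z ^ n"
  by (simp add: eval_at_def map_poly_monom poly_monom)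

lemma eval_at_q_int_poly: "eval_at z (q_int_poly n) = (\<Sum>i<n. z ^ i)"
  by (induction n) (simp_all add: q_int_poly_Suc)

lemma eval_at_1_gauss_poly: "eval_at 1 (gauss_poly n m) = of_nat (n choose m)"
  by (induction n m rule: gauss_poly_induct) simp_all

context
  fixes z :: complex and e :: nat
  assumes two_le_e: "2 \<le> e" and primitive_z: "primitive_unity_root e z"
begin

lemma z_power_e: "z ^ e = 1" and z_neq_1: "z \<noteq> 1"
  using primitive_z two_le_e by (auto simp: primitive_unity_root_def dest!: spec[of _ 1])

lemma eval_at_q_int_poly_root: "eval_at z (q_int_poly n) = (z ^ n - 1) / (z - 1)"
  using z_neq_1 by (simp add: eval_at_q_int_poly geometric_sum)

lemma eval_at_gauss_poly_e:
  assumes "0 < m" "m < e" shows "eval_at z (gauss_poly e m) = 0"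
proof -
  obtain m' e' where Suc: "m = Suc m'" "e = Suc e'" using assms by (metis Suc_pred less_trans)
  have "eval_at z (q_int_poly m) * eval_at z (gauss_poly e m) =
      eval_at z (q_int_poly e) * eval_at z (gauss_poly e' m')"
    using gauss_poly_absorb[of m' e'] assms unfolding Suc
    by (metis Suc_less_SucD eval_at_mult less_imp_le)
  also have "eval_at z (q_int_poly e) = 0" by (simp add: eval_at_q_int_poly_root z_power_e)
  finally show ?thesis
    using assms primitive_z z_neq_1 by (simp add: eval_at_q_int_poly_root primitive_unity_root_def)
qed

lemma eval_at_gauss_poly_Suc:
  "eval_at z (gauss_poly (Suc n) (Suc m)) =
    eval_at z (gauss_poly n m) + z ^ Suc m * eval_at z (gauss_poly n (Suc m))"
  by (simp del: power_Suc)

lemma z_power_Suc_mod: "z ^ Suc m = z ^ Suc (m mod e)"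
  using z_power_e power_add[of z "m div e * e" "m mod e"] by (simp add: mult.commute power_mult)

lemma q_lucas:
  "eval_at z (gauss_poly n m) =
    of_nat (n div e choose (m div e)) * eval_at z (gauss_poly (n mod e) (m mod e))"
proof (induction n m rule: gauss_poly_induct)
  case (left_0 m)
  show ?case
    using two_le_e by (cases "Suc m < e") (simp_all add: binomial_eq_0 div_greater_zero_iff)
next
  case (Suc_Suc n m)
  define r s where "r = n mod e" and "s = m mod e"
  have rs: "r < e" "s < e" using two_le_e by (auto simp: r_def s_def)
  have step: "eval_at z (gauss_poly (Suc n) (Suc m)) =
      of_nat (n div e choose (m div e)) * eval_at z (gauss_poly r s) +
      z ^ Suc s * (of_nat (n div e choose (Suc m div e)) * eval_at z (gauss_poly r (Suc m mod e)))"
    using Suc_Suc z_power_Suc_mod by (simp add: eval_at_gauss_poly_Suc r_def s_def)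
  consider (no_carry) "Suc r < e" "Suc s < e" | (lower_carry) "Suc r < e" "Suc s = e"
    | (upper_carry) "Suc r = e" "Suc s < e" | (both_carry) "Suc r = e" "Suc s = e"
    using rs by linarith
  then show ?case
  proof cases
    case no_carry
    then show ?thesis
      using step eval_at_gauss_poly_Suc
      by (simp add: r_def s_def div_Suc mod_Suc distrib_left mult.left_commute)
  next
    case lower_carry
    then show ?thesis using step z_power_e
      by (simp add: r_def s_def div_Suc mod_Suc gauss_poly_eq_0 del: power_Suc)
  next
    case upper_carry
    then have "eval_at z (gauss_poly (Suc r) (Suc s)) = 0" using eval_at_gauss_poly_e by simp
    then have "of_nat (n div e choose (m div e)) *
        (eval_at z (gauss_poly r s) + z ^ Suc s * eval_at z (gauss_poly r (Suc s))) = 0"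
      unfolding eval_at_gauss_poly_Suc by simp
    then show ?thesis using step upper_carry
      by (simp add: r_def s_def div_Suc mod_Suc distrib_left mult.left_commute del: power_Suc)
  next
    case both_carry
    then have "r = s" by simp
    then show ?thesis using step both_carry z_power_e
      by (simp add: r_def s_def div_Suc mod_Suc gauss_poly_self del: power_Suc)
  qed
qed simp

end

section \<open>Symmetric unimodal sequences\<close>

definition sym_unimodal :: "int \<Rightarrow> (int \<Rightarrow> 'a :: order) \<Rightarrow> bool" where
  "sym_unimodal d c \<longleftrightarrow> (\<forall>i. c (d - i) = c i) \<and> (\<forall>i j. i \<le> j \<and> i + j \<le> d \<longrightarrow> c i \<le> c j)"

lemma sym_unimodal_sym: "sym_unimodal d c \<Longrightarrow> c (d - i) = c i"
  and sym_unimodal_le: "sym_unimodal d c \<Longrightarrow> i \<le> j \<Longrightarrow> i + j \<le> d \<Longrightarrow> c i \<le> c j"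
  by (simp_all add: sym_unimodal_def)

lemma sym_unimodalI:
  assumes sym: "\<And>i. c (d - i) = c i" and step: "\<And>i. 2 * i < d \<Longrightarrow> c i \<le> c (i + 1)"
  shows "sym_unimodal d c"
proof -
  have mono: "c i \<le> c j" if "i \<le> j" "2 * j \<le> d + 1" for i j
    using that
  proof (induction j rule: int_ge_induct)
    case (step j)
    then show ?case using assms(2)[of j] by simp
  qed simp
  have "c i \<le> c j" if "i \<le> j" "i + j \<le> d" for i j
  proof (cases "2 * j \<le> d + 1")
    case False
    then show ?thesis using mono[of i "d - j"] sym[of j] that by simp
  qed (use mono that in blast)
  then show ?thesis using sym by (simp add: sym_unimodal_def)
qed

definition icoeff :: "'a :: zero poly \<Rightarrow> int \<Rightarrow> 'a" where
  "icoeff p i = (if 0 \<le> i then coeff p (nat i) else 0)"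

lemma icoeff_neg: "i < 0 \<Longrightarrow> icoeff p i = 0"
  by (simp add: icoeff_def)

lemma icoeff_of_nat: "icoeff p (int i) = coeff p i"
  by (simp add: icoeff_def)

lemma icoeff_diff: "icoeff (p - r :: 'a :: ab_group_add poly) i = icoeff p i - icoeff r i"
  by (simp add: icoeff_def)

lemma icoeff_monom_mult: "icoeff (monom 1 n * p :: 'a :: comm_semiring_1 poly) i = icoeff p (i - int n)"
  by (auto simp: icoeff_def coeff_monom_mult nat_diff_distrib le_nat_iff)

lemma icoeff_mult:
  fixes p r :: "'a :: comm_semiring_0 poly"
  assumes fin: "finite A" and supp: "\<And>j. j \<notin> A \<Longrightarrow> icoeff p j = 0"
  shows "icoeff (p * r) i = (\<Sum>j\<in>A. icoeff p j * icoeff r (i - j))"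
proof -
  have "icoeff (p * r) i = (\<Sum>j\<in>{0..i}. icoeff p j * icoeff r (i - j))"
  proof (cases "0 \<le> i")
    case True
    then show ?thesis unfolding icoeff_def[of "p * r"] coeff_mult
      by (auto simp: icoeff_def nat_diff_distrib intro!: sum.reindex_bij_witness[of _ nat int])
  qed (simp add: icoeff_def)
  also have "\<dots> = (\<Sum>j\<in>A \<union> {0..i}. icoeff p j * icoeff r (i - j))"
    by (rule sum.mono_neutral_left) (use fin in \<open>auto simp: icoeff_def\<close>)
  also have "\<dots> = (\<Sum>j\<in>A. icoeff p j * icoeff r (i - j))"
    by (rule sum.mono_neutral_right) (use fin supp in auto)
  finally show ?thesis .
qed

lemma sym_unimodal_support:
  fixes p :: "'a :: {zero, order} poly"
  assumes "sym_unimodal d (icoeff p)" "j \<notin> {0..d}" shows "icoeff p j = 0"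
  using sym_unimodal_sym[OF assms(1), of j] assms(2) icoeff_neg[of j p] icoeff_neg[of "d - j" p]
  by force

context
  fixes p r :: "'a :: linordered_idom poly" and d e :: int
  assumes unimodal_p: "sym_unimodal d (icoeff p)" and unimodal_r: "sym_unimodal e (icoeff r)"
begin

lemma icoeff_mult_sym_unimodal:
  "finite A \<Longrightarrow> {0..d} \<subseteq> A \<Longrightarrow> icoeff (p * r) i = (\<Sum>j\<in>A. icoeff p j * icoeff r (i - j))"
  by (rule icoeff_mult) (use sym_unimodal_support[OF unimodal_p] in blast)+

lemma icoeff_mult_sym: "icoeff (p * r) (d + e - i) = icoeff (p * r) i"
proof -
  have "icoeff (p * r) (d + e - i) = (\<Sum>j\<in>{0..d}. icoeff p j * icoeff r (d + e - i - j))"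
    by (rule icoeff_mult_sym_unimodal) auto
  also have "\<dots> = (\<Sum>j\<in>{0..d}. icoeff p (d - j) * icoeff r (e - (i - j)))"
    by (rule sum.reindex_bij_witness[of _ "\<lambda>j. d - j" "\<lambda>j. d - j"]) (auto simp: algebra_simps)
  also have "\<dots> = (\<Sum>j\<in>{0..d}. icoeff p j * icoeff r (i - j))"
    by (simp only: sym_unimodal_sym[OF unimodal_p] sym_unimodal_sym[OF unimodal_r])
  finally show ?thesis using icoeff_mult_sym_unimodal[of "{0..d}" i] by simp
qed

lemma icoeff_mult_step:
  assumes lower_half: "2 * i < d + e" shows "icoeff (p * r) i \<le> icoeff (p * r) (i + 1)"
proof -
  define \<Delta> where "\<Delta> j = icoeff p j - icoeff p (j - 1)" for j
  let ?A = "{0..d + 1}"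
  have anti: "\<Delta> (d + 1 - j) = - \<Delta> j" for j
    using sym_unimodal_sym[OF unimodal_p, of j] sym_unimodal_sym[OF unimodal_p, of "j - 1"]
    by (simp add: \<Delta>_def algebra_simps)
  have pos: "0 \<le> \<Delta> j" "icoeff r (i - d + j) \<le> icoeff r (i + 1 - j)" if "2 * j \<le> d + 1" for j
    using sym_unimodal_le[OF unimodal_p, of "j - 1" j]
      sym_unimodal_le[OF unimodal_r, of "i - d + j" "i + 1 - j"] that lower_half
    by (auto simp: \<Delta>_def)
  have "icoeff (p * r) i = (\<Sum>j\<in>{- 1..d}. icoeff p j * icoeff r (i - j))"
    by (rule icoeff_mult_sym_unimodal) auto
  also have "\<dots> = (\<Sum>j\<in>?A. icoeff p (j - 1) * icoeff r (i + 1 - j))"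
    by (rule sum.reindex_bij_witness[of _ "\<lambda>j. j - 1" "\<lambda>j. j + 1"]) (auto simp: algebra_simps)
  finally have diff: "icoeff (p * r) (i + 1) - icoeff (p * r) i = (\<Sum>j\<in>?A. \<Delta> j * icoeff r (i + 1 - j))"
    using icoeff_mult_sym_unimodal[of ?A "i + 1"]
    by (simp add: \<Delta>_def sum_subtractf left_diff_distrib)
  also have "\<dots> = (\<Sum>j\<in>?A. \<Delta> (d + 1 - j) * icoeff r (i - d + j))"
    by (rule sum.reindex_bij_witness[of _ "\<lambda>j. d + 1 - j" "\<lambda>j. d + 1 - j"])
      (auto simp: algebra_simps)
  finally have "2 * (icoeff (p * r) (i + 1) - icoeff (p * r) i) =
      (\<Sum>j\<in>?A. \<Delta> j * (icoeff r (i + 1 - j) - icoeff r (i - d + j)))"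
    using diff unfolding anti by (simp add: sum_subtractf right_diff_distrib sum_negf)
  also have "0 \<le> \<dots>"
  proof (rule sum_nonneg)
    fix j
    show "0 \<le> \<Delta> j * (icoeff r (i + 1 - j) - icoeff r (i - d + j))"
    proof (cases "2 * j \<le> d + 1")
      case False
      then have "\<Delta> j \<le> 0" "icoeff r (i + 1 - j) \<le> icoeff r (i - d + j)"
        using pos[of "d + 1 - j"] anti by (simp_all add: algebra_simps)
      then show ?thesis by (simp add: mult_nonpos_nonpos)
    qed (use pos in simp)
  qed
  finally show ?thesis by simp
qed

lemma sym_unimodal_mult: "sym_unimodal (d + e) (icoeff (p * r))"
  using icoeff_mult_sym icoeff_mult_step by (rule sym_unimodalI)

end

text \<open>Since \<open>(1 - q\<^sup>n) p = (1 - q) [n] p\<close>, the differences of the unimodal sequence control \<open>p\<close>: from below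
  in the lower half and from above in the upper half.\<close>

context
  fixes n :: nat and p :: "int poly" and d :: int
  assumes n_pos: "0 < n" and unimodal: "sym_unimodal d (icoeff (q_int_poly n * p))"
begin

lemma icoeff_quotient_diff:
  "icoeff p j - icoeff p (j - int n) = icoeff (q_int_poly n * p) j - icoeff (q_int_poly n * p) (j - 1)"
proof -
  have "q_int_poly n * p - monom 1 1 * (q_int_poly n * p) = p - monom 1 n * p"
    using arg_cong[OF q_int_poly_geometric[of n], of "\<lambda>r. r * p"] by (simp add: algebra_simps)
  then show ?thesis
    using arg_cong[of _ _ "\<lambda>r. icoeff r j"] by (metis icoeff_diff icoeff_monom_mult of_nat_1)
qed

lemma icoeff_quotient_nonneg_low: "2 * j \<le> d + 1 \<Longrightarrow> 0 \<le> icoeff p j"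
proof (induction "nat (j + 1)" arbitrary: j rule: less_induct)
  case less
  show ?case
  proof (cases "j < 0")
    case False
    then have "0 \<le> icoeff p (j - int n)" using less n_pos by simp
    moreover have "icoeff (q_int_poly n * p) (j - 1) \<le> icoeff (q_int_poly n * p) j"
      using sym_unimodal_le[OF unimodal, of "j - 1" j] less.prems by simp
    ultimately show ?thesis using icoeff_quotient_diff[of j] by simp
  qed (simp add: icoeff_neg)
qed

lemma icoeff_quotient_nonneg_high: "d + 1 < 2 * j \<Longrightarrow> 0 \<le> icoeff p j"
proof (induction "nat (int (degree p) + 1 - j)" arbitrary: j rule: less_induct)
  case less
  show ?case
  proof (cases "int (degree p) < j")
    case True
    then show ?thesis by (simp add: icoeff_def coeff_eq_0)
  next
    case False
    let ?j = "j + int n"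
    have "0 \<le> icoeff p ?j" using less False n_pos by simp
    moreover have "icoeff (q_int_poly n * p) (d - ?j) \<le> icoeff (q_int_poly n * p) (d - (?j - 1))"
      using sym_unimodal_le[OF unimodal, of "d - ?j" "d - (?j - 1)"] less.prems n_pos by simp
    ultimately show ?thesis
      using icoeff_quotient_diff[of ?j] by (simp add: sym_unimodal_sym[OF unimodal])
  qed
qed

lemma coeff_quotient_nonneg: "0 \<le> coeff p i"
  using icoeff_quotient_nonneg_low[of "int i"] icoeff_quotient_nonneg_high[of "int i"]
  by (cases "2 * int i \<le> d + 1") (auto simp: icoeff_of_nat)

end

section \<open>Unimodality of Gaussian polynomials\<close>

lemma sum_Pow_lessThan_Suc:
  "(\<Sum>S\<in>Pow {..<Suc n}. f S) = (\<Sum>S\<in>Pow {..<n}. f (insert 0 (Suc ` S))) + (\<Sum>S\<in>Pow {..<n}. f (Suc ` S))"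
proof -
  have "Pow (Suc ` {..<n}) = (`) Suc ` Pow {..<n}" by (simp add: image_Pow_surj)
  then have "Pow {..<Suc n} = (\<lambda>S. insert 0 (Suc ` S)) ` Pow {..<n} \<union> (`) Suc ` Pow {..<n}"
    by (simp add: lessThan_Suc_eq_insert_0 Pow_insert image_image Un_commute)
  moreover have "inj_on (\<lambda>S. insert 0 (Suc ` S)) (Pow {..<n})"
  proof
    fix S T :: "nat set" assume "insert 0 (Suc ` S) = insert 0 (Suc ` T)"
    then have "Suc ` S = Suc ` T" by (metis Diff_insert_absorb image_iff nat.distinct(1))
    then show "S = T" by (simp add: inj_image_eq_iff)
  qed
  moreover have "inj_on ((`) Suc) (Pow {..<n})" by (auto simp: inj_on_def inj_image_eq_iff)
  moreover have "(\<lambda>S. insert 0 (Suc ` S)) ` Pow {..<n} \<inter> (`) Suc ` Pow {..<n} = {}" by auto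
  ultimately show ?thesis by (simp add: sum.union_disjoint sum.reindex)
qed

lemma gauss_poly_sum_subsets:
  "monom 1 (\<Sum>{..<m}) * gauss_poly n m = (\<Sum>S\<in>Pow {..<n}. if card S = m then monom 1 (\<Sum>S) else 0)"
proof (induction n m rule: gauss_poly_induct)
  case (right_0 n)
  have "card S = 0 \<longleftrightarrow> S = {}" if "S \<in> Pow {..<n}" for S
    using that finite_subset[of S "{..<n}"] by auto
  then have "(\<Sum>S\<in>Pow {..<n}. if card S = 0 then monom 1 (\<Sum>S) else 0) =
      (\<Sum>S\<in>Pow {..<n}. if S = {} then 1 else 0)" by (intro sum.cong) auto
  then show ?case by simp
next
  case (Suc_Suc n m)
  let ?W = "\<lambda>m. \<Sum>S\<in>Pow {..<n}. if card S = m then monom 1 (\<Sum>S) else (0 :: int poly)"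
  have shift: "\<Sum>(Suc ` S) = card S + \<Sum>S" if "S \<in> Pow {..<n}" for S
    using finite_subset[of S "{..<n}"] that by (simp add: sum.reindex sum_Suc)
  have fin: "finite S" if "S \<in> Pow {..<n}" for S using finite_subset[of S "{..<n}"] that by simp
  have "(\<Sum>S\<in>Pow {..<n}. if card (insert 0 (Suc ` S)) = Suc m then monom 1 (\<Sum>(insert 0 (Suc ` S))) else 0) =
      monom 1 m * ?W m"
    unfolding sum_distrib_left using fin shift
    by (intro sum.cong) (auto simp: card_image mult_monom)
  moreover have "(\<Sum>S\<in>Pow {..<n}. if card (Suc ` S) = Suc m then monom 1 (\<Sum>(Suc ` S)) else 0) =
      monom 1 (Suc m) * ?W (Suc m)"
    unfolding sum_distrib_left using fin shift
    by (intro sum.cong) (auto simp: card_image mult_monom)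
  ultimately show ?case
    unfolding sum_Pow_lessThan_Suc Suc_Suc[symmetric]
    by (simp add: mult_monom distrib_left ac_simps flip: mult.assoc)
qed simp

definition level :: "nat \<Rightarrow> nat \<Rightarrow> int \<Rightarrow> nat set set" where
  "level n m j = {S. S \<subseteq> {..<n} \<and> card S = m \<and> int (\<Sum>S) = j}"

lemma finite_level: "finite (level n m j)"
  by (rule finite_subset[of _ "Pow {..<n}"]) (auto simp: level_def)

lemma icoeff_gauss_poly: "icoeff (gauss_poly n m) i = int (card (level n m (i + int (\<Sum>{..<m}))))"
proof -
  let ?s = "\<Sum>{..<m}"
  have coeff: "icoeff (monom 1 t) j = of_bool (int t = j)" for t :: nat and j
    by (auto simp: icoeff_def)
  have sum: "icoeff (sum f A) j = (\<Sum>x\<in>A. icoeff (f x) j)" for f :: "nat set \<Rightarrow> int poly" and A j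
    by (simp add: icoeff_def coeff_sum)
  have "icoeff (gauss_poly n m) i = icoeff (monom 1 ?s * gauss_poly n m) (i + int ?s)"
    by (simp add: icoeff_monom_mult)
  also have "\<dots> = (\<Sum>S\<in>Pow {..<n}. if card S = m \<and> int (\<Sum>S) = i + int ?s then 1 else 0)"
    unfolding gauss_poly_sum_subsets sum by (intro sum.cong) (auto simp: coeff icoeff_def[of 0])
  also have "\<dots> = int (card (level n m (i + int ?s)))"
    by (simp add: sum.If_cases level_def Int_def)
  finally show ?thesis .
qed

lemma card_level_reflect: "card (level n m (int m * (int n - 1) - j)) = card (level n m j)"
proof (rule bij_betw_same_card)
  let ?f = "\<lambda>S. (\<lambda>t. n - 1 - t) ` S"
  have invol: "?f (?f S) = S" if "S \<subseteq> {..<n}" for S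
    using that by (force simp: image_image)
  have maps: "?f S \<in> level n m (int m * (int n - 1) - j)" if S: "S \<in> level n m j" for S j
  proof -
    have sub: "S \<subseteq> {..<n}" using S by (simp add: level_def)
    have "inj_on (\<lambda>t. n - 1 - t) {..<n}" by (auto simp: inj_on_def)
    then have inj: "inj_on (\<lambda>t. n - 1 - t) S" using sub by (rule inj_on_subset)
    have "int (\<Sum>(?f S)) = (\<Sum>t\<in>S. (int n - 1) - int t)"
      unfolding sum.reindex[OF inj] by (simp, rule sum.cong) (use sub in \<open>auto simp: of_nat_diff\<close>)
    also have "\<dots> = int m * (int n - 1) - j" using S by (simp add: sum_subtractf level_def)
    finally show ?thesis using S inj by (auto simp: level_def card_image)
  qed
  show "bij_betw ?f (level n m (int m * (int n - 1) - j)) (level n m j)"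
  proof (rule bij_betwI[of _ _ _ ?f])
    show "?f \<in> level n m (int m * (int n - 1) - j) \<rightarrow> level n m j"
      using maps[of _ "int m * (int n - 1) - j"] by simp
    show "?f \<in> level n m j \<rightarrow> level n m (int m * (int n - 1) - j)" using maps by blast
  qed (use invol in \<open>simp_all add: level_def\<close>)
qed

definition nontrivial_solution :: "('b \<Rightarrow> 'a \<Rightarrow> 'c :: idom) \<Rightarrow> 'b set \<Rightarrow> 'a set \<Rightarrow> ('a \<Rightarrow> 'c) \<Rightarrow> bool" where
  "nontrivial_solution M B A x \<longleftrightarrow>
    (\<forall>i. i \<notin> A \<longrightarrow> x i = 0) \<and> (\<exists>i. x i \<noteq> 0) \<and> (\<forall>j\<in>B. (\<Sum>i\<in>A. M j i * x i) = 0)"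

lemma nontrivial_solution_mono:
  assumes "nontrivial_solution M B A' x" "A' \<subseteq> A" "finite A" shows "nontrivial_solution M B A x"
proof -
  have "(\<Sum>i\<in>A. M j i * x i) = (\<Sum>i\<in>A'. M j i * x i)" for j
    using assms by (intro sum.mono_neutral_right) (auto simp: nontrivial_solution_def)
  then show ?thesis using assms by (auto simp: nontrivial_solution_def)
qed

lemma nontrivial_solution_insert:
  assumes solution_x: "nontrivial_solution M B A x" "x k \<noteq> 0"
    and solution_y: "nontrivial_solution M B A y" "y k = 0"
  obtains z where "nontrivial_solution M (insert b B) A z"
proof (cases "(\<Sum>i\<in>A. M b i * y i) = 0")
  case True
  then show ?thesis using that[of y] solution_y by (simp add: nontrivial_solution_def)
next
  case False
  define row where "row z = (\<Sum>i\<in>A. M b i * z i)" for z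
  define z where "z i = row y * x i - row x * y i" for i
  have combination: "(\<Sum>i\<in>A. M j i * z i) = row y * (\<Sum>i\<in>A. M j i * x i) - row x * (\<Sum>i\<in>A. M j i * y i)" for j
    unfolding z_def
    by (simp add: right_diff_distrib sum_subtractf sum_distrib_left mult.left_commute)
  have "z k \<noteq> 0" using solution_x(2) solution_y(2) False by (simp add: z_def row_def)
  moreover have "(\<Sum>i\<in>A. M b i * z i) = 0" unfolding combination by (simp add: row_def)
  ultimately have "nontrivial_solution M (insert b B) A z"
    using solution_x(1) solution_y(1) combination by (auto simp: nontrivial_solution_def z_def)
  then show ?thesis by (rule that)
qed

lemma underdetermined_system_nontrivial:
  assumes "finite B" "finite A" "card B < card A"
  obtains x where "nontrivial_solution M B A x"
  using assms
proof (induction B arbitrary: A thesis rule: finite_induct)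
  case empty
  then obtain i where "i \<in> A" by fastforce
  then show ?case
    using empty.prems(1)[of "\<lambda>j. of_bool (j = i)"] by (auto simp: nontrivial_solution_def)
next
  case (insert b B)
  have sub: "\<exists>x. nontrivial_solution M B (A - {k}) x" if "k \<in> A" for k
  proof -
    have "card B < card (A - {k})" using insert that by simp
    then show ?thesis using insert.IH[of "A - {k}"] insert.prems(2) by blast
  qed
  have "A \<noteq> {}" using insert.prems by auto
  then obtain k0 x where x: "k0 \<in> A" "nontrivial_solution M B (A - {k0}) x" using sub by blast
  then obtain k where k: "k \<in> A" "x k \<noteq> 0" by (auto simp: nontrivial_solution_def)
  from sub[OF k(1)] obtain y where y: "nontrivial_solution M B (A - {k}) y" by blast
  then have "y k = 0" by (simp add: nontrivial_solution_def)
  then show ?case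
    using nontrivial_solution_insert[of M B A x k y b] nontrivial_solution_mono[OF x(2), of A]
      nontrivial_solution_mono[OF y, of A] k(2) insert.prems by blast
qed

text \<open>The operators \<open>raise\<close> and \<open>lower\<close> of the representation of \<open>sl\<^sub>2\<close> on the subsets of the chain
  \<open>{0, \<dots>, n}\<close> move one element by one step. They are adjoint, and their commutator is diagonal.\<close>

definition up :: "nat \<Rightarrow> (nat set \<Rightarrow> real) \<Rightarrow> nat set \<Rightarrow> real" where
  "up t x S = (if Suc t \<in> S \<and> t \<notin> S then x (insert t (S - {Suc t})) else 0)"

definition down :: "nat \<Rightarrow> (nat set \<Rightarrow> real) \<Rightarrow> nat set \<Rightarrow> real" where
  "down t x S = (if t \<in> S \<and> Suc t \<notin> S then x (insert (Suc t) (S - {t})) else 0)"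

definition raise :: "nat \<Rightarrow> (nat set \<Rightarrow> real) \<Rightarrow> nat set \<Rightarrow> real" where
  "raise n x S = (\<Sum>t<n. sqrt (real (Suc t * (n - t))) * up t x S)"

definition lower :: "nat \<Rightarrow> (nat set \<Rightarrow> real) \<Rightarrow> nat set \<Rightarrow> real" where
  "lower n x S = (\<Sum>t<n. sqrt (real (Suc t * (n - t))) * down t x S)"

definition dot :: "nat \<Rightarrow> (nat set \<Rightarrow> real) \<Rightarrow> (nat set \<Rightarrow> real) \<Rightarrow> real" where
  "dot n x y = (\<Sum>S\<in>Pow {..n}. x S * y S)"

lemma dot_commute: "dot n x y = dot n y x"
  by (simp add: dot_def mult.commute)

lemma dot_self_nonneg: "0 \<le> dot n x x"
  by (simp add: dot_def sum_nonneg)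

lemma dot_diff_right: "dot n x y - dot n x z = dot n x (\<lambda>S. y S - z S)"
  by (simp add: dot_def right_diff_distrib sum_subtractf)

lemma dot_sum: "dot n (\<lambda>S. \<Sum>i\<in>I. c i * f i S) (\<lambda>S. \<Sum>j\<in>J. d j * g j S) =
    (\<Sum>i\<in>I. \<Sum>j\<in>J. c i * d j * dot n (f i) (g j))"
proof -
  have "dot n (\<lambda>S. \<Sum>i\<in>I. c i * f i S) (\<lambda>S. \<Sum>j\<in>J. d j * g j S) =
      (\<Sum>S\<in>Pow {..n}. \<Sum>i\<in>I. \<Sum>j\<in>J. c i * d j * (f i S * g j S))"
    unfolding dot_def sum_product by (intro sum.cong) (auto simp: algebra_simps)
  also have "\<dots> = (\<Sum>i\<in>I. \<Sum>S\<in>Pow {..n}. \<Sum>j\<in>J. c i * d j * (f i S * g j S))" by (rule sum.swap)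
  also have "\<dots> = (\<Sum>i\<in>I. \<Sum>j\<in>J. \<Sum>S\<in>Pow {..n}. c i * d j * (f i S * g j S))"
    by (intro sum.cong refl sum.swap)
  finally show ?thesis by (simp add: dot_def sum_distrib_left)
qed

lemma dot_up:
  assumes "t < n" shows "dot n (up t x) y = dot n x (down t y)"
proof -
  let ?A = "{S \<in> Pow {..n}. Suc t \<in> S \<and> t \<notin> S}" and ?B = "{S \<in> Pow {..n}. t \<in> S \<and> Suc t \<notin> S}"
  have "dot n (up t x) y = (\<Sum>S\<in>?A. x (insert t (S - {Suc t})) * y S)"
    unfolding dot_def by (rule sum.mono_neutral_cong_right) (auto simp: up_def)
  also have "\<dots> = (\<Sum>S\<in>?B. x S * y (insert (Suc t) (S - {t})))"
    by (rule sum.reindex_bij_witness[of _ "\<lambda>S. insert (Suc t) (S - {t})" "\<lambda>S. insert t (S - {Suc t})"])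
       (use assms in \<open>auto simp: insert_absorb insert_Diff_if\<close>)
  also have "\<dots> = dot n x (down t y)"
    unfolding dot_def by (rule sum.mono_neutral_cong_left) (auto simp: down_def)
  finally show ?thesis .
qed

lemma down_up_commute:
  assumes "s \<noteq> t" shows "down s (up t x) = up t (down s x)"
proof
  fix S
  have "insert t (insert (Suc s) (S - {s}) - {Suc t}) = insert (Suc s) (insert t (S - {Suc t}) - {s})"
    using assms by auto
  then show "down s (up t x) S = up t (down s x) S" using assms by (auto simp: up_def down_def)
qed

lemma down_up_diff: "down t (up t x) S - up t (down t x) S = (of_bool (t \<in> S) - of_bool (Suc t \<in> S)) * x S"
proof -
  have "insert t (insert (Suc t) (S - {t}) - {Suc t}) = S" if "t \<in> S" "Suc t \<notin> S" using that by auto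
  moreover have "insert (Suc t) (insert t (S - {Suc t}) - {t}) = S" if "t \<notin> S" "Suc t \<in> S"
    using that by auto
  ultimately show ?thesis by (auto simp: up_def down_def)
qed

lemma sum_commutator_weights:
  assumes "S \<subseteq> {..n}"
  shows "(\<Sum>t<n. real (Suc t * (n - t)) * (of_bool (t \<in> S) - of_bool (Suc t \<in> S))) =
    real n * real (card S) - 2 * real (\<Sum>S)"
proof -
  define v where "v t = real t * (real (Suc n) - real t)" for t
  have fin: "finite S" using assms by (rule finite_subset) simp
  have indicator: "(\<Sum>t\<le>n. f t * of_bool (t \<in> S)) = (\<Sum>t\<in>S. f t)" for f :: "nat \<Rightarrow> real"
    using assms by (intro sum.mono_neutral_cong_right) auto
  have "(\<Sum>t<n. v (Suc t) * of_bool (t \<in> S)) = (\<Sum>t\<le>n. v (Suc t) * of_bool (t \<in> S))"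
    by (simp add: v_def flip: lessThan_Suc_atMost)
  moreover have "(\<Sum>t<n. v (Suc t) * of_bool (Suc t \<in> S)) = (\<Sum>t\<le>n. v t * of_bool (t \<in> S))"
    by (simp add: v_def sum.lessThan_Suc_shift del: sum.lessThan_Suc flip: lessThan_Suc_atMost)
  moreover have "real (Suc t * (n - t)) = v (Suc t)" if "t < n" for t
    using that by (simp add: v_def of_nat_diff del: mult_Suc)
  ultimately have "(\<Sum>t<n. real (Suc t * (n - t)) * (of_bool (t \<in> S) - of_bool (Suc t \<in> S))) =
      (\<Sum>t\<in>S. v (Suc t)) - (\<Sum>t\<in>S. v t)"
    by (simp add: right_diff_distrib sum_subtractf indicator)
  also have "\<dots> = (\<Sum>t\<in>S. real n - 2 * real t)"
    unfolding sum_subtractf[symmetric] by (intro sum.cong) (auto simp: v_def algebra_simps)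
  also have "\<dots> = real n * real (card S) - 2 * real (\<Sum>S)"
    by (simp add: sum_subtractf sum_distrib_left)
  finally show ?thesis .
qed

lemma dot_raise_lower:
  "dot n (raise n x) (raise n x) - dot n (lower n x) (lower n x) =
    (\<Sum>S\<in>Pow {..n}. (real n * real (card S) - 2 * real (\<Sum>S)) * (x S)\<^sup>2)"
proof -
  let ?c = "\<lambda>t. sqrt (real (Suc t * (n - t)))"
  have lower: "dot n (down s x) (down t x) = dot n x (up t (down s x))" if "t < n" for s t
    using dot_up[OF that, of "down s x" x] dot_commute by metis
  have "dot n (raise n x) (raise n x) - dot n (lower n x) (lower n x) =
      (\<Sum>s<n. \<Sum>t<n. ?c s * ?c t * (dot n x (down s (up t x)) - dot n x (up t (down s x))))"
    unfolding raise_def[abs_def] lower_def[abs_def] dot_sum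
    by (simp add: dot_up lower right_diff_distrib flip: sum_subtractf)
  also have "\<dots> = (\<Sum>s<n. \<Sum>t<n.
      if t = s then ?c s * ?c s * dot n x (\<lambda>S. down s (up s x) S - up s (down s x) S) else 0)"
  proof (intro sum.cong refl)
    fix s t
    show "?c s * ?c t * (dot n x (down s (up t x)) - dot n x (up t (down s x))) =
        (if t = s then ?c s * ?c s * dot n x (\<lambda>S. down s (up s x) S - up s (down s x) S) else 0)"
      by (cases "t = s") (simp_all add: down_up_commute flip: dot_diff_right)
  qed
  also have "\<dots> = (\<Sum>s<n. real (Suc s * (n - s)) * dot n x (\<lambda>S. down s (up s x) S - up s (down s x) S))"
    by (simp del: of_nat_mult)
  also have "\<dots> = (\<Sum>s<n. \<Sum>S\<in>Pow {..n}.
      real (Suc s * (n - s)) * (of_bool (s \<in> S) - of_bool (Suc s \<in> S)) * (x S)\<^sup>2)"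
    unfolding down_up_diff dot_def sum_distrib_left
    by (intro sum.cong refl) (simp add: power2_eq_square)
  also have "\<dots> = (\<Sum>S\<in>Pow {..n}. \<Sum>s<n.
      real (Suc s * (n - s)) * (of_bool (s \<in> S) - of_bool (Suc s \<in> S)) * (x S)\<^sup>2)"
    by (rule sum.swap)
  also have "\<dots> = (\<Sum>S\<in>Pow {..n}. (real n * real (card S) - 2 * real (\<Sum>S)) * (x S)\<^sup>2)"
    by (intro sum.cong refl) (simp only: sum_distrib_right[symmetric] sum_commutator_weights Pow_iff)
  finally show ?thesis .
qed

lemma raise_eq_sum:
  assumes "finite A" "\<And>S. S \<notin> A \<Longrightarrow> x S = 0"
  shows "raise n x S = (\<Sum>T\<in>A. raise n (\<lambda>U. of_bool (U = T)) S * x T)"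
proof -
  have "up t x S = (\<Sum>T\<in>A. up t (\<lambda>U. of_bool (U = T)) S * x T)" for t
    using assms
    by (auto simp: up_def of_bool_def if_distrib[of "\<lambda>c. c * _"] sum.delta cong: if_cong)
  then show ?thesis
    unfolding raise_def by (simp add: sum_distrib_left sum_distrib_right mult.assoc) (rule sum.swap)
qed

lemma level_if_moved:
  assumes "S \<subseteq> {..<n}" "Suc t \<in> S" "t \<notin> S" "insert t (S - {Suc t}) \<in> level n m j"
  shows "S \<in> level n m (j + 1)"
proof -
  have fin: "finite S" using assms(1) by (rule finite_subset) simp
  then have "\<Sum>S = Suc t + \<Sum>(S - {Suc t})" "card S = Suc (card (S - {Suc t}))"
    using assms(2) by (rule sum.remove, rule card.remove)
  then show ?thesis using assms fin by (simp add: level_def del: of_nat_sum)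
qed

lemma raise_eq_0_imp_eq_0:
  assumes lower_half: "2 * j < int m * int n" and supp: "\<And>S. S \<notin> level (Suc n) m j \<Longrightarrow> x S = 0"
    and raise: "\<And>S. S \<in> Pow {..n} \<Longrightarrow> raise n x S = 0"
  shows "x S = 0"
proof (rule ccontr)
  assume "x S \<noteq> 0"
  let ?w = "\<lambda>S. real n * real (card S) - 2 * real (\<Sum>S)"
  have weight: "0 < ?w T" if "T \<in> level (Suc n) m j" for T
  proof -
    have "int (2 * \<Sum>T) < int (card T * n)" using that lower_half by (simp add: level_def)
    then have "real (2 * \<Sum>T) < real (card T * n)" by (simp only: of_nat_less_iff)
    then show ?thesis by (simp add: mult.commute)
  qed
  have "0 < (\<Sum>T\<in>Pow {..n}. ?w T * (x T)\<^sup>2)"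
  proof (rule sum_pos2[of _ S])
    have "S \<in> level (Suc n) m j" using supp \<open>x S \<noteq> 0\<close> by blast
    then show "S \<in> Pow {..n}" "0 < ?w S * (x S)\<^sup>2"
      using weight \<open>x S \<noteq> 0\<close> by (auto simp: level_def less_Suc_eq_le)
    show "0 \<le> ?w T * (x T)\<^sup>2" for T
      using weight[of T] supp[of T] by (cases "T \<in> level (Suc n) m j") auto
  qed simp
  moreover have "dot n (raise n x) (raise n x) = 0" using raise by (simp add: dot_def)
  ultimately show False using dot_raise_lower[of n x] dot_self_nonneg[of n "lower n x"] by simp
qed

lemma card_level_le:
  assumes "2 * j < int m * (int n - 1)"
  shows "card (level n m j) \<le> card (level n m (j + 1))"
proof (cases n)
  case 0
  then have "level n m j = {}" using assms by (auto simp: level_def)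
  then show ?thesis by simp
next
  case (Suc k)
  let ?A = "level n m j" and ?B = "level n m (j + 1)"
  show ?thesis
  proof (rule ccontr)
    assume "\<not> ?thesis"
    then obtain x where x: "nontrivial_solution (\<lambda>S T. raise k (\<lambda>U. of_bool (U = T)) S) ?B ?A x"
      using underdetermined_system_nontrivial[of ?B ?A] finite_level by (metis not_le)
    then have supp: "x S = 0" if "S \<notin> ?A" for S using that by (simp add: nontrivial_solution_def)
    have "raise k x S = 0" if "S \<in> Pow {..k}" for S
    proof (cases "S \<in> ?B")
      case True
      then show ?thesis
        using x raise_eq_sum[OF finite_level supp] by (simp add: nontrivial_solution_def)
    next
      case False
      then have "up t x S = 0" for t
        using level_if_moved[of S n t m j] supp that Suc by (auto simp: up_def lessThan_Suc_atMost)
      then show ?thesis by (simp add: raise_def)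
    qed
    then have "x S = 0" for S using raise_eq_0_imp_eq_0[of j m k x S] assms supp Suc by simp
    then show False using x by (simp add: nontrivial_solution_def)
  qed
qed

lemma sym_unimodal_gauss_poly:
  "sym_unimodal (int m * (int n - 1) - 2 * int (\<Sum>{..<m})) (icoeff (gauss_poly n m))"
proof (rule sym_unimodalI)
  fix i
  show "icoeff (gauss_poly n m) (int m * (int n - 1) - 2 * int (\<Sum>{..<m}) - i) = icoeff (gauss_poly n m) i"
    using card_level_reflect[of n m "i + int (\<Sum>{..<m})"]
    by (simp add: icoeff_gauss_poly algebra_simps del: of_nat_sum)
  assume "2 * i < int m * (int n - 1) - 2 * int (\<Sum>{..<m})"
  then show "icoeff (gauss_poly n m) i \<le> icoeff (gauss_poly n m) (i + 1)"
    using card_level_le[of "i + int (\<Sum>{..<m})" m n]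
    by (simp add: icoeff_gauss_poly algebra_simps del: of_nat_sum)
qed

section \<open>Heights of a lattice path\<close>

definition easts :: "step list \<Rightarrow> nat \<Rightarrow> nat" where
  "easts D n = count_list (take n D) East"

definition norths :: "step list \<Rightarrow> nat \<Rightarrow> nat" where
  "norths D n = count_list (take n D) North"

definition height :: "step list \<Rightarrow> nat \<Rightarrow> nat" where
  "height D i = (if i = 0 then 0 else norths D (east_steps D ! (i - 1)))"

lemma height_0 [simp]: "height D 0 = 0"
  by (simp add: height_def)

lemma vertex_eq: "vertex D n = (real (easts D n), real (norths D n))"
  by (simp add: vertex_def easts_def norths_def)

lemma count_list_take_mono: "m \<le> n \<Longrightarrow> count_list (take m D) s \<le> count_list (take n D) s"
  by (metis count_list_append le_add1 le_add_diff_inverse take_add)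

lemma easts_mono: "m \<le> n \<Longrightarrow> easts D m \<le> easts D n"
  and norths_mono: "m \<le> n \<Longrightarrow> norths D m \<le> norths D n"
  by (simp_all add: easts_def norths_def count_list_take_mono)

lemma easts_Suc: "n < length D \<Longrightarrow> easts D (Suc n) = easts D n + (if D ! n = East then 1 else 0)"
  and norths_Suc: "n < length D \<Longrightarrow> norths D (Suc n) = norths D n + (if D ! n = North then 1 else 0)"
  by (simp_all add: easts_def norths_def take_Suc_conv_app_nth)

lemma easts_le: "easts D n \<le> count_list D East" and norths_le: "norths D n \<le> count_list D North"
  using count_list_take_mono[of n "max n (length D)" D] by (simp_all add: easts_def norths_def)

lemma east_steps_snoc: "east_steps (D @ [s]) = east_steps D @ (if s = East then [length D] else [])"
proof -
  have "filter (\<lambda>n. (D @ [s]) ! n = East) [0..<length D] = filter (\<lambda>n. D ! n = East) [0..<length D]"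
    by (rule filter_cong) (auto simp: nth_append)
  then show ?thesis by (simp add: east_steps_def)
qed

lemma length_east_steps: "length (east_steps D) = count_list D East"
proof (induction D rule: rev_induct)
  case (snoc s D) then show ?case by (simp add: east_steps_snoc)
qed (simp add: east_steps_def)

lemma east_steps_nth:
  assumes "i < count_list D East"
  shows "east_steps D ! i < length D \<and> D ! (east_steps D ! i) = East \<and> easts D (east_steps D ! i) = i"
  using assms
proof (induction D rule: rev_induct)
  case (snoc s D)
  then show ?case
    using length_east_steps[of D]
    by (cases "i < count_list D East")
       (auto simp: east_steps_snoc nth_append easts_def less_Suc_eq split: if_splits)
qed simp

definition on_step :: "step list \<Rightarrow> nat \<Rightarrow> real \<Rightarrow> real \<Rightarrow> bool" where
  "on_step D n x y \<longleftrightarrow> (case D ! n of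
     East \<Rightarrow> real (easts D n) \<le> x \<and> x \<le> real (easts D n) + 1 \<and> y = real (norths D n)
   | North \<Rightarrow> x = real (easts D n) \<and> real (norths D n) \<le> y \<and> y \<le> real (norths D n) + 1)"

lemma mem_horizontal_segment:
  "(s, t) \<in> closed_segment (x, y) (x + 1 :: real, y :: real) \<longleftrightarrow> x \<le> s \<and> s \<le> x + 1 \<and> t = y"
proof
  assume "x \<le> s \<and> s \<le> x + 1 \<and> t = y"
  then show "(s, t) \<in> closed_segment (x, y) (x + 1, y)"
    by (auto simp: in_segment algebra_simps intro!: exI[of _ "s - x"])
qed (auto simp: in_segment algebra_simps)

lemma mem_vertical_segment:
  "(s, t) \<in> closed_segment (x, y) (x :: real, y + 1 :: real) \<longleftrightarrow> y \<le> t \<and> t \<le> y + 1 \<and> s = x"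
proof
  assume "y \<le> t \<and> t \<le> y + 1 \<and> s = x"
  then show "(s, t) \<in> closed_segment (x, y) (x, y + 1)"
    by (auto simp: in_segment algebra_simps intro!: exI[of _ "t - y"])
qed (auto simp: in_segment algebra_simps)

lemma mem_path_points: "(x, y) \<in> path_points D \<longleftrightarrow> (\<exists>n<length D. on_step D n x y)"
proof -
  have "(x, y) \<in> closed_segment (vertex D n) (vertex D (Suc n)) \<longleftrightarrow> on_step D n x y" if "n < length D" for n
    using mem_horizontal_segment[of x y "real (easts D n)" "real (norths D n)"]
      mem_vertical_segment[of x y "real (easts D n)" "real (norths D n)"]
    by (cases "D ! n")
       (auto simp: on_step_def vertex_eq easts_Suc[OF that] norths_Suc[OF that] add.commute)
  then show ?thesis by (auto simp: path_points_def)
qed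

locale lattice_path =
  fixes D :: "step list" and b :: nat
  assumes count_East: "count_list D East = b"
begin

lemma easts_le_b: "easts D n \<le> b"
  using easts_le count_East by metis

lemma east_step:
  assumes "1 \<le> i" "i \<le> b"
  obtains n where "n = east_steps D ! (i - 1)" "n < length D" "D ! n = East" "easts D n = i - 1"
    "easts D (Suc n) = i" "norths D n = height D i" "norths D (Suc n) = height D i"
proof -
  have "i - 1 < count_list D East" using assms count_East by simp
  then have n: "east_steps D ! (i - 1) < length D" "D ! (east_steps D ! (i - 1)) = East"
    "easts D (east_steps D ! (i - 1)) = i - 1" using east_steps_nth by blast+
  show ?thesis
    using that[OF refl n] easts_Suc[OF n(1)] norths_Suc[OF n(1)] n assms by (simp add: height_def)
qed

lemma height_le_norths:
  assumes "i \<le> b" "i \<le> easts D n" shows "height D i \<le> norths D n"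
proof (cases "i = 0")
  case False
  then obtain e where e: "easts D e = i - 1" "norths D e = height D i"
    using east_step[of i] assms by auto
  have "e \<le> n" using easts_mono[of n e D] e assms False by (cases "e \<le> n") auto
  then show ?thesis using norths_mono[of e n D] e by simp
qed simp

lemma norths_le_height:
  assumes "i \<le> b" "easts D n < i" shows "norths D n \<le> height D i"
proof -
  obtain e where e: "easts D (Suc e) = i" "norths D e = height D i"
    using east_step[of i] assms by auto
  have "n \<le> e" using easts_mono[of "Suc e" n D] e assms by (cases "n \<le> e") auto
  then show ?thesis using norths_mono[of n e D] e by simp
qed

lemma height_mono:
  assumes "i \<le> j" "j \<le> b" shows "height D i \<le> height D j"
proof (cases "j = 0")
  case False
  then obtain e where "easts D (Suc e) = j" "norths D (Suc e) = height D j"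
    using east_step[of j] assms by auto
  then show ?thesis using height_le_norths[of i "Suc e"] assms by simp
qed (use assms in simp)

lemma path_points_range:
  assumes "(x, y) \<in> path_points D" shows "0 \<le> x" "x \<le> real b" "0 \<le> y"
proof -
  obtain n where "n < length D" "on_step D n x y" using assms mem_path_points by blast
  then show "0 \<le> x" "x \<le> real b" "0 \<le> y"
    using easts_le_b[of n] easts_le_b[of "Suc n"] easts_Suc[of n D]
    by (auto simp: on_step_def split: step.splits)
qed

lemma path_points_above:
  assumes "(x, y) \<in> path_points D" "i \<le> b" "real i - 1 < x"
  shows "real (height D i) \<le> y"
proof -
  obtain n where n: "n < length D" "on_step D n x y" using assms mem_path_points by blast
  show ?thesis
  proof (cases "D ! n")
    case East
    then have "i \<le> easts D (Suc n)" using n assms(3) easts_Suc[OF n(1)] by (simp add: on_step_def)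
    then show ?thesis
      using height_le_norths[OF assms(2)] East n norths_Suc[OF n(1)] by (force simp: on_step_def)
  next
    case North
    then have "i \<le> easts D n" using n assms(3) by (simp add: on_step_def)
    then have "height D i \<le> norths D n" by (rule height_le_norths[OF assms(2)])
    then show ?thesis using North n by (simp add: on_step_def)
  qed
qed

lemma horizontal_path_points:
  assumes "1 \<le> i" "i \<le> b" "real i - 1 \<le> x" "x \<le> real i"
  shows "(x, real (height D i)) \<in> path_points D"
proof -
  obtain n where "n < length D" "D ! n = East" "easts D n = i - 1" "norths D n = height D i"
    using east_step[OF assms(1,2)] .
  then show ?thesis
    using assms unfolding mem_path_points
    by (auto simp: on_step_def of_nat_diff intro!: exI[of _ n])
qed

lemma vertical_path_points:
  assumes "1 \<le> i" "i < b" "real (height D i) \<le> y" "y \<le> real (height D (Suc i))"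
  shows "(real i, y) \<in> path_points D"
proof (cases "y = real (height D (Suc i))")
  case True
  then show ?thesis using horizontal_path_points[of "Suc i" "real i"] assms by simp
next
  case False
  obtain e where last_east: "easts D (Suc e) = i" "norths D (Suc e) = height D i"
    using east_step[of i] assms by auto
  obtain e' where next_east: "e' < length D" "easts D e' = i" "norths D e' = height D (Suc i)"
    using east_step[of "Suc i"] assms by auto
  define P where "P n \<longleftrightarrow> n \<le> e' \<and> real (norths D n) \<le> y" for n
  define n where "n = Greatest P"
  have bounded: "k \<le> e'" if "P k" for k using that by (simp add: P_def)
  have "Suc e \<le> e'"
    using norths_mono[of e' "Suc e" D] last_east next_east assms False by (cases "Suc e \<le> e'") auto
  then have start: "P (Suc e)" using last_east assms(3) by (simp add: P_def)
  then have n_le: "n \<le> e'" "real (norths D n) \<le> y"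
    using GreatestI_nat[of P, OF _ bounded] by (simp_all add: n_def P_def)
  have greatest: "k \<le> n" if "P k" for k
    unfolding n_def by (rule Greatest_le_nat[of P, OF that bounded])
  have "Suc e \<le> n" using greatest[OF start] .
  have "n < e'" using n_le next_east assms(4) False by (cases "n = e'") auto
  moreover have "\<not> P (Suc n)" using greatest[of "Suc n"] by auto
  ultimately have "y < real (norths D (Suc n))" by (simp add: P_def)
  moreover have "easts D n = i"
    using easts_mono[OF \<open>Suc e \<le> n\<close>, of D] easts_mono[OF n_le(1), of D] last_east next_east by simp
  ultimately have "on_step D n (real i) y"
    using n_le(2) norths_Suc[of n D] \<open>n < e'\<close> next_east(1)
    by (cases "D ! n") (auto simp: on_step_def)
  then show ?thesis
    using \<open>n < e'\<close> next_east(1) unfolding mem_path_points by (intro exI[of _ n]) simp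
qed

lemma label_eq:
  assumes "1 \<le> i" "i \<le> b" shows "label D \<epsilon> i = (real i, real (height D i) - \<epsilon>)"
proof -
  obtain n where "n = east_steps D ! (i - 1)" "easts D (Suc n) = i" "norths D (Suc n) = height D i"
    using east_step[OF assms] .
  then show ?thesis by (simp add: label_def vertex_eq)
qed

lemma path_above_line_iff:
  assumes "0 < b" "0 \<le> c"
  shows "(\<forall>(x, y)\<in>path_points D. c * x \<le> y) \<longleftrightarrow> (\<forall>i\<in>{1..b}. c * real i \<le> real (height D i))"
proof
  assume above: "\<forall>(x, y)\<in>path_points D. c * x \<le> y"
  show "\<forall>i\<in>{1..b}. c * real i \<le> real (height D i)"
  proof
    fix i assume "i \<in> {1..b}"
    then have "(real i, real (height D i)) \<in> path_points D" by (intro horizontal_path_points) auto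
    then show "c * real i \<le> real (height D i)" using above by auto
  qed
next
  assume above: "\<forall>i\<in>{1..b}. c * real i \<le> real (height D i)"
  have "c * x \<le> y" if xy: "(x, y) \<in> path_points D" for x y
  proof (cases "x = 0")
    case False
    define i where "i = nat \<lceil>x\<rceil>"
    have i: "1 \<le> i" "i \<le> b" "real i - 1 < x" "x \<le> real i"
      using path_points_range[OF xy] False unfolding i_def by linarith+
    have "c * x \<le> c * real i" using i(4) assms(2) by (rule mult_left_mono)
    also have "\<dots> \<le> real (height D i)" using above i by simp
    also have "\<dots> \<le> y" by (rule path_points_above[OF xy i(2,3)])
    finally show ?thesis .
  qed (use path_points_range[OF xy] in simp)
  then show "\<forall>(x, y)\<in>path_points D. c * x \<le> y" by blast
qed

end

lemma dyck_paths_iff: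
  assumes "0 < b"
  shows "D \<in> dyck_paths a b \<longleftrightarrow> count_list D East = b \<and> count_list D North = a \<and>
    (\<forall>i\<le>b. a * i \<le> b * height D i)"
proof (cases "count_list D East = b")
  case True
  then interpret lattice_path D b by unfold_locales
  have "real a / real b * real i \<le> real (height D i) \<longleftrightarrow> a * i \<le> b * height D i" for i
  proof -
    have "real a / real b * real i \<le> real (height D i) \<longleftrightarrow> real (a * i) \<le> real (b * height D i)"
      using assms by (simp add: field_simps)
    then show ?thesis by (simp only: of_nat_le_iff)
  qed
  moreover have "(\<forall>i\<in>{1..b}. a * i \<le> b * height D i) \<longleftrightarrow> (\<forall>i\<le>b. a * i \<le> b * height D i)"
    by (metis One_nat_def atLeastAtMost_iff height_0 mult_0_right not_less_eq_eq le_0_eq order_refl)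
  ultimately show ?thesis
    using path_above_line_iff[OF assms, of "real a / real b"] True
    by (simp add: dyck_paths_def vertex_def)
qed (simp add: dyck_paths_def vertex_def)

locale nat_slope =
  fixes a b N :: nat
  assumes b_eq: "b = Suc N" and a_pos: "0 < a" and a_less: "a < b" and coprime_ab: "coprime a b"
begin

lemma N_pos: "0 < N" and b_pos: "0 < b"
  using b_eq a_pos a_less by simp_all

sublocale walk: slope "int a" "int b" "int N"
  by unfold_locales (use a_pos a_less coprime_ab in simp_all, use b_eq in simp)

end

locale dyck_path = nat_slope +
  fixes D :: "step list"
  assumes dyck: "D \<in> dyck_paths a b"
begin

lemma count_North: "count_list D North = a" and height_ge: "i \<le> b \<Longrightarrow> a * i \<le> b * height D i"
  using dyck dyck_paths_iff[OF b_pos] by auto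

sublocale lattice_path D b
  using dyck dyck_paths_iff[OF b_pos] by unfold_locales blast

lemma height_N: "height D N = a"
proof -
  have "height D N \<le> a"
    using height_le_norths[of N "length D"] count_East count_North b_eq
    by (simp add: easts_def norths_def)
  moreover have "\<not> height D N < a"
  proof
    assume "height D N < a"
    then have "b * Suc (height D N) \<le> b * a" by (intro mult_le_mono2) simp
    moreover have "a * N \<le> b * height D N" using height_ge[of N] b_eq by simp
    moreover have "b * a = a * N + a" by (simp add: b_eq)
    ultimately show False using a_less by simp
  qed
  ultimately show ?thesis by simp
qed

lemma height_b: "height D b = a"
proof -
  have "b * a \<le> b * height D b" using height_ge[of b] by (simp add: mult.commute)
  moreover have "height D b \<le> a"
    using height_le_norths[of b "length D"] count_East count_North
    by (simp add: easts_def norths_def)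
  ultimately show ?thesis using b_pos by simp
qed

definition valley_at :: "nat \<Rightarrow> bool" where
  "valley_at p \<longleftrightarrow> 1 \<le> p \<and> p < b \<and> height D p < height D (Suc p)"

lemma valley_at_if_valley:
  assumes valley: "Suc n < length D" "D ! n = East" "D ! Suc n = North"
  obtains p where "valley_at p" "vertex D (Suc n) = (real p, real (height D p))"
proof -
  define p where "p = easts D (Suc n)"
  have p_bounds: "1 \<le> p" "p \<le> b" "easts D n = p - 1"
    using easts_Suc[of n D] valley easts_le_b[of "Suc n"] by (auto simp: p_def)
  have "height D p \<le> norths D (Suc n)"
    by (rule height_le_norths) (use p_bounds in \<open>auto simp: p_def\<close>)
  moreover have "norths D n \<le> height D p" by (rule norths_le_height) (use p_bounds in auto)
  ultimately have norths_Suc_n: "norths D (Suc n) = height D p"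
    using norths_Suc[of n D] valley by simp
  have next_step: "easts D (Suc (Suc n)) = p" "norths D (Suc (Suc n)) = Suc (height D p)"
    using easts_Suc[of "Suc n" D] norths_Suc[of "Suc n" D] valley norths_Suc_n by (auto simp: p_def)
  then have "p \<noteq> b" using norths_le[of D "Suc (Suc n)"] height_b count_North by auto
  then have "p < b" using p_bounds by simp
  moreover have "Suc (height D p) \<le> height D (Suc p)"
    using norths_le_height[of "Suc p" "Suc (Suc n)"] next_step \<open>p < b\<close> by simp
  ultimately have "valley_at p" using p_bounds(1) by (simp add: valley_at_def)
  then show ?thesis by (rule that) (simp add: vertex_eq p_def[symmetric] norths_Suc_n)
qed

lemma valley_if_valley_at:
  assumes "valley_at p"
  obtains n where "Suc n < length D" "D ! n = East" "D ! Suc n = North"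
    "vertex D (Suc n) = (real p, real (height D p))"
proof -
  have valley: "1 \<le> p" "p < b" "height D p < height D (Suc p)"
    using assms by (simp_all add: valley_at_def)
  obtain n where east: "n < length D" "D ! n = East" "easts D (Suc n) = p" "norths D (Suc n) = height D p"
    using east_step[of p] valley by auto
  have length: "Suc n < length D"
  proof (rule ccontr)
    assume "\<not> Suc n < length D"
    then show False using count_East east valley(2) by (simp add: easts_def)
  qed
  have "D ! Suc n \<noteq> East"
    using easts_Suc[OF length] norths_Suc[OF length] east valley
      height_le_norths[of "Suc p" "Suc (Suc n)"]
    by auto
  then have "D ! Suc n = North" by (cases "D ! Suc n") auto
  then show ?thesis by (rule that[OF length east(2)]) (simp add: vertex_eq east)
qed

lemma valleys_eq: "valleys D = (\<lambda>p. (real p, real (height D p))) ` {p. valley_at p}"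
proof (intro subset_antisym subsetI)
  fix P assume "P \<in> valleys D"
  then obtain n where n: "P = vertex D (Suc n)" "Suc n < length D" "D ! n = East" "D ! Suc n = North"
    by (auto simp: valleys_def)
  obtain p where "valley_at p" "vertex D (Suc n) = (real p, real (height D p))"
    using valley_at_if_valley[OF n(2-4)] .
  then show "P \<in> (\<lambda>p. (real p, real (height D p))) ` {p. valley_at p}" using n(1) by auto
next
  fix P assume "P \<in> (\<lambda>p. (real p, real (height D p))) ` {p. valley_at p}"
  then obtain p where p: "valley_at p" "P = (real p, real (height D p))" by blast
  obtain n where "Suc n < length D" "D ! n = East" "D ! Suc n = North"
    "vertex D (Suc n) = (real p, real (height D p))" using valley_if_valley_at[OF p(1)] .
  then show "P \<in> valleys D" unfolding valleys_def p(2) by (intro CollectI exI[of _ n]) simp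
qed

end

section \<open>The region cut off by a laser\<close>

locale dyck_valley = dyck_path +
  fixes p :: nat
  assumes valley: "valley_at p"
begin

lemma p_pos: "1 \<le> p" and p_less: "p < b" and height_less: "height D p < height D (Suc p)"
  using valley by (simp_all add: valley_at_def)

definition line :: "real \<Rightarrow> real" where
  "line x = real (height D p) + real a / real b * (x - real p)"

definition stop :: nat where
  "stop = (LEAST q. p < q \<and> real (height D q) \<le> line (real q))"

definition laser_end :: real where
  "laser_end = real p + real b / real a * (real (height D stop) - real (height D p))"

definition inside :: "nat \<Rightarrow> bool" where
  "inside i \<longleftrightarrow> p < i \<and> i < stop"

lemma line_less_iff: "line x < line y \<longleftrightarrow> x < y"
proof -
  have "0 < real a / real b" using a_pos b_pos by simp
  then show ?thesis by (simp only: line_def add_less_cancel_left mult_less_cancel_left_pos) simp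
qed

lemma line_le_iff: "line x \<le> line y \<longleftrightarrow> x \<le> y"
  using line_less_iff by (simp flip: not_less)

lemma line_p: "line (real p) = real (height D p)"
  by (simp add: line_def)

lemma line_laser_end: "line laser_end = real (height D stop)"
  using a_pos b_pos by (simp add: line_def laser_end_def)

lemma stop_witness: "p < b \<and> real (height D b) \<le> line (real b)"
proof -
  have "real (a * p) \<le> real (b * height D p)" unfolding of_nat_le_iff using height_ge p_less by simp
  then show ?thesis using p_less b_pos by (simp add: line_def height_b field_simps)
qed

lemma p_less_stop: "p < stop" and stop_le_line: "real (height D stop) \<le> line (real stop)"
  using LeastI[of "\<lambda>q. p < q \<and> real (height D q) \<le> line (real q)", OF stop_witness]
  by (simp_all add: stop_def)

lemma stop_le: "stop \<le> b"
  unfolding stop_def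
  by (rule Least_le[of "\<lambda>q. p < q \<and> real (height D q) \<le> line (real q)", OF stop_witness])

lemma inside_above_line: "inside i \<Longrightarrow> line (real i) < real (height D i)"
  using not_less_Least[of i "\<lambda>q. p < q \<and> real (height D q) \<le> line (real q)"]
  by (auto simp: stop_def inside_def)

lemma stop_less_line: "real (height D stop) < line (real stop)"
proof -
  have "real (height D stop) \<noteq> line (real stop)"
  proof
    assume "real (height D stop) = line (real stop)"
    then have "real b * (real (height D stop) - real (height D p)) = real a * (real stop - real p)"
      using b_pos by (simp add: line_def field_simps)
    then have "int b * (int (height D stop) - int (height D p)) = int a * (int stop - int p)"
      by (metis (mono_tags, lifting) of_int_eq_iff of_int_diff of_int_mult of_int_of_nat_eq)
    then have "int b dvd int a * (int stop - int p)" by (metis dvd_triv_left)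
    then have "int b dvd int stop - int p"
      using coprime_ab by (simp add: coprime_dvd_mult_right_iff coprime_commute)
    then have "int b \<le> int stop - int p" using p_less_stop by (intro zdvd_imp_le) auto
    then show False using stop_le p_pos by simp
  qed
  then show ?thesis using stop_le_line by simp
qed

lemma inside_Suc_p: "inside (Suc p)"
proof -
  have "stop \<noteq> Suc p"
  proof
    assume "stop = Suc p"
    then have "real (height D p) + 1 \<le> line (real (Suc p))" using stop_le_line height_less by simp
    then show False using a_less b_pos by (simp add: line_def)
  qed
  then show ?thesis using p_less_stop by (simp add: inside_def)
qed

lemma laser_end_less: "laser_end < real stop"
  using stop_less_line line_less_iff line_laser_end by metis

lemma laser_end_le_b: "laser_end \<le> real b"
  using laser_end_less stop_le by linarith

lemma less_laser_end: "inside i \<Longrightarrow> real i < laser_end"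
  using inside_above_line[of i] height_mono[of i stop] stop_le line_laser_end
    line_less_iff[of "real i" laser_end]
  by (simp add: inside_def)

lemma p_less_laser_end: "real p < laser_end"
  using less_laser_end[OF inside_Suc_p] by simp

lemma stop_pred_less: "real stop - 1 < laser_end"
proof -
  have "inside (stop - 1)" "1 \<le> stop" using inside_Suc_p by (auto simp: inside_def)
  then show ?thesis using less_laser_end[of "stop - 1"] by (simp add: of_nat_diff)
qed

lemma ceiling_index:
  assumes "real p < x" "x \<le> laser_end"
  obtains i where "1 \<le> i" "i \<le> b" "p < i" "i \<le> stop" "real i - 1 < x" "x \<le> real i"
proof
  have "0 < x" using assms(1) by (meson of_nat_0_le_iff order.strict_trans1)
  then show "1 \<le> nat \<lceil>x\<rceil>" "nat \<lceil>x\<rceil> \<le> b" "p < nat \<lceil>x\<rceil>" "nat \<lceil>x\<rceil> \<le> stop"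
    "real (nat \<lceil>x\<rceil>) - 1 < x" "x \<le> real (nat \<lceil>x\<rceil>)"
    using assms laser_end_le_b laser_end_less by linarith+
qed

lemma line_not_path:
  assumes "real p < x" "x < laser_end" shows "(x, line x) \<notin> path_points D"
proof
  assume path: "(x, line x) \<in> path_points D"
  obtain i where i: "i \<le> b" "p < i" "i \<le> stop" "real i - 1 < x" "x \<le> real i"
    using ceiling_index assms by (metis less_imp_le)
  have "line x < real (height D i)"
  proof (cases "i = stop")
    case True
    then show ?thesis using assms(2) line_laser_end line_less_iff by metis
  next
    case False
    then have "line (real i) < real (height D i)"
      using i by (intro inside_above_line) (simp add: inside_def)
    then show ?thesis using i(5) line_le_iff[of x "real i"] by linarith
  qed
  then show False using path_points_above[OF path i(1,4)] by simp
qed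

lemma laser_end_in_path: "(laser_end, line laser_end) \<in> path_points D"
  unfolding line_laser_end
  using p_less_stop stop_le laser_end_less stop_pred_less by (intro horizontal_path_points) auto

lemma laser_eq: "laser a b D (real p, real (height D p)) = (\<lambda>x. (x, line x)) ` {real p..laser_end}"
proof -
  have point: "(real p, real (height D p)) + t *\<^sub>R (real b, real a) =
      (real p + t * real b, line (real p + t * real b))" for t
    using b_pos by (simp add: line_def)
  show ?thesis
  proof (intro subset_antisym subsetI)
    fix z assume "z \<in> laser a b D (real p, real (height D p))"
    then obtain t where z: "z = (real p + t * real b, line (real p + t * real b))" "0 \<le> t"
      and free: "\<And>s. 0 < s \<Longrightarrow> s < t \<Longrightarrow> (real p + s * real b, line (real p + s * real b)) \<notin> path_points D"
      unfolding laser_def point by blast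
    have "t \<le> (laser_end - real p) / real b"
      using free[of "(laser_end - real p) / real b"] laser_end_in_path p_less_laser_end b_pos
      by force
    then have "real p + t * real b \<le> laser_end" using b_pos by (simp add: field_simps)
    then show "z \<in> (\<lambda>x. (x, line x)) ` {real p..laser_end}" using z by auto
  next
    fix z assume "z \<in> (\<lambda>x. (x, line x)) ` {real p..laser_end}"
    then obtain x where x: "z = (x, line x)" "real p \<le> x" "x \<le> laser_end" by auto
    define t where "t = (x - real p) / real b"
    have t: "real p + t * real b = x" "0 \<le> t" using x b_pos by (auto simp: t_def)
    have "(real p + s * real b, line (real p + s * real b)) \<notin> path_points D" if s: "0 < s" "s < t" for s
    proof (rule line_not_path)
      show "real p < real p + s * real b" using s b_pos by simp
      have "s * real b < t * real b" using s b_pos by simp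
      then show "real p + s * real b < laser_end" using t x by linarith
    qed
    then show "z \<in> laser a b D (real p, real (height D p))"
      unfolding laser_def point using x(1) t by blast
  qed
qed

definition barrier :: "(real \<times> real) set" where
  "barrier = path_points D \<union> laser a b D (real p, real (height D p))"

lemma mem_barrier: "(x, y) \<in> barrier \<longleftrightarrow> (x, y) \<in> path_points D \<or> real p \<le> x \<and> x \<le> laser_end \<and> y = line x"
  by (auto simp: barrier_def laser_eq)

definition region :: "(real \<times> real) set" where
  "region = {z. real p < fst z \<and> fst z < laser_end \<and> line (fst z) < snd z} \<inter>
     (\<Inter>i\<in>{1..b}. {z. real i < fst z} \<union> {z. snd z < real (height D i)})"

definition closed_region :: "(real \<times> real) set" where
  "closed_region = {z. real p \<le> fst z \<and> fst z \<le> laser_end \<and> line (fst z) \<le> snd z} \<inter>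
     (\<Inter>i\<in>{1..b}. {z. real i \<le> fst z} \<union> {z. snd z \<le> real (height D i)})"

lemma mem_region: "(x, y) \<in> region \<longleftrightarrow> real p < x \<and> x < laser_end \<and> line x < y \<and>
    (\<forall>i\<in>{1..b}. x \<le> real i \<longrightarrow> y < real (height D i))"
  by (auto simp: region_def not_le[symmetric])

lemma mem_closed_region: "(x, y) \<in> closed_region \<longleftrightarrow> real p \<le> x \<and> x \<le> laser_end \<and> line x \<le> y \<and>
    (\<forall>i\<in>{1..b}. x < real i \<longrightarrow> y \<le> real (height D i))"
  by (auto simp: closed_region_def not_less[symmetric])

lemma continuous_line: "continuous_on S (\<lambda>z. line (fst z))"
  unfolding line_def by (intro continuous_intros)

lemma open_region: "open region"
  unfolding region_def
  by (intro open_Int open_INT open_Un ballI finite_atLeastAtMost open_Collect_conj open_Collect_less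
      continuous_line continuous_intros)

lemma closure_region: "closure region \<subseteq> closed_region"
proof (rule closure_minimal)
  show "closed closed_region"
    unfolding closed_region_def
    by (intro closed_Int closed_INT closed_Un ballI closed_Collect_conj closed_Collect_le
        continuous_line continuous_intros)
  show "region \<subseteq> closed_region"
  proof
    fix z assume "z \<in> region"
    then show "z \<in> closed_region" by (cases z) (force simp: mem_region mem_closed_region)
  qed
qed

lemma boundary_above_line:
  assumes closed: "(x, y) \<in> closed_region" and "(x, y) \<notin> region"
    and x_bounds: "real p < x" "x < laser_end" and "line x < y"
  shows "(x, y) \<in> path_points D"
proof -
  have ceiling: "y \<le> real (height D i)" if "1 \<le> i" "i \<le> b" "x < real i" for i
    using closed that by (simp add: mem_closed_region)
  obtain i where i: "i \<in> {1..b}" "x \<le> real i" "real (height D i) \<le> y"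
    using assms by (force simp: mem_region)
  obtain k where k: "1 \<le> k" "k \<le> b" "p < k" "k \<le> stop" "real k - 1 < x" "x \<le> real k"
    using ceiling_index x_bounds by (metis less_imp_le)
  have "k \<le> i" using k(5) i(2) by linarith
  then have above: "real (height D k) \<le> y" using height_mono[of k i] i by simp
  show ?thesis
  proof (cases "x = real k")
    case True
    then have "k < b" using x_bounds laser_end_le_b by simp
    then have "y \<le> real (height D (Suc k))" using ceiling[of "Suc k"] True by simp
    then show ?thesis using vertical_path_points[OF k(1) \<open>k < b\<close> above] True by simp
  next
    case False
    then have "y = real (height D k)" using ceiling[of k] k above by simp
    then show ?thesis using horizontal_path_points[OF k(1,2), of x] k by simp
  qed
qed

lemma frontier_region: "frontier region \<subseteq> barrier"
proof
  fix z assume "z \<in> frontier region"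
  moreover obtain x y where z: "z = (x, y)" by force
  ultimately have mem: "(x, y) \<in> closed_region" "(x, y) \<notin> region"
    using closure_region by (auto simp: frontier_def interior_open[OF open_region])
  then have line: "real p \<le> x" "x \<le> laser_end" "line x \<le> y" by (simp_all add: mem_closed_region)
  have ceiling: "y \<le> real (height D i)" if "1 \<le> i" "i \<le> b" "x < real i" for i
    using mem(1) that by (simp add: mem_closed_region)
  consider (left) "x = real p" | (right) "x = laser_end" | (between) "real p < x" "x < laser_end"
    using line by linarith
  then show "z \<in> barrier"
  proof cases
    case left
    then have "y \<le> real (height D (Suc p))" using ceiling[of "Suc p"] p_less by simp
    moreover have "real (height D p) \<le> y" using line(3) left line_p by simp
    ultimately show ?thesis
      using vertical_path_points[OF p_pos p_less] left by (simp add: z mem_barrier)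
  next
    case right
    then have "y = real (height D stop)"
      using ceiling[of stop] line(3) line_laser_end laser_end_less p_less_stop stop_le by simp
    then show ?thesis using laser_end_in_path right by (simp add: z mem_barrier line_laser_end)
  next
    case between
    then show ?thesis
      using boundary_above_line[OF mem] line by (cases "line x = y") (auto simp: z mem_barrier)
  qed
qed

lemma region_avoids_barrier: "region \<inter> barrier = {}"
proof -
  have "(x, y) \<notin> barrier" if region: "(x, y) \<in> region" for x y
  proof -
    obtain i where i: "1 \<le> i" "i \<le> b" "real i - 1 < x" "x \<le> real i"
      using ceiling_index[of x] region by (auto simp: mem_region)
    then have "y < real (height D i)" using region by (simp add: mem_region)
    then have "(x, y) \<notin> path_points D" using path_points_above[OF _ i(2,3)] by force
    then show ?thesis using region by (simp add: mem_barrier mem_region)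
  qed
  then show ?thesis by auto
qed

definition small :: "real \<Rightarrow> bool" where
  "small \<epsilon> \<longleftrightarrow> 0 < \<epsilon> \<and> (\<forall>i. inside i \<longrightarrow> line (real i) < real (height D i) - \<epsilon>)"

lemma eventually_small: "\<forall>\<^sub>F \<epsilon> in at_right 0. small \<epsilon>"
proof -
  have "\<forall>\<^sub>F \<epsilon> in at_right 0. 0 < \<epsilon> \<and> (\<forall>i\<in>{p<..<stop}. line (real i) < real (height D i) - \<epsilon>)"
  proof (intro eventually_conj eventually_ball_finite ballI)
    show "\<forall>\<^sub>F \<epsilon> in at_right (0 :: real). 0 < \<epsilon>" by (rule eventually_at_right_less)
    fix i assume "i \<in> {p<..<stop}"
    then have "0 < real (height D i) - line (real i)"
      using inside_above_line by (simp add: inside_def)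
    then have "\<forall>\<^sub>F \<epsilon> in at_right 0. \<epsilon> < real (height D i) - line (real i)"
      by (intro eventually_at_rightI[of 0]) auto
    then show "\<forall>\<^sub>F \<epsilon> in at_right 0. line (real i) < real (height D i) - \<epsilon>"
      by eventually_elim linarith
  qed simp
  then show ?thesis by eventually_elim (auto simp: small_def inside_def)
qed

lemma label_in_region_iff:
  assumes "small \<epsilon>" "1 \<le> i" "i \<le> b"
  shows "label D \<epsilon> i \<in> region \<longleftrightarrow> inside i"
proof
  assume "inside i"
  moreover have "real (height D i) - \<epsilon> < real (height D k)" if "k \<in> {1..b}" "i \<le> k" for k
    using height_mono[of i k] that assms(1) by (simp add: small_def)
  ultimately show "label D \<epsilon> i \<in> region"
    using assms(1) less_laser_end[of i]
    by (auto simp: label_eq[OF assms(2,3)] mem_region small_def inside_def)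
next
  assume "label D \<epsilon> i \<in> region"
  then show "inside i"
    using laser_end_less by (simp add: label_eq[OF assms(2,3)] mem_region inside_def)
qed

lemma segment_in_region:
  assumes "(real i, y) \<in> region" "(real (Suc i), y') \<in> region" "y \<le> y'"
  shows "closed_segment (real i, y) (real (Suc i), y') \<subseteq> region"
proof
  fix z assume "z \<in> closed_segment (real i, y) (real (Suc i), y')"
  then obtain u where u: "0 \<le> u" "u \<le> 1" "z = (real i + u, y + u * (y' - y))"
    by (auto simp: in_segment algebra_simps)
  have "h + c * (x + u - t) = (1 - u) * (h + c * (x - t)) + u * (h + c * (1 + x - t))" for c h x t :: real
    by (simp add: algebra_simps)
  then have "line (real i + u) = (1 - u) * line (real i) + u * line (real (Suc i))"
    unfolding line_def of_nat_Suc .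
  also have "\<dots> < (1 - u) * y + u * y'"
    using assms(1,2) u
    by (cases "u = 0") (auto simp: mem_region intro!: add_le_less_mono mult_left_mono mult_strict_left_mono)
  finally have "line (real i + u) < y + u * (y' - y)" by (simp add: algebra_simps)
  moreover have "real i + u < laser_end" "real p < real i + u"
    using assms(1,2) u by (auto simp: mem_region)
  moreover have "y + u * (y' - y) < real (height D k)" if "k \<in> {1..b}" "real i + u \<le> real k" for k
  proof (cases "u = 0")
    case True
    then show ?thesis using assms(1) that by (simp add: mem_region)
  next
    case False
    then have "real i < real k" using that u by linarith
    then have "real (Suc i) \<le> real k" by simp
    then have "y' < real (height D k)" using assms(2) that by (simp add: mem_region)
    moreover have "u * (y' - y) \<le> 1 * (y' - y)" using u assms(3) by (intro mult_right_mono) auto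
    ultimately show ?thesis by simp
  qed
  ultimately show "z \<in> region" by (simp add: u(3) mem_region)
qed

lemma inside_connected_Suc:
  assumes "small \<epsilon>" "inside i" "inside (Suc i)"
  shows "connected_component (- barrier) (label D \<epsilon> i) (label D \<epsilon> (Suc i))"
proof -
  have i_bounds: "1 \<le> i" "Suc i \<le> b" using assms(2,3) stop_le by (auto simp: inside_def)
  have "closed_segment (label D \<epsilon> i) (label D \<epsilon> (Suc i)) \<subseteq> region"
    using segment_in_region[of i "real (height D i) - \<epsilon>" "real (height D (Suc i)) - \<epsilon>"]
      label_in_region_iff[OF assms(1), of i] label_in_region_iff[OF assms(1), of "Suc i"]
      height_mono[of i "Suc i"] assms(2,3) i_bounds by (simp add: label_eq)
  then have "closed_segment (label D \<epsilon> i) (label D \<epsilon> (Suc i)) \<subseteq> - barrier"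
    using region_avoids_barrier by blast
  then show ?thesis
    by (intro connected_componentI[of "closed_segment (label D \<epsilon> i) (label D \<epsilon> (Suc i))"]) auto
qed

lemma inside_connected_le:
  assumes "small \<epsilon>" "i \<le> j" "inside i" "inside j"
  shows "connected_component (- barrier) (label D \<epsilon> i) (label D \<epsilon> j)"
  using assms(2,4)
proof (induction j rule: dec_induct)
  case base
  have "label D \<epsilon> i \<in> region"
    using label_in_region_iff[OF assms(1), of i] assms(3) stop_le by (simp add: inside_def)
  then show ?case using region_avoids_barrier by auto
next
  case (step j)
  then have "inside j" using assms(3) by (simp add: inside_def)
  then show ?case
    using step inside_connected_Suc[OF assms(1)] connected_component_trans by blast
qed

lemma outside_connected:
  assumes "0 < \<epsilon>" "1 \<le> i" "i \<le> b" "\<not> inside i"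
  shows "connected_component (- barrier) (label D \<epsilon> i) (0, - 1)"
proof -
  have "(real i, y) \<notin> barrier" if "y < real (height D i)" for y
  proof -
    have "(real i, y) \<notin> path_points D" using path_points_above[OF _ assms(3)] that by force
    moreover have "\<not> (real p \<le> real i \<and> real i \<le> laser_end \<and> y = line (real i))"
    proof
      assume laser: "real p \<le> real i \<and> real i \<le> laser_end \<and> y = line (real i)"
      then have "i = p" using laser_end_less assms(4) by (auto simp: inside_def)
      then show False using laser line_p that by simp
    qed
    ultimately show ?thesis by (simp add: mem_barrier)
  qed
  moreover have "closed_segment (label D \<epsilon> i) (real i, - 1) \<subseteq> {real i} \<times> {..<real (height D i)}"
    using assms(1)
    by (intro closed_segment_subset convex_Times) (auto simp: label_eq[OF assms(2,3)])
  ultimately have "closed_segment (label D \<epsilon> i) (real i, - 1) \<subseteq> - barrier" by fastforce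
  then have "connected_component (- barrier) (label D \<epsilon> i) (real i, - 1)"
    by (intro connected_componentI[of "closed_segment (label D \<epsilon> i) (real i, - 1)"]) auto
  moreover have "(x, - 1) \<notin> barrier" for x
    using path_points_range(3)[of x "- 1"] line_le_iff[of "real p" x] line_p
    by (force simp: mem_barrier)
  then have "closed_segment (real i, - 1) (0, - 1) \<subseteq> - barrier" by (auto simp: in_segment)
  then have "connected_component (- barrier) (real i, - 1) (0, - 1)"
    by (intro connected_componentI[of "closed_segment (real i, - 1) (0, - 1)"]) auto
  ultimately show ?thesis by (rule connected_component_trans)
qed

lemma connected_labels_iff:
  assumes small: "small \<epsilon>" and i_bounds: "1 \<le> i" "i \<le> b" and j_bounds: "1 \<le> j" "j \<le> b"
  shows "connected_component (- barrier) (label D \<epsilon> i) (label D \<epsilon> j) \<longleftrightarrow> (inside i \<longleftrightarrow> inside j)"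
proof
  assume "connected_component (- barrier) (label D \<epsilon> i) (label D \<epsilon> j)"
  then obtain T where T: "connected T" "T \<subseteq> - barrier" "label D \<epsilon> i \<in> T" "label D \<epsilon> j \<in> T"
    unfolding connected_component_def by blast
  then have "T \<inter> frontier region = {}" using frontier_region by blast
  then have "T \<inter> region = {} \<or> T - region = {}" using connected_Int_frontier[OF T(1)] by blast
  then show "inside i \<longleftrightarrow> inside j"
    using T(3,4) label_in_region_iff[OF small i_bounds] label_in_region_iff[OF small j_bounds]
    by blast
next
  assume inside_eq: "inside i \<longleftrightarrow> inside j"
  show "connected_component (- barrier) (label D \<epsilon> i) (label D \<epsilon> j)"
  proof (cases "inside i")
    case True
    then show ?thesis
      using inside_connected_le[OF small] inside_eq connected_component_sym by (metis linear)
  next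
    case False
    have "0 < \<epsilon>" using small by (simp add: small_def)
    then show ?thesis
      using outside_connected[OF _ i_bounds False] outside_connected[OF _ j_bounds] False inside_eq
      by (metis connected_component_sym connected_component_trans)
  qed
qed

lemma separated_iff:
  assumes "1 \<le> i" "i \<le> b" "1 \<le> j" "j \<le> b"
  shows "separated D (laser a b D (real p, real (height D p))) i j \<longleftrightarrow> inside i \<noteq> inside j"
proof -
  have "separated D (laser a b D (real p, real (height D p))) i j \<longleftrightarrow>
      (\<forall>\<^sub>F \<epsilon> in at_right (0 :: real). inside i \<noteq> inside j)"
    unfolding separated_def barrier_def[symmetric]
    by (rule eventually_cong[OF eventually_small]) (simp add: connected_labels_iff[OF _ assms])
  then show ?thesis by simp
qed

end

section \<open>Dyck paths as words\<close>

definition path_word :: "nat \<Rightarrow> step list \<Rightarrow> int \<Rightarrow> nat" where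
  "path_word N D j = (let i = nat (j mod int N) in height D (Suc i) - height D i)"

lemma path_word_of_nat: "i < N \<Longrightarrow> path_word N D (int i) = height D (Suc i) - height D i"
  by (simp add: path_word_def Let_def flip: of_nat_mod)

lemma periodic_path_word: "periodic (path_word N D) (int N)"
  by (simp add: periodic_fun_simple_def path_word_def)

context dyck_path begin

abbreviation word :: "int \<Rightarrow> nat" where
  "word \<equiv> path_word N D"

lemma psum_word: "i \<le> N \<Longrightarrow> psum word (int i) = int (height D i)"
proof (induction i)
  case (Suc i)
  then have "height D i \<le> height D (Suc i)" by (intro height_mono) (simp_all add: b_eq)
  then show ?case
    using Suc psum_add_1[of word "int i"] path_word_of_nat[of i N D] by (simp add: add.commute)
qed simp

lemma ht_word: "i \<le> N \<Longrightarrow> walk.ht word (int i) = int b * int (height D i) - int a * int i"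
  by (simp add: walk.ht_def psum_word)

lemma full_word: "walk.full word"
  using psum_word[of N] by (simp add: walk.full_def periodic_path_word height_N)

lemma is_root_word: "walk.is_root word 0"
proof (rule walk.is_rootI[OF full_word])
  fix j assume "j \<in> {0<..0 + int N}"
  then obtain i where i: "j = int i" "1 \<le> i" "i \<le> N" by (intro that[of "nat j"]) auto
  have "int (a * i) \<le> int (b * height D i)" unfolding of_nat_le_iff using height_ge i b_eq by simp
  then have "0 \<le> walk.ht word j" using ht_word[OF i(3)] i by simp
  moreover have "walk.ht word 0 \<noteq> walk.ht word j" using walk.ht_inj[of word 0 j] i b_eq by auto
  ultimately show "walk.ht word 0 < walk.ht word j" by simp
qed

lemma word_in_dyck_words: "word \<in> walk.dyck_words"
  using full_word is_root_word by (simp add: walk.dyck_words_def)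

lemma valley_at_iff:
  assumes "1 \<le> p" "p < N" shows "valley_at p \<longleftrightarrow> 0 < word (int p)"
  using assms path_word_of_nat[of p N D] b_eq unfolding valley_at_def by auto

end

context dyck_valley begin

lemma ht_word_less_iff:
  assumes "k \<le> N"
  shows "walk.ht word (int p) < walk.ht word (int k) \<longleftrightarrow> line (real k) < real (height D k)"
proof -
  have "real_of_int (walk.ht word (int i)) = real b * real (height D i) - real a * real i" if "i \<le> N" for i
    by (simp add: ht_word[OF that])
  then have "walk.ht word (int p) < walk.ht word (int k) \<longleftrightarrow>
      real b * real (height D p) - real a * real p < real b * real (height D k) - real a * real k"
    using assms p_less b_eq by (simp flip: of_int_less_iff[where 'a = real])
  also have "\<dots> \<longleftrightarrow> line (real k) < real (height D k)"
    using b_pos by (simp add: line_def field_simps)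
  finally show ?thesis .
qed

lemma inside_iff_ancestor:
  assumes k_range: "k \<in> {1..N}" shows "inside k \<longleftrightarrow> walk.ancestor word (int p) (int k)"
proof
  assume "inside k"
  have "walk.ht word (int p) < walk.ht word t" if t: "int p < t" "t \<le> int k" for t
  proof -
    obtain s where s: "t = int s" "p < s" "s \<le> k" using t by (intro that[of "nat t"]) auto
    then have "line (real s) < real (height D s)"
      using \<open>inside k\<close> by (intro inside_above_line) (simp add: inside_def)
    then show ?thesis using ht_word_less_iff[of s] s k_range by simp
  qed
  then show "walk.ancestor word (int p) (int k)"
    using \<open>inside k\<close> by (simp add: walk.ancestor_def inside_def)
next
  assume anc: "walk.ancestor word (int p) (int k)"
  have "k < stop"
  proof (rule ccontr)
    assume "\<not> k < stop"
    then have "walk.ht word (int p) < walk.ht word (int stop)"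
      using anc p_less_stop by (simp add: walk.ancestor_def)
    then show False using ht_word_less_iff[of stop] stop_le_line \<open>\<not> k < stop\<close> k_range by simp
  qed
  then show "inside k" using anc by (simp add: walk.ancestor_def inside_def)
qed

end

context dyck_path begin

lemma separated_iff_ancestor:
  assumes valley: "valley_at p" and labels: "i \<in> {1..N}" "j \<in> {1..N}"
  shows "separated D (laser a b D (real p, real (height D p))) i j \<longleftrightarrow>
    walk.ancestor word (int p) (int i) \<noteq> walk.ancestor word (int p) (int j)"
proof -
  interpret dyck_valley a b N D p by unfold_locales (rule valley)
  show ?thesis using separated_iff[of i j] inside_iff_ancestor labels b_eq by simp
qed

lemma parent_le_if_not_separated:
  assumes "walk.parent word s (int i)" "walk.parent word t (int j)" "i \<in> {1..N}" "j \<in> {1..N}"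
    and ancestor_iff: "\<And>p. valley_at p \<Longrightarrow>
      walk.ancestor word (int p) (int i) \<longleftrightarrow> walk.ancestor word (int p) (int j)"
  shows "t \<le> s"
proof (rule ccontr)
  assume "\<not> t \<le> s"
  moreover have "0 \<le> s"
    using walk.cut_if_is_root[OF is_root_word] assms(1,3) by (auto simp: walk.cut_def)
  ultimately obtain p where p: "t = int p" "1 \<le> p" by (intro that[of "nat t"]) auto
  have "t < int j" using assms(2) by (simp add: walk.parent_def)
  then have "valley_at p"
    using walk.parent_add_1[OF assms(2)] p assms(4)
    by (simp add: valley_at_iff walk.parent_add_1_iff)
  then have "walk.ancestor word t (int i)"
    using ancestor_iff p(1) walk.parent_imp_ancestor[OF assms(2)] by simp
  then show False using assms(1) \<open>\<not> t \<le> s\<close> walk.parent_iff_ancestor by blast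
qed

lemma not_separated_iff_linked:
  assumes labels: "i \<in> {1..N}" "j \<in> {1..N}"
  shows "(\<forall>P\<in>valleys D. \<not> separated D (laser a b D P) i j) \<longleftrightarrow> walk.linked word (int i) (int j)"
proof -
  have "(\<forall>P\<in>valleys D. \<not> separated D (laser a b D P) i j) \<longleftrightarrow>
      (\<forall>p. valley_at p \<longrightarrow> (walk.ancestor word (int p) (int i) \<longleftrightarrow> walk.ancestor word (int p) (int j)))"
    using separated_iff_ancestor[OF _ labels] by (auto simp: valleys_eq)
  also have "\<dots> \<longleftrightarrow> walk.siblings word (int i) (int j)"
  proof
    assume ancestor_iff: "\<forall>p. valley_at p \<longrightarrow>
      (walk.ancestor word (int p) (int i) \<longleftrightarrow> walk.ancestor word (int p) (int j))"
    obtain s t where s: "walk.parent word s (int i)" and t: "walk.parent word t (int j)"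
      using walk.full_parent_ex[OF full_word] by metis
    have "s = t"
      using parent_le_if_not_separated[OF s t labels]
        parent_le_if_not_separated[OF t s labels(2,1)] ancestor_iff
      by force
    then show "walk.siblings word (int i) (int j)" using walk.siblings_if_parent s t by simp
  qed (simp add: walk.siblings_iff_ancestor)
  also have "\<dots> \<longleftrightarrow> walk.linked word (int i) (int j)"
    using walk.linked_iff_siblings[OF periodic_path_word walk.cut_if_is_root[OF is_root_word]]
      labels
    by simp
  finally show ?thesis .
qed

lemma laser_partition_eq: "laser_partition a b D = walk.partition_of word"
proof -
  have "{(i, j). i \<in> {1..N} \<and> j \<in> {1..N} \<and> (\<forall>P\<in>valleys D. \<not> separated D (laser a b D P) i j)} =
      walk.label_rel word"
    unfolding walk.label_rel_def nat_int
    by (intro Collect_cong) (use not_separated_iff_linked in auto)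
  moreover have "b - 1 = N" by (simp add: b_eq)
  ultimately show ?thesis unfolding laser_partition_def walk.partition_of_def nat_int by simp
qed

end

definition path_of :: "nat list \<Rightarrow> step list" where
  "path_of vs = concat (map (\<lambda>v. replicate v North @ [East]) vs)"

lemma path_of_snoc: "path_of (vs @ [v]) = (path_of vs @ replicate v North) @ [East]"
  by (simp add: path_of_def)

lemma count_list_replicate: "count_list (replicate n s) t = (if s = t then n else 0)"
  by (induction n) auto

lemma count_list_path_of:
  "count_list (path_of vs) East = length vs" "count_list (path_of vs) North = sum_list vs"
  by (induction vs) (auto simp: path_of_def count_list_replicate)

lemma east_steps_append_replicate: "east_steps (D @ replicate n North) = east_steps D"
proof (induction n)
  case (Suc n)
  have "D @ replicate (Suc n) North = (D @ replicate n North) @ [North]"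
    by (simp add: replicate_append_same)
  then show ?case using Suc by (simp only: east_steps_snoc) simp
qed simp

lemma height_path_of: "i \<le> length vs \<Longrightarrow> height (path_of vs) i = sum_list (take i vs)"
proof (induction vs rule: rev_induct)
  case (snoc v vs)
  let ?D = "path_of vs" and ?D' = "path_of (vs @ [v])"
  have steps: "east_steps ?D' = east_steps ?D @ [length ?D + v]"
    unfolding path_of_snoc east_steps_snoc east_steps_append_replicate by simp
  have len: "length (east_steps ?D) = length vs" by (simp add: length_east_steps count_list_path_of)
  show ?case
  proof (cases "i = Suc (length vs)")
    case True
    then have "height ?D' i = count_list (take (length ?D + v) ?D') North"
      using len by (simp add: height_def steps norths_def nth_append)
    also have "take (length ?D + v) ?D' = ?D @ replicate v North" by (simp add: path_of_snoc)
    finally show ?thesis using True by (simp add: count_list_path_of count_list_replicate)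
  next
    case False
    then have i_le: "i \<le> length vs" using snoc.prems by simp
    have "height ?D' i = height ?D i"
    proof (cases "i = 0")
      case False
      then have "east_steps ?D ! (i - 1) < length ?D"
        using i_le east_steps_nth[of "i - 1" ?D] by (simp add: count_list_path_of)
      then have "take (east_steps ?D ! (i - 1)) ?D' = take (east_steps ?D ! (i - 1)) ?D"
        by (simp add: path_of_snoc)
      then show ?thesis using False i_le len by (simp add: height_def steps norths_def nth_append)
    qed simp
    then show ?thesis using snoc.IH i_le by simp
  qed
qed simp

context nat_slope begin

definition word_path :: "(int \<Rightarrow> nat) \<Rightarrow> step list" where
  "word_path u = path_of (map (\<lambda>i. u (int i)) [0..<N] @ [0])"

lemma height_word_path:
  assumes "i \<le> N" shows "int (height (word_path u) i) = psum u (int i)"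
  using assms height_path_of[of i "map (\<lambda>i. u (int i)) [0..<N] @ [0]"]
  by (simp add: word_path_def take_map psum_of_nat interv_sum_list_conv_sum_set_nat atLeast0LessThan)

lemma path_word_word_path:
  assumes "periodic u (int N)" shows "path_word N (word_path u) = u"
proof
  fix j
  define i where "i = nat (j mod int N)"
  have i: "i < N" "int i = j mod int N" using N_pos by (auto simp: i_def nat_less_iff)
  have "int (height (word_path u) (Suc i)) = int (height (word_path u) i) + int (u (int i))"
    using height_word_path[of i u] height_word_path[of "Suc i" u] i psum_add_1[of u "int i"]
    by (simp add: add.commute)
  then have "path_word N (word_path u) j = u (int i)"
    by (simp add: path_word_def Let_def flip: i_def)
  then show "path_word N (word_path u) j = u j" using periodic_mod[OF assms, of j] i by simp
qed

lemma word_path_in_dyck_paths: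
  assumes "u \<in> walk.dyck_words" shows "word_path u \<in> dyck_paths a b"
proof -
  let ?vs = "map (\<lambda>i. u (int i)) [0..<N] @ [0]"
  have full: "walk.full u" and root: "walk.is_root u 0"
    using assms by (auto simp: walk.dyck_words_def)
  have len: "length ?vs = b" by (simp add: b_eq)
  have "int (sum_list ?vs) = int a"
    using full
    by (simp add: walk.full_def psum_of_nat interv_sum_list_conv_sum_set_nat atLeast0LessThan)
  then have sum: "sum_list ?vs = a" by (simp only: of_nat_eq_iff)
  have "a * i \<le> b * height (word_path u) i" if i: "i \<le> b" for i
  proof (cases "i = b")
    case True
    then show ?thesis using height_path_of[of b ?vs] len sum by (simp add: word_path_def)
  next
    case False
    then have "i \<le> N" using i b_eq by simp
    have "0 \<le> walk.ht u (int i)"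
      using root walk.ht_0[of u] by (cases "i = 0") (auto simp: walk.is_root_def intro: less_imp_le)
    then have "int (a * i) \<le> int (b * height (word_path u) i)"
      using height_word_path[OF \<open>i \<le> N\<close>, of u] by (simp add: walk.ht_def)
    then show ?thesis by (simp only: of_nat_le_iff)
  qed
  then show ?thesis
    using dyck_paths_iff[OF b_pos] count_list_path_of[of ?vs] len sum by (simp add: word_path_def)
qed

lemma NC_eq: "NC a b = walk.partition_of ` Collect walk.full"
proof -
  have partition: "laser_partition a b D = walk.partition_of (path_word N D)"
    "path_word N D \<in> walk.dyck_words" if "D \<in> dyck_paths a b" for D
  proof -
    interpret dyck_path a b N D using that by unfold_locales
    show "laser_partition a b D = walk.partition_of (path_word N D)" "path_word N D \<in> walk.dyck_words"
      by (rule laser_partition_eq word_in_dyck_words)+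
  qed
  have "NC a b = walk.partition_of ` walk.dyck_words"
  proof (intro subset_antisym subsetI)
    fix \<pi> assume "\<pi> \<in> walk.partition_of ` walk.dyck_words"
    then obtain u where u: "u \<in> walk.dyck_words" "\<pi> = walk.partition_of u" by blast
    then have "path_word N (word_path u) = u"
      using path_word_word_path walk.full_periodic by (simp add: walk.dyck_words_def)
    then show "\<pi> \<in> NC a b"
      using partition(1)[OF word_path_in_dyck_paths[OF u(1)]] word_path_in_dyck_paths[OF u(1)] u(2)
      by (auto simp: NC_def)
  qed (use partition in \<open>auto simp: NC_def\<close>)
  then show ?thesis using walk.bij_betw_dyck_words by (simp add: bij_betw_def)
qed

lemma NC_blocks_eq: "NC_blocks a b k = {\<pi> \<in> walk.partition_of ` Collect walk.full. card \<pi> = k}"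
  by (simp add: NC_blocks_def NC_eq)

end

section \<open>Cyclic sieving\<close>

lemma primitive_unity_root_dvd:
  assumes "primitive_unity_root n z" "0 < n" "z ^ m = 1" shows "n dvd m"
proof -
  have "z ^ m = (z ^ n) ^ (m div n) * z ^ (m mod n)"
    by (metis div_mult_mod_eq mult.commute power_add power_mult)
  then have "z ^ (m mod n) = 1" using assms by (simp add: primitive_unity_root_def)
  moreover have "m mod n < n" using assms(2) by simp
  ultimately have "m mod n = 0"
    using assms(1) unfolding primitive_unity_root_def by (meson neq0_conv)
  then show ?thesis by (simp add: dvd_eq_mod_eq_0)
qed

lemma primitive_unity_root_power:
  assumes "primitive_unity_root n z" "0 < n"
  shows "primitive_unity_root (n div gcd d n) (z ^ d)"
  unfolding primitive_unity_root_def
proof (intro conjI allI impI notI)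
  have "d * (n div gcd d n) = n * (d div gcd d n)"
    by (metis div_mult_swap dvd_div_mult gcd_dvd1 gcd_dvd2 mult.commute)
  then have "(z ^ d) ^ (n div gcd d n) = (z ^ n) ^ (d div gcd d n)" by (metis power_mult)
  then show "(z ^ d) ^ (n div gcd d n) = 1" using assms by (simp add: primitive_unity_root_def)
  fix m assume m: "0 < m \<and> m < n div gcd d n" and "(z ^ d) ^ m = 1"
  then have "n dvd d * m" using primitive_unity_root_dvd[OF assms] by (simp add: power_mult)
  moreover have "d * m = (d div gcd d n) * m * gcd d n"
    by (simp add: mult.commute mult.left_commute)
  ultimately have "(n div gcd d n) * gcd d n dvd (d div gcd d n) * m * gcd d n" by simp
  then have "n div gcd d n dvd (d div gcd d n) * m"
    by (rule dvd_times_right_cancel_iff[THEN iffD1, rotated]) (use assms(2) in simp)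
  moreover have "coprime (n div gcd d n) (d div gcd d n)"
    using div_gcd_coprime[of d n] assms(2) by (simp add: coprime_commute)
  ultimately have "n div gcd d n dvd m" by (simp add: coprime_dvd_mult_right_iff)
  then show False using m nat_dvd_not_less by blast
qed

lemma funpow_fixed_multiple: "(r ^^ g) x = x \<Longrightarrow> (r ^^ (g * m)) x = x"
  by (induction m) (simp_all add: funpow_add)

lemma funpow_fixed_gcd:
  assumes "(r ^^ n) x = x" "0 < d" shows "(r ^^ d) x = x \<longleftrightarrow> (r ^^ gcd d n) x = x"
proof
  assume "(r ^^ gcd d n) x = x"
  moreover obtain m where "d = gcd d n * m" by (meson dvdE gcd_dvd1)
  ultimately show "(r ^^ d) x = x" by (metis funpow_fixed_multiple)
next
  assume fixed: "(r ^^ d) x = x"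
  obtain s t where st: "d * s = n * t + gcd d n" using bezout_nat assms(2) by blast
  have "x = (r ^^ (d * s)) x" using funpow_fixed_multiple[OF fixed] by simp
  also have "\<dots> = (r ^^ gcd d n) ((r ^^ (n * t)) x)"
    unfolding st by (metis add.commute comp_apply funpow_add)
  also have "\<dots> = (r ^^ gcd d n) x" using funpow_fixed_multiple[OF assms(1)] by simp
  finally show "(r ^^ gcd d n) x = x" by simp
qed

lemma generate_integer_mod_group:
  assumes "0 < n" shows "generate (integer_mod_group n) {1 mod int n} = carrier (integer_mod_group n)"
proof -
  let ?G = "integer_mod_group n"
  have "generate ?G {1 mod int n} = {(1 mod int n) [^]\<^bsub>?G\<^esub> (m :: int) |m. m \<in> UNIV}"
    by (rule group.generate_pow[OF group_integer_mod_group])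
      (use assms in \<open>simp add: carrier_integer_mod_group\<close>)
  also have "\<dots> = range (\<lambda>m. m mod int n)"
    by (auto simp: int_pow_integer_mod_group mod_mult_right_eq)
  also have "\<dots> = {0..<int n}"
  proof (intro subset_antisym subsetI)
    fix x assume "x \<in> {0..<int n}"
    then show "x \<in> range (\<lambda>m. m mod int n)" by (intro range_eqI[of _ _ x]) simp
  qed (use assms in auto)
  finally show ?thesis using assms by (simp add: carrier_integer_mod_group)
qed

context
  fixes r :: "'x \<Rightarrow> 'x" and X :: "'x set" and n :: nat
  assumes n_pos: "0 < n" and closed: "\<And>x. x \<in> X \<Longrightarrow> r x \<in> X" and period: "\<And>x. x \<in> X \<Longrightarrow> (r ^^ n) x = x"
begin

lemma funpow_closed: "x \<in> X \<Longrightarrow> (r ^^ m) x \<in> X"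
  by (induction m) (auto intro: closed)

lemma funpow_in_Bij: "restrict (r ^^ m) X \<in> Bij X"
proof -
  have "bij_betw r X X"
  proof (rule bij_betwI[of _ _ _ "r ^^ (n - 1)"])
    fix x assume x: "x \<in> X"
    have "n = Suc (n - 1)" using n_pos by simp
    then have "(r ^^ Suc (n - 1)) x = x" using period[OF x] by metis
    then show "(r ^^ (n - 1)) (r x) = x" "r ((r ^^ (n - 1)) x) = x"
      by (simp_all only: funpow.simps(2) comp_apply flip: funpow_swap1)
  qed (use closed funpow_closed in auto)
  then show ?thesis by (simp add: Bij_def bij_betw_restrict_eq bij_betw_funpow)
qed

lemma group_action_funpow: "group_action (integer_mod_group n) X (\<lambda>d. restrict (r ^^ nat d) X)"
proof -
  let ?G = "integer_mod_group n" and ?\<phi> = "\<lambda>d. restrict (r ^^ nat d) X"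
  have "?\<phi> \<in> hom ?G (BijGroup X)"
  proof (rule homI)
    show "?\<phi> d \<in> carrier (BijGroup X)" for d by (simp add: BijGroup_def funpow_in_Bij)
    fix c d assume "c \<in> carrier ?G" "d \<in> carrier ?G"
    then have sum: "nat ((c + d) mod int n) = (nat c + nat d) mod n"
      using n_pos by (simp add: carrier_integer_mod_group nat_mod_distrib nat_add_distrib)
    have "(r ^^ ((nat c + nat d) mod n)) x = (r ^^ nat c) ((r ^^ nat d) x)" if "x \<in> X" for x
      using funpow_mod_eq[OF period[OF that], of "nat c + nat d"] by (simp add: funpow_add)
    then have "?\<phi> ((c + d) mod int n) = compose X (?\<phi> c) (?\<phi> d)"
      by (auto simp: sum compose_def funpow_closed)
    then show "?\<phi> (c \<otimes>\<^bsub>?G\<^esub> d) = ?\<phi> c \<otimes>\<^bsub>BijGroup X\<^esub> ?\<phi> d"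
      using funpow_in_Bij by (simp add: BijGroup_def)
  qed
  then show ?thesis
    by (simp add: group_action_def group_hom_def group_hom_axioms_def group_BijGroup)
qed

lemma funpow_mod_fixed_iff: "x \<in> X \<Longrightarrow> (r ^^ (d mod n)) x = x \<longleftrightarrow> (r ^^ gcd d n) x = x"
  using funpow_mod_eq[OF period, of x d] funpow_fixed_gcd[OF period, of x d] period[of x]
  by (cases "d = 0") auto

lemma cyclic_sieving_funpow:
  assumes fin: "finite X" and nonneg: "\<And>i. 0 \<le> coeff p i"
    and eval: "\<And>e g z. n = e * g \<Longrightarrow> primitive_unity_root e z \<Longrightarrow>
      poly (map_poly of_int p) z = of_nat (card {x \<in> X. (r ^^ g) x = x})"
  shows "cyclic_sieving (integer_mod_group n) (1 mod int n) (\<lambda>d. restrict (r ^^ nat d) X) X p"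
proof -
  let ?G = "integer_mod_group n"
  have carrier: "carrier ?G = {0..<int n}" using n_pos by (simp add: carrier_integer_mod_group)
  have "(1 mod int n) [^]\<^bsub>?G\<^esub> d = int (d mod n)" for d :: nat
    by (simp add: mod_mult_right_eq zmod_int)
  then have fixed: "{x \<in> X. restrict (r ^^ nat ((1 mod int n) [^]\<^bsub>?G\<^esub> d)) X x = x} =
      {x \<in> X. (r ^^ gcd d n) x = x}" for d :: nat
    using funpow_mod_fixed_iff[of _ d] by auto
  show ?thesis
    unfolding cyclic_sieving_def fixed
  proof (intro conjI allI impI)
    fix \<zeta> d assume "primitive_unity_root (Coset.order ?G) \<zeta>"
    then have "primitive_unity_root n \<zeta>" by (simp add: Coset.order_def carrier)
    then show "poly (map_poly of_int p) (\<zeta> ^ d) = of_nat (card {x \<in> X. (r ^^ gcd d n) x = x})"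
      using eval[of "n div gcd d n" "gcd d n" "\<zeta> ^ d"] primitive_unity_root_power[OF _ n_pos]
      by simp
  qed (use n_pos fin nonneg group_action_funpow generate_integer_mod_group carrier in auto)
qed

end

section \<open>The q-Narayana polynomial at roots of unity\<close>

context
  fixes a b k :: nat and p :: "int poly"
  assumes product: "q_int_poly (Suc b) * p = gauss_poly (Suc b) (Suc k) * gauss_poly a k"
begin

lemma eval_at_1_narayana: "of_nat (Suc b) * eval_at 1 p = of_nat ((Suc b choose Suc k) * (a choose k))"
  using arg_cong[OF product, of "eval_at 1"]
  by (simp add: eval_at_q_int_poly eval_at_1_gauss_poly del: gauss_poly.simps binomial_Suc_Suc)

lemma narayana_coeff_nonneg: "0 \<le> coeff p i"
  using sym_unimodal_mult[OF sym_unimodal_gauss_poly[of "Suc k" "Suc b"] sym_unimodal_gauss_poly[of k a]]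
  unfolding product[symmetric] by (rule coeff_quotient_nonneg[rotated]) simp

context
  fixes z :: complex and e g :: nat
  assumes two_le_e: "2 \<le> e" and primitive_z: "primitive_unity_root e z" and b_eq: "b = e * g"
begin

lemma eval_at_root_narayana_digits:
  "eval_at z p = of_nat (g choose (Suc k div e)) * eval_at z (gauss_poly 1 (Suc k mod e)) *
    (of_nat (a div e choose (k div e)) * eval_at z (gauss_poly (a mod e) (k mod e)))"
proof -
  have "eval_at z (q_int_poly (Suc b)) = 1"
    using z_neq_1[OF two_le_e primitive_z] z_power_e[OF two_le_e primitive_z]
    by (simp add: eval_at_q_int_poly_root[OF two_le_e primitive_z] b_eq power_mult)
  then have "eval_at z p = eval_at z (gauss_poly (Suc b) (Suc k)) * eval_at z (gauss_poly a k)"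
    using arg_cong[OF product, of "eval_at z"] by (simp del: gauss_poly.simps)
  moreover have "Suc b div e = g" "Suc b mod e = 1"
    using two_le_e by (auto simp: b_eq div_Suc mod_Suc)
  ultimately show ?thesis
    by (simp only: q_lucas[OF two_le_e primitive_z, of "Suc b" "Suc k"] q_lucas[OF two_le_e primitive_z, of a k])
qed

lemma eval_at_root_narayana: "eval_at z p = of_nat (fixed_narayana e g (Suc a) (Suc k))"
proof -
  have dvd_Suc_iff: "e dvd Suc m \<longleftrightarrow> Suc (m mod e) = e" for m
    using two_le_e by (simp add: dvd_eq_mod_eq_0 mod_Suc)
  have "k mod e < e" using two_le_e by simp
  then consider (last) "Suc (k mod e) = e" | (zero) "k mod e = 0"
    | (inner) "0 < k mod e" "Suc (k mod e) < e" by linarith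
  then show ?thesis
  proof cases
    case last
    then have k: "Suc k mod e = 0" "e dvd Suc k" "\<not> e dvd k"
      using two_le_e by (auto simp: mod_Suc dvd_Suc_iff dvd_eq_mod_eq_0)
    have "eval_at z (gauss_poly (a mod e) (k mod e)) = of_bool (e dvd Suc a)"
    proof (cases "e dvd Suc a")
      case True
      then have "a mod e = k mod e" using last dvd_Suc_iff[of a] by simp
      then show ?thesis using True by (simp add: gauss_poly_self)
    next
      case False
      then have "a mod e < k mod e"
        using last dvd_Suc_iff[of a] mod_less_divisor[of e a] two_le_e by linarith
      then show ?thesis using False by (simp add: gauss_poly_eq_0)
    qed
    then show ?thesis using eval_at_root_narayana_digits k by (simp add: fixed_narayana_def)
  next
    case zero
    then have "Suc k mod e = 1" "Suc k div e = k div e" "e dvd k" "\<not> e dvd Suc k"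
      using two_le_e by (auto simp: mod_Suc div_Suc dvd_Suc_iff dvd_eq_mod_eq_0)
    then show ?thesis
      using zero eval_at_root_narayana_digits gauss_poly_self[of 1]
      by (simp add: fixed_narayana_def)
  next
    case inner
    then have "1 < Suc k mod e" "\<not> e dvd k" "\<not> e dvd Suc k"
      by (auto simp: mod_Suc dvd_Suc_iff dvd_eq_mod_eq_0)
    then show ?thesis
      using eval_at_root_narayana_digits by (simp add: fixed_narayana_def gauss_poly_eq_0)
  qed
qed

end

end

context nat_slope begin

lemma eval_at_narayana_eq_card_fixed:
  assumes product: "q_int_poly b * p = gauss_poly b (Suc k) * gauss_poly (a - 1) k"
    and N_eq: "N = e * g" and primitive_z: "primitive_unity_root e z"
  shows "eval_at z p = of_nat (card {\<pi> \<in> NC_blocks a b (Suc k). (rot_partition N ^^ g) \<pi> = \<pi>})"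
proof -
  have product_N: "q_int_poly (Suc N) * p = gauss_poly (Suc N) (Suc k) * gauss_poly (a - 1) k"
    using product by (simp only: b_eq)
  have "0 < e" "0 < g" using N_eq N_pos by (auto intro!: Nat.gr0I)
  show ?thesis
  proof (cases "e = 1")
    case True
    then have "z = 1" "g = N" using primitive_z N_eq by (auto simp: primitive_unity_root_def)
    have "{\<pi> \<in> NC_blocks a b (Suc k). (rot_partition N ^^ g) \<pi> = \<pi>} = NC_blocks a b (Suc k)"
      using walk.rot_partition_period \<open>g = N\<close> by (auto simp: NC_blocks_eq)
    moreover have "b * card (NC_blocks a b (Suc k)) = (b choose Suc k) * (a - 1 choose k)"
      using walk.card_partitions[of k] by (simp add: NC_blocks_eq)
    then have "of_nat b * eval_at 1 p = of_nat b * of_nat (card (NC_blocks a b (Suc k)))"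
      using eval_at_1_narayana[OF product_N] b_eq by (metis of_nat_mult)
    then have "eval_at 1 p = of_nat (card (NC_blocks a b (Suc k)))" using b_pos by simp
    ultimately show ?thesis using \<open>z = 1\<close> by simp
  next
    case False
    then have two_le_e: "2 \<le> e" using \<open>0 < e\<close> by simp
    have "{\<pi> \<in> NC_blocks a b (Suc k). (rot_partition N ^^ g) \<pi> = \<pi>} =
        {\<pi> \<in> walk.partition_of ` Collect walk.full. card \<pi> = Suc k \<and> (rot_partition (nat (int N)) ^^ g) \<pi> = \<pi>}"
      by (auto simp: NC_blocks_eq)
    then have "card {\<pi> \<in> NC_blocks a b (Suc k). (rot_partition N ^^ g) \<pi> = \<pi>} = fixed_narayana e g a (Suc k)"
      using walk.card_fixed_partitions[OF \<open>0 < g\<close> two_le_e] N_eq by simp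
    then show ?thesis
      using eval_at_root_narayana[OF product_N two_le_e primitive_z N_eq] a_pos by simp
  qed
qed

lemma rot_partition_NC_blocks:
  assumes "\<pi> \<in> NC_blocks a b k"
  shows "rot_partition N \<pi> \<in> NC_blocks a b k" "(rot_partition N ^^ N) \<pi> = \<pi>"
  using assms walk.rot_partition_closed[of \<pi>] walk.card_rot_partition[of \<pi>]
    walk.rot_partition_period[of \<pi>]
  by (auto simp: NC_blocks_eq)

end

theorem theorem5p2:
  fixes a b k :: nat
  assumes "0 < a" and "a < b" and "coprime a b"
    and "1 \<le> k" and "k \<le> a"
  shows "\<exists>p :: int poly. to_fract p = q_narayana a b k \<and>
    cyclic_sieving (integer_mod_group (b - 1)) (1 mod int (b - 1))
      (rotation_action (b - 1) (NC_blocks a b k)) (NC_blocks a b k) p"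
proof -
  interpret nat_slope a b "b - 1" using assms by unfold_locales auto
  have Suc: "a = Suc (a - 1)" "b = Suc (b - 1)" "k = Suc (k - 1)"
    and pred_le: "k - 1 \<le> a - 1" "a - 1 \<le> b - 1" using assms by auto
  obtain p where p_eq: "to_fract p = q_narayana a b k"
    and narayana: "q_int_poly b * p = gauss_poly b k * gauss_poly (a - 1) (k - 1)"
    using narayana_poly_ex[OF pred_le, folded Suc, OF assms(3)] .
  have "finite (NC_blocks a b k)" using walk.finite_partitions by (simp add: NC_blocks_eq)
  moreover have "0 \<le> coeff p i" for i
    using narayana_coeff_nonneg[of "b - 1" p "k - 1" "a - 1" i] narayana
    by (simp only: Suc[symmetric])
  moreover have "poly (map_poly of_int p) z =
      of_nat (card {\<pi> \<in> NC_blocks a b k. (rot_partition (b - 1) ^^ g) \<pi> = \<pi>})"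
    if "b - 1 = e * g" "primitive_unity_root e z" for e g z
    using eval_at_narayana_eq_card_fixed[of p "k - 1" e g z] narayana that
    by (simp only: Suc(3)[symmetric] eval_at_def)
  ultimately have "cyclic_sieving (integer_mod_group (b - 1)) (1 mod int (b - 1))
      (rotation_action (b - 1) (NC_blocks a b k)) (NC_blocks a b k) p"
    unfolding rotation_action_def[abs_def]
    by (intro cyclic_sieving_funpow rot_partition_NC_blocks) (use N_pos in auto)
  then show ?thesis using p_eq by blast
qed

end
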